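(* Let $\Lambda\in\mathcal{P}(\mathfrak{C})$ and let $(\kappa_n)_n$ be a sequence in $(0,\infty)$ with $\lim_n\kappa_n=\kappa_\infty\in[0,\infty)\cup\{\infty\}$. For each $n$, let $\nu_n\in\mathfrak{C}$ be a minimizer of $J_{\Lambda,\kappa_n}$ over $\mathcal{M}_+(\Omega)$. Then the sequence $(\nu_n)_n$ is weak* pre-compact and each cluster point $\nu_\infty\in\mathfrak{C}$ is a minimizer of $J_{\Lambda,\kappa_\infty}$ over $\mathcal{M}_+(\Omega)$. Furthermore, $$J_{\Lambda,\kappa_\infty}(\nu_\infty)=\lim_{n\to\infty}J_{\Lambda,\kappa_n}(\nu_n)\quad\text{if }\kappa_\infty\in[0,\infty),$$ and $$J_{\Lambda,\infty}(\nu_\infty)=\lim_{n\to\infty}\kappa_n^2\,J_{\Lambda,\kappa_n}(\nu_n)\quad\text{if }\kappa_\infty=\infty.$$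
   Context: $\Omega \subset \mathbb{R}^d$ is a compact convex set with non-empty interior. $\mathcal{M}_+(\Omega)$ denotes the non-negative Radon measures on $\Omega$ with the weak* topology (duality with continuous functions), and $\|\mu\| = \mu(\Omega)$. For $\kappa\in(0,\infty)$ and $\mu,\nu\in\mathcal{M}_+(\Omega)$ the Hellinger--Kantorovich distance is $$\mathrm{HK}_\kappa^2(\mu,\nu) := \inf_{\gamma\in\mathcal{M}_+(\Omega\times\Omega)} \int \hat c_\kappa\,d\gamma + \mathrm{KL}(P_1\gamma|\mu)+\mathrm{KL}(P_2\gamma|\nu),$$ where $P_1\gamma,P_2\gamma$ are the two marginals of $\gamma$, $\hat c_\kappa(x,y) = -2\log\cos(|x-y|/\kappa)$ if $|x-y|\le\kappa\pi/2$ (with $-\log 0=+\infty$) and $+\infty$ otherwise, and $\mathrm{KL}(\mu|\nu)=\int\varphi(d\mu/d\nu)\,d\nu$ if $\mu\ll\nu$, $\mu\ge0$, and $+\infty$ otherwise, with $\varphi(s)=s\log s-s+1$ for $s>0$, $\varphi(0)=1$. It is known that $\mathrm{HK}_\kappa$ metrizes the weak* topology on $\mathcal{M}_+(\Omega)$. The Hellinger distance is $\mathrm{Hell}^2(\mu,\nu):=\int_\Omega\big(\sqrt{d\mu/d\tau}-\sqrt{d\nu/d\tau}\big)^2d\tau$ for any $\tau\in\mathcal{M}_+(\Omega)$ with $\mu,\nu\ll\tau$ (independent of $\tau$). The Wasserstein-2 distance on $\mathcal{M}_+(\Omega)$ is $W^2(\mu,\nu):=\inf\{\int|x-y|^2d\gamma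 : \gamma\in\mathcal{M}_+(\Omega\times\Omega),\ P_1\gamma=\mu,\ P_2\gamma=\nu\}$, which is $+\infty$ if $\|\mu\|\ne\|\nu\|$. Fix $M\in(0,\infty)$ and let $\mathfrak{C} := \{\mu\in\mathcal{M}_+(\Omega) : \|\mu\|\le M\}$, a compact metrizable space in the weak* topology, equipped with its Borel $\sigma$-algebra; $\mathcal{P}(\mathfrak{C})$ is the set of Borel probability measures on $\mathfrak{C}$. For $\Lambda\in\mathcal{P}(\mathfrak{C})$ and $\nu\in\mathcal{M}_+(\Omega)$ set $$J_{\Lambda,\kappa}(\nu):=\int_{\mathfrak{C}}\mathrm{HK}_\kappa^2(\mu,\nu)\,d\Lambda(\mu)\ (0<\kappa<\infty),\quad J_{\Lambda,0}(\nu):=\int_{\mathfrak{C}}\mathrm{Hell}^2(\mu,\nu)\,d\Lambda(\mu),\quad J_{\Lambda,\infty}(\nu):=\int_{\mathfrak{C}}W^2(\mu,\nu)\,d\Lambda(\mu),$$ where $J_{\Lambda,\infty}$ may take the value $+\infty$ (possibly identically, in which case every $\nu$ counts as a minimizer). *)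

theory Defs
  imports "HOL-Probability.Probability"
begin

section \<open>Non-negative Radon measures and the weak* topology\<close>

text \<open>Finite Borel measures on \<open>S\<close>; on a compact subset of a Euclidean space these are exactly
  the non-negative Radon measures. They are measures whose space is \<open>S\<close> itself, so that measures
  agreeing on all Borel subsets of \<open>S\<close> are equal.\<close>

definition radon_measures :: "'a::topological_space set \<Rightarrow> 'a measure set" where
  "radon_measures S = {\<mu>. sets \<mu> = sets (restrict_space borel S) \<and> finite_measure \<mu>}"

text \<open>The coarsest topology on the Radon measures making integration against every continuous
  function on \<open>S\<close> continuous.\<close>

definition weak_star :: "'a::topological_space set \<Rightarrow> 'a measure topology" where
  "weak_star S = topology_generated_by
     {{\<mu> \<in> radon_measures S. (\<integral>x. f x \<partial>\<mu>) \<in> U} | (f :: 'a \<Rightarrow> real) U. continuous_on S f \<and> open U}"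

lemma topspace_weak_star [simp]: "topspace (weak_star S) = radon_measures S"
proof -
  have "radon_measures S \<in> {{\<mu> \<in> radon_measures S. (\<integral>x. f x \<partial>\<mu>) \<in> U} | (f :: 'a \<Rightarrow> real) U.
      continuous_on S f \<and> open U}"
    by (rule CollectI, rule exI[of _ "\<lambda>_. 0"], rule exI[of _ UNIV]) auto
  then show ?thesis
    unfolding weak_star_def topology_generated_by_topspace by blast
qed

definition bounded_radon_measures :: "'a::topological_space set \<Rightarrow> real \<Rightarrow> 'a measure set" where
  "bounded_radon_measures S M = {\<mu> \<in> radon_measures S. measure \<mu> S \<le> M}"

definition borel_of :: "'a topology \<Rightarrow> 'a measure" where
  "borel_of T = sigma (topspace T) {U. openin T U}"

definition borel_prob_measures :: "'a topology \<Rightarrow> 'a measure set" where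
  "borel_prob_measures T = {\<Lambda>. sets \<Lambda> = sets (borel_of T) \<and> prob_space \<Lambda>}"

definition precompact_in :: "'a topology \<Rightarrow> 'a set \<Rightarrow> bool" where
  "precompact_in T A \<longleftrightarrow> A \<subseteq> topspace T \<and> compactin T (T closure_of A)"

definition cluster_point :: "'a topology \<Rightarrow> (nat \<Rightarrow> 'a) \<Rightarrow> 'a \<Rightarrow> bool" where
  "cluster_point T u l \<longleftrightarrow>
     l \<in> topspace T \<and> (\<forall>U. openin T U \<and> l \<in> U \<longrightarrow> (\<exists>\<^sub>F n in sequentially. u n \<in> U))"


section \<open>The Hellinger--Kantorovich distance\<close>

definition kl_entropy :: "real \<Rightarrow> real" where
  "kl_entropy s = (if s = 0 then 1 else s * ln s - s + 1)"

text \<open>The library's \<open>KL_divergence\<close> lacks the mass terms and the value \<open>\<infinity>\<close>.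
  Note that \<open>\<mu> \<lless> \<nu>\<close> reads \<open>absolutely_continuous \<nu> \<mu>\<close> and that \<open>d\<mu>/d\<nu>\<close> reads \<open>RN_deriv \<nu> \<mu>\<close>.\<close>

definition KL :: "'a measure \<Rightarrow> 'a measure \<Rightarrow> ennreal" where
  "KL \<mu> \<nu> = (if absolutely_continuous \<nu> \<mu>
     then \<integral>\<^sup>+x. ennreal (kl_entropy (enn2real (RN_deriv \<nu> \<mu> x))) \<partial>\<nu> else \<infinity>)"

text \<open>The boundary case \<open>dist x y = \<kappa> * pi / 2\<close> belongs to the second branch because of the
  convention \<open>-log 0 = \<infinity>\<close>.\<close>

definition HK_cost :: "real \<Rightarrow> 'a::metric_space \<Rightarrow> 'a \<Rightarrow> ennreal" where
  "HK_cost \<kappa> x y = (if dist x y < \<kappa> * pi / 2 then ennreal (- 2 * ln (cos (dist x y / \<kappa>))) else \<infinity>)"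

definition marginal1 :: "'a::topological_space set \<Rightarrow> ('a \<times> 'a) measure \<Rightarrow> 'a measure" where
  "marginal1 S \<gamma> = distr \<gamma> (restrict_space borel S) fst"

definition marginal2 :: "'a::topological_space set \<Rightarrow> ('a \<times> 'a) measure \<Rightarrow> 'a measure" where
  "marginal2 S \<gamma> = distr \<gamma> (restrict_space borel S) snd"

definition HK_sq :: "'a::euclidean_space set \<Rightarrow> real \<Rightarrow> 'a measure \<Rightarrow> 'a measure \<Rightarrow> ennreal" where
  "HK_sq S \<kappa> \<mu> \<nu> = (INF \<gamma>\<in>radon_measures (S \<times> S).
     (\<integral>\<^sup>+z. HK_cost \<kappa> (fst z) (snd z) \<partial>\<gamma>) + KL (marginal1 S \<gamma>) \<mu> + KL (marginal2 S \<gamma>) \<nu>)"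


section \<open>The Hellinger and Wasserstein distances\<close>

definition Hell_sq_wrt :: "'a measure \<Rightarrow> 'a measure \<Rightarrow> 'a measure \<Rightarrow> ennreal" where
  "Hell_sq_wrt \<tau> \<mu> \<nu> =
     (\<integral>\<^sup>+x. ennreal ((sqrt (enn2real (RN_deriv \<tau> \<mu> x)) - sqrt (enn2real (RN_deriv \<tau> \<nu> x)))\<^sup>2) \<partial>\<tau>)"

definition sum_measure :: "'a measure \<Rightarrow> 'a measure \<Rightarrow> 'a measure" where
  "sum_measure \<mu> \<nu> = measure_of (space \<mu>) (sets \<mu>) (\<lambda>A. emeasure \<mu> A + emeasure \<nu> A)"

text \<open>We take \<open>\<mu> + \<nu>\<close> as reference measure; lemma \<open>Hell_sq_eq_wrt\<close> below shows that every
  dominating measure \<open>\<tau>\<close> gives the same value.\<close>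

definition Hell_sq :: "'a measure \<Rightarrow> 'a measure \<Rightarrow> ennreal" where
  "Hell_sq \<mu> \<nu> = Hell_sq_wrt (sum_measure \<mu> \<nu>) \<mu> \<nu>"

definition W_sq :: "'a::euclidean_space set \<Rightarrow> 'a measure \<Rightarrow> 'a measure \<Rightarrow> ennreal" where
  "W_sq S \<mu> \<nu> =
     (INF \<gamma>\<in>{\<gamma> \<in> radon_measures (S \<times> S). marginal1 S \<gamma> = \<mu> \<and> marginal2 S \<gamma> = \<nu>}.
       \<integral>\<^sup>+z. ennreal ((dist (fst z) (snd z))\<^sup>2) \<partial>\<gamma>)"

lemma
  assumes "sets \<mu> = sets \<nu>"
  shows sets_sum_measure: "sets (sum_measure \<mu> \<nu>) = sets \<mu>"
    and emeasure_sum_measure: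
      "A \<in> sets \<mu> \<Longrightarrow> emeasure (sum_measure \<mu> \<nu>) A = emeasure \<mu> A + emeasure \<nu> A"
proof -
  show *: "sets (sum_measure \<mu> \<nu>) = sets \<mu>"
    unfolding sum_measure_def by simp
  assume A: "A \<in> sets \<mu>"
  show "emeasure (sum_measure \<mu> \<nu>) A = emeasure \<mu> A + emeasure \<nu> A"
  proof (rule emeasure_measure_of[OF sum_measure_def])
    show "sets \<mu> \<subseteq> Pow (space \<mu>)" by (rule sets.space_closed)
    show "positive (sets (sum_measure \<mu> \<nu>)) (\<lambda>A. emeasure \<mu> A + emeasure \<nu> A)"
      by (simp add: positive_def)
    show "countably_additive (sets (sum_measure \<mu> \<nu>)) (\<lambda>A. emeasure \<mu> A + emeasure \<nu> A)"
      unfolding countably_additive_def * using assms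
      by (auto simp: suminf_add[symmetric] suminf_emeasure)
    show "A \<in> sets (sum_measure \<mu> \<nu>)" using A * by simp
  qed
qed

lemma Hell_sq_eq_wrt:
  assumes "finite_measure \<mu>" "finite_measure \<nu>" "finite_measure \<tau>"
    and s: "sets \<mu> = sets \<tau>" "sets \<nu> = sets \<tau>"
    and ac: "absolutely_continuous \<tau> \<mu>" "absolutely_continuous \<tau> \<nu>"
  shows "Hell_sq_wrt \<tau> \<mu> \<nu> = Hell_sq \<mu> \<nu>"
proof -
  interpret m: finite_measure \<mu> by fact
  interpret n: finite_measure \<nu> by fact
  interpret t: finite_measure \<tau> by fact
  define \<sigma> where "\<sigma> = sum_measure \<mu> \<nu>"
  have st: "sets \<sigma> = sets \<tau>" and em: "\<And>A. A \<in> sets \<tau> \<Longrightarrow> emeasure \<sigma> A = emeasure \<mu> A + emeasure \<nu> A"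
    using sets_sum_measure[of \<mu> \<nu>] emeasure_sum_measure[of \<mu> \<nu>] s by (auto simp: \<sigma>_def)
  have spst: "space \<sigma> = space \<tau>" using sets_eq_imp_space_eq[OF st] .
  have "finite_measure \<sigma>"
    by (rule finite_measureI)
       (use em[of "space \<tau>"] spst s m.emeasure_finite n.emeasure_finite in auto)
  then interpret g: finite_measure \<sigma> .
  have ac': "absolutely_continuous \<sigma> \<mu>" "absolutely_continuous \<sigma> \<nu>"
    unfolding absolutely_continuous_def null_sets_def using em st s by auto
  define a where "a = RN_deriv \<tau> \<mu>"
  define b where "b = RN_deriv \<tau> \<nu>"
  define a' where "a' = RN_deriv \<sigma> \<mu>"
  define b' where "b' = RN_deriv \<sigma> \<nu>"
  have meas [measurable]: "a \<in> borel_measurable \<tau>" "b \<in> borel_measurable \<tau>"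
    by (auto simp: a_def b_def)
  have "a' \<in> borel_measurable \<sigma>" "b' \<in> borel_measurable \<sigma>" by (auto simp: a'_def b'_def)
  then have meas' [measurable]: "a' \<in> borel_measurable \<tau>" "b' \<in> borel_measurable \<tau>"
    using measurable_cong_sets[OF st refl] by auto
  have da: "density \<tau> a = \<mu>" "density \<tau> b = \<nu>"
    unfolding a_def b_def using t.density_RN_deriv ac s by auto
  have da': "density \<sigma> a' = \<mu>" "density \<sigma> b' = \<nu>"
    unfolding a'_def b'_def using g.density_RN_deriv ac' s st by auto
  have ds: "density \<tau> (\<lambda>x. a x + b x) = \<sigma>"
  proof (rule measure_eqI)
    fix A assume "A \<in> sets (density \<tau> (\<lambda>x. a x + b x))"
    then have A [measurable]: "A \<in> sets \<tau>" by simp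
    have "emeasure (density \<tau> (\<lambda>x. a x + b x)) A = emeasure (density \<tau> a) A + emeasure (density \<tau> b) A"
      by (simp add: emeasure_density nn_integral_add[symmetric] distrib_right)
    then show "emeasure (density \<tau> (\<lambda>x. a x + b x)) A = emeasure \<sigma> A"
      using em[OF A] da by simp
  qed (simp add: st)
  have "density \<tau> (\<lambda>x. (a x + b x) * a' x) = density \<tau> a"
    "density \<tau> (\<lambda>x. (a x + b x) * b' x) = density \<tau> b"
    using density_density_eq[of "\<lambda>x. a x + b x" \<tau> a'] density_density_eq[of "\<lambda>x. a x + b x" \<tau> b']
    by (simp_all add: ds da da')
  then have ae: "AE x in \<tau>. (a x + b x) * a' x = a x" "AE x in \<tau>. (a x + b x) * b' x = b x"
    using t.density_unique_iff[of "\<lambda>x. (a x + b x) * a' x" a]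
      t.density_unique_iff[of "\<lambda>x. (a x + b x) * b' x" b] by auto
  have fin: "AE x in \<tau>. a x \<noteq> \<infinity>" "AE x in \<tau>. b x \<noteq> \<infinity>"
    unfolding a_def b_def using t.RN_deriv_finite m.sigma_finite_measure_axioms n.sigma_finite_measure_axioms ac s by auto
  have "Hell_sq \<mu> \<nu> = (\<integral>\<^sup>+x. (a x + b x) * ennreal ((sqrt (enn2real (a' x)) - sqrt (enn2real (b' x)))\<^sup>2) \<partial>\<tau>)"
    unfolding Hell_sq_def Hell_sq_wrt_def \<sigma>_def[symmetric] a'_def[symmetric] b'_def[symmetric]
    by (subst ds[symmetric], subst nn_integral_density) auto
  also have "\<dots> = (\<integral>\<^sup>+x. ennreal ((sqrt (enn2real (a x)) - sqrt (enn2real (b x)))\<^sup>2) \<partial>\<tau>)"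
  proof (rule nn_integral_cong_AE)
    show "AE x in \<tau>. (a x + b x) * ennreal ((sqrt (enn2real (a' x)) - sqrt (enn2real (b' x)))\<^sup>2)
        = ennreal ((sqrt (enn2real (a x)) - sqrt (enn2real (b x)))\<^sup>2)"
      using ae fin
    proof eventually_elim
      case (elim x)
      define c where "c = enn2real (a x + b x)"
      have c: "a x + b x = ennreal c" "c \<ge> 0"
        using elim by (auto simp: c_def ennreal_enn2real_if)
      have "enn2real (a x) = c * enn2real (a' x)" "enn2real (b x) = c * enn2real (b' x)"
        using elim(1,2)
        unfolding c_def enn2real_mult[symmetric] using elim(1,2) by simp_all
      then have "(sqrt (enn2real (a x)) - sqrt (enn2real (b x)))\<^sup>2
          = (sqrt c * (sqrt (enn2real (a' x)) - sqrt (enn2real (b' x))))\<^sup>2"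
        by (simp add: real_sqrt_mult right_diff_distrib)
      also have "\<dots> = c * (sqrt (enn2real (a' x)) - sqrt (enn2real (b' x)))\<^sup>2"
        using c by (simp add: power_mult_distrib)
      finally show ?case using c by (simp add: ennreal_mult')
    qed
  qed
  finally show ?thesis by (simp add: Hell_sq_wrt_def a_def b_def)
qed


section \<open>The barycenter functional\<close>

text \<open>The parameter \<open>\<kappa>\<close> ranges over \<open>[0,\<infinity>]\<close>, which is the type \<^typ>\<open>ennreal\<close>.\<close>

definition J_fun :: "'a::euclidean_space set \<Rightarrow> 'a measure measure \<Rightarrow> ennreal \<Rightarrow> 'a measure \<Rightarrow> ennreal" where
  "J_fun S \<Lambda> \<kappa> \<nu> =
     (if \<kappa> = 0 then \<integral>\<^sup>+\<mu>. Hell_sq \<mu> \<nu> \<partial>\<Lambda>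
      else if \<kappa> = \<infinity> then \<integral>\<^sup>+\<mu>. W_sq S \<mu> \<nu> \<partial>\<Lambda>
      else \<integral>\<^sup>+\<mu>. HK_sq S (enn2real \<kappa>) \<mu> \<nu> \<partial>\<Lambda>)"

end

theory Submission
  imports Defs
begin

text \<open>All three distances are values of one entropy-transport problem: minimise
  \<open>\<integral>c d\<gamma> + \<alpha> (KL(P\<^sub>1\<gamma>|\<mu>) + KL(P\<^sub>2\<gamma>|\<nu>))\<close> over \<open>\<gamma>\<close>. The Hellinger--Kantorovich distance is
  \<open>\<alpha> = 1\<close> with cost \<open>HK_cost \<kappa>\<close>, the Hellinger distance is \<open>\<alpha> = 1\<close> with a cost that is infinite
  off the diagonal, the Wasserstein distance is \<open>\<alpha> = \<infinity>\<close> with the squared distance, and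
  \<open>\<kappa>\<^sup>2 HK\<^sup>2\<close> is \<open>\<alpha> = \<kappa>\<^sup>2\<close> with cost \<open>\<kappa>\<^sup>2 HK_cost \<kappa>\<close>. Costs that are suprema of continuous functions,
  the dual formula for \<open>KL\<close> and weak* compactness of plans yield one lower semicontinuity theorem
  covering every limit of \<open>\<kappa>\<close> and also the Borel measurability of the distances. Conversely, for
  fixed measures the upper limit of the distances is bounded by the limit distance.
  Fatou's lemma and its reverse carry both bounds over to the functionals \<open>J\<close>; with
  compactness this is a Gamma-convergence argument.

  Weak* compactness is reduced to Helly's theorem: a compact set embeds into the real line by a
  Borel map whose inverse is uniformly continuous, hence extends continuously to the closure of
  the image.\<close>


section \<open>Coding a compact set into the real line\<close>

text \<open>At finite \<kappa> the marginals of a plan are free, so compactness of plans rests on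
  the entropies alone: a bound on \<open>KL \<rho> \<mu>\<close> bounds the mass of \<rho>. This
  survives the limit because the weight of the entropies stays away from 0. For finite limits,
  semicontinuity in \<kappa> and in the measures at once comes from truncating the cost at a
  parameter slightly above the limit; the result is continuous and lies below every cost with nearby
  parameter, even when the limit cost is infinite off the diagonal. The upper bound has three
  different reasons. Towards 0, the Hellinger distance dominates for each \<kappa>. At a positive
  finite limit k, the cost becomes infinite at distance \<open>k * pi / 2\<close>, a threshold that
  moves inwards if \<kappa> is below k; plans must then lose some mass, and since entropy is not
  monotone this loss has to be estimated. Towards infinity, the Wasserstein distance may be
  infinite, so reverse Fatou has no dominating function; a factor 1 + e, uniform over all pairs of
  measures, takes its place.\<close>

definition ternary :: "(nat \<Rightarrow> bool) \<Rightarrow> real" where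
  "ternary b = (\<Sum>m. 2 * of_bool (b m) * (1 / 3) ^ Suc m)"

lemma summable_ternary: "summable (\<lambda>m. 2 * of_bool (b m) * (1 / 3) ^ Suc m :: real)"
proof (rule summable_comparison_test)
  show "summable (\<lambda>m. 2 * (1 / 3) ^ Suc m :: real)"
    by (intro summable_mult) (subst summable_Suc_iff, rule summable_geometric, simp)
  show "\<exists>N. \<forall>n\<ge>N. norm (2 * of_bool (b n) * (1 / 3) ^ Suc n :: real) \<le> 2 * (1 / 3) ^ Suc n"
    by auto
qed

lemma ternary_bounds: "0 \<le> ternary b" "ternary b \<le> 1"
proof -
  show "0 \<le> ternary b"
    unfolding ternary_def by (rule suminf_nonneg[OF summable_ternary]) auto
  have *: "(\<lambda>m. 2 / 3 * (1 / 3) ^ m :: real) sums (2 / 3 * (1 / (1 - 1 / 3)))"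
    by (intro sums_mult geometric_sums) auto
  have "ternary b \<le> (\<Sum>m. 2 / 3 * (1 / 3) ^ m)"
    unfolding ternary_def
    by (rule suminf_le[OF _ summable_ternary sums_summable[OF *]]) auto
  also have "\<dots> = 1" using sums_unique[OF *] by simp
  finally show "ternary b \<le> 1" .
qed

lemma ternary_split: "ternary b = 2 / 3 * of_bool (b 0) + ternary (\<lambda>m. b (Suc m)) / 3"
proof -
  have "ternary b = 2 / 3 * of_bool (b 0) + (\<Sum>m. 2 * of_bool (b (Suc m)) * (1 / 3) ^ Suc (Suc m))"
    unfolding ternary_def using suminf_split_head[OF summable_ternary[of b]] by simp
  also have "(\<Sum>m. 2 * of_bool (b (Suc m)) * (1 / 3) ^ Suc (Suc m) :: real)
      = (\<Sum>m. 2 * of_bool (b (Suc m)) * (1 / 3) ^ Suc m * (1 / 3))"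
    by (simp add: mult_ac)
  also have "\<dots> = ternary (\<lambda>m. b (Suc m)) * (1 / 3)"
    unfolding ternary_def by (rule suminf_mult2[symmetric, OF summable_ternary])
  finally show ?thesis by simp
qed

text \<open>The digits are 0 and 2 in base 3, as in the Cantor set. All digits after the first are
  worth at most 1/3 together, so different leading digits separate the values by at least 1/3; equal
  ones can be removed and the difference multiplied by 3.\<close>

lemma ternary_close_imp_eq_prefix:
  "\<bar>ternary b - ternary c\<bar> < (1 / 3) ^ N \<Longrightarrow> m < N \<Longrightarrow> b m = c m"
proof (induction N arbitrary: b c m)
  case 0
  then show ?case by simp
next
  case (Suc N)
  have small: "\<bar>ternary b - ternary c\<bar> < 1 / 3"
    using Suc.prems(1) power_le_one[of "1 / 3 :: real" N] by simp
  have 0: "b 0 = c 0"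
    using small ternary_bounds[of "\<lambda>m. b (Suc m)"] ternary_bounds[of "\<lambda>m. c (Suc m)"]
    unfolding ternary_split[of b] ternary_split[of c]
    by (cases "b 0"; cases "c 0") (auto simp: abs_if split: if_splits)
  then have "\<bar>ternary (\<lambda>m. b (Suc m)) - ternary (\<lambda>m. c (Suc m))\<bar> < (1 / 3) ^ N"
    using Suc.prems(1) unfolding ternary_split[of b] ternary_split[of c]
    by (simp add: abs_if split: if_splits)
  with Suc.IH[of "\<lambda>m. b (Suc m)" "\<lambda>m. c (Suc m)"] 0 Suc.prems(2) show ?case
    by (cases m) auto
qed

text \<open>The digits of the code record membership in the balls of a countable family with arbitrarily
  fine finite subcovers of \<open>S\<close>. Hence a common prefix of digits forces two points of \<open>S\<close> to be close.\<close>

lemma compact_real_coding: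
  fixes S :: "'a::{second_countable_topology, metric_space} set"
  assumes "compact S"
  obtains s :: "'a \<Rightarrow> real" where "s \<in> borel_measurable borel" "\<And>x. s x \<in> {0..1}"
    "\<And>e. 0 < e \<Longrightarrow> \<exists>d>0. \<forall>x\<in>S. \<forall>y\<in>S. \<bar>s x - s y\<bar> < d \<longrightarrow> dist x y < e"
proof -
  obtain D :: "'a set" where D: "countable D" "\<And>X. open X \<Longrightarrow> X \<noteq> {} \<Longrightarrow> \<exists>d\<in>D. d \<in> X"
    using countable_dense_exists by blast
  have "D \<noteq> {}" using D(2)[of UNIV] by auto
  define P where "P = D \<times> (UNIV :: nat set)"
  have P: "countable P" "P \<noteq> {}" using D(1) \<open>D \<noteq> {}\<close> by (auto simp: P_def)
  define U where "U m = ball (fst (from_nat_into P m)) (1 / real (Suc (snd (from_nat_into P m))))" for m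
  define s where "s x = ternary (\<lambda>m. x \<in> U m)" for x
  show thesis
  proof
    have *: "s = (\<lambda>x. \<Sum>m. 2 * indicator (U m) x * (1 / 3) ^ Suc m)"
      unfolding s_def ternary_def indicator_def by (simp add: of_bool_def)
    have [measurable]: "U m \<in> sets borel" for m unfolding U_def by auto
    show "s \<in> borel_measurable borel" unfolding * by measurable
    show "s x \<in> {0..1}" for x using ternary_bounds by (auto simp: s_def)
    fix e :: real assume "0 < e"
    then obtain k where k: "1 / real (Suc k) < e / 2" using nat_approx_posE[of "e / 2"] by auto
    have "S \<subseteq> (\<Union>q\<in>D. ball q (1 / real (Suc k)))"
    proof
      fix x
      show "x \<in> (\<Union>q\<in>D. ball q (1 / real (Suc k)))"
        using D(2)[of "ball x (1 / real (Suc k))"] by (auto simp: dist_commute)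
    qed
    then obtain C where C: "C \<subseteq> D" "finite C" "S \<subseteq> (\<Union>q\<in>C. ball q (1 / real (Suc k)))"
      using compactE_image[OF assms, of D "\<lambda>q. ball q (1 / real (Suc k))"] by auto
    \<comment> \<open>Indices of the balls in the finite subcover. N exceeds all of them, so
      agreement of the first N digits decides membership in each of these balls;
      \<open>insert 0\<close> allows for an empty subcover.\<close>
    define I where "I = (\<lambda>q. to_nat_on P (q, k)) ` C"
    define N where "N = Suc (Max (insert 0 I))"
    have "finite I" using C by (auto simp: I_def)
    show "\<exists>d>0. \<forall>x\<in>S. \<forall>y\<in>S. \<bar>s x - s y\<bar> < d \<longrightarrow> dist x y < e"
    proof (intro exI[of _ "(1 / 3) ^ N"] conjI ballI impI)
      fix x y assume xy: "x \<in> S" "y \<in> S" "\<bar>s x - s y\<bar> < (1 / 3) ^ N"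
      from xy(1) C obtain q where q: "q \<in> C" "x \<in> ball q (1 / real (Suc k))" by blast
      define m where "m = to_nat_on P (q, k)"
      have "from_nat_into P m = (q, k)"
        unfolding m_def using P q(1) C(1) by (intro from_nat_into_to_nat_on) (auto simp: P_def)
      then have Um: "U m = ball q (1 / real (Suc k))" by (simp add: U_def)
      have "m < N" using q(1) \<open>finite I\<close> by (auto simp: N_def I_def m_def less_Suc_eq_le)
      then have "y \<in> U m"
        using ternary_close_imp_eq_prefix[of "\<lambda>m. x \<in> U m" "\<lambda>m. y \<in> U m" N m] xy(3) q(2) Um
        by (auto simp: s_def)
      then have "dist q y < e / 2" "dist q x < e / 2" using q(2) k unfolding Um by auto
      then show "dist x y < e" using dist_triangle3[of x y q] by simp
    qed simp
  qed
qed

section \<open>Basic facts on Radon measures and sequential weak* convergence\<close>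

lemma radon_measuresD:
  assumes "\<mu> \<in> radon_measures S"
  shows "sets \<mu> = sets (restrict_space borel S)" "space \<mu> = S" "finite_measure \<mu>"
  using assms sets_eq_imp_space_eq[of \<mu> "restrict_space borel S"]
  by (auto simp: radon_measures_def space_restrict_space)

lemma radon_measurable_continuous:
  fixes f :: "'a::topological_space \<Rightarrow> 'b::topological_space"
  assumes "\<mu> \<in> radon_measures S" "continuous_on S f"
  shows "f \<in> borel_measurable \<mu>"
  using borel_measurable_continuous_on_restrict[OF assms(2)]
    measurable_cong_sets[OF radon_measuresD(1)[OF assms(1)] refl] by blast

lemma radon_integrable_bounded:
  fixes f :: "'a::topological_space \<Rightarrow> real"
  assumes "\<mu> \<in> radon_measures S" "f \<in> borel_measurable \<mu>" "\<And>x. x \<in> S \<Longrightarrow> \<bar>f x\<bar> \<le> B"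
  shows "integrable \<mu> f"
proof -
  interpret finite_measure \<mu> using radon_measuresD(3)[OF assms(1)] .
  show ?thesis
    by (rule integrable_const_bound[of _ B])
       (use assms radon_measuresD(2)[OF assms(1)] in auto)
qed

lemma continuous_on_compact_bounded:
  fixes f :: "'a::topological_space \<Rightarrow> real"
  assumes "compact S" "continuous_on S f"
  obtains B where "0 < B" "\<And>x. x \<in> S \<Longrightarrow> \<bar>f x\<bar> \<le> B"
  using compact_imp_bounded[OF compact_continuous_image[OF assms(2,1)]]
  unfolding bounded_pos by auto

lemma radon_integrable_continuous:
  fixes f :: "'a::topological_space \<Rightarrow> real"
  assumes "compact S" "\<mu> \<in> radon_measures S" "continuous_on S f"
  shows "integrable \<mu> f"
  using continuous_on_compact_bounded[OF assms(1,3)]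
    radon_integrable_bounded[OF assms(2) radon_measurable_continuous[OF assms(2,3)]] by metis

lemma radon_integral_diff_le:
  assumes "\<mu> \<in> radon_measures S" "f \<in> borel_measurable \<mu>" "g \<in> borel_measurable \<mu>"
    "\<And>x. x \<in> S \<Longrightarrow> \<bar>f x - g x\<bar> \<le> e" "integrable \<mu> f" "integrable \<mu> g"
  shows "\<bar>(\<integral>x. f x \<partial>\<mu>) - (\<integral>x. g x \<partial>\<mu>)\<bar> \<le> e * measure \<mu> S"
proof -
  interpret finite_measure \<mu> using radon_measuresD(3)[OF assms(1)] .
  have sp: "space \<mu> = S" using radon_measuresD(2)[OF assms(1)] .
  have "\<bar>(\<integral>x. f x \<partial>\<mu>) - (\<integral>x. g x \<partial>\<mu>)\<bar> = \<bar>\<integral>x. f x - g x \<partial>\<mu>\<bar>"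
    using assms by simp
  also have "\<dots> \<le> (\<integral>x. \<bar>f x - g x\<bar> \<partial>\<mu>)" by (rule integral_abs_bound)
  also have "\<dots> \<le> (\<integral>x. e \<partial>\<mu>)"
    using assms by (intro integral_mono) (auto simp: sp)
  also have "\<dots> = e * measure \<mu> S" by (simp add: sp mult.commute)
  finally show ?thesis .
qed

text \<open>Almost all arguments use this sequential form; metrizability of bounded sets later links
  it to compactness, cluster points and Borel sets of \<open>weak_star S\<close>.\<close>

definition weak_star_conv :: "'a::topological_space set \<Rightarrow> (nat \<Rightarrow> 'a measure) \<Rightarrow> 'a measure \<Rightarrow> bool" where
  "weak_star_conv S u l \<longleftrightarrow>
     (\<forall>f :: 'a \<Rightarrow> real. continuous_on S f \<longrightarrow> (\<lambda>n. \<integral>x. f x \<partial>u n) \<longlonglongrightarrow> (\<integral>x. f x \<partial>l))"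

lemma weak_star_conv_subseq:
  "weak_star_conv S u l \<Longrightarrow> strict_mono r \<Longrightarrow> weak_star_conv S (u \<circ> r) l"
  unfolding weak_star_conv_def using LIMSEQ_subseq_LIMSEQ by (fastforce simp: o_def)

lemma weak_star_conv_const: "weak_star_conv S (\<lambda>_. \<mu>) \<mu>"
  by (simp add: weak_star_conv_def)

lemma integral_one_radon: "\<mu> \<in> radon_measures S \<Longrightarrow> (\<integral>x. (1 :: real) \<partial>\<mu>) = measure \<mu> S"
  using radon_measuresD(2) by fastforce

lemma weak_star_conv_mass:
  assumes "weak_star_conv S u l" "\<And>n. u n \<in> radon_measures S" "l \<in> radon_measures S"
  shows "(\<lambda>n. measure (u n) S) \<longlonglongrightarrow> measure l S"
proof -
  have "(\<lambda>n. \<integral>x. 1 \<partial>u n) \<longlonglongrightarrow> (\<integral>x. (1 :: real) \<partial>l)"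
    by (rule assms(1)[unfolded weak_star_conv_def, rule_format, OF continuous_on_const])
  then show ?thesis unfolding integral_one_radon[OF assms(2)] integral_one_radon[OF assms(3)] .
qed


section \<open>Sequential weak* compactness\<close>

text \<open>The coding is discontinuous in general, which is harmless: a test function g on S
  becomes g composed with f on K, so only the continuity of the decoding f enters. The limit on S is
  the image under f of the limit law of the codes.\<close>

lemma prob_radon_seq_compact:
  fixes S :: "'a::euclidean_space set" and u :: "nat \<Rightarrow> 'a measure"
  assumes S: "compact S" and u: "\<And>n. u n \<in> radon_measures S" and mass: "\<And>n. measure (u n) S = 1"
  obtains r l where "strict_mono r" "l \<in> radon_measures S" "weak_star_conv S (u \<circ> r) l"
proof -
  note spu = radon_measuresD(2)[OF u]
  have prob: "prob_space (u n)" for n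
    using finite_measure.emeasure_eq_measure[OF radon_measuresD(3)[OF u[of n]], of S] mass[of n]
    by (intro prob_spaceI) (simp add: spu)
  obtain a where "a \<in> S" using mass[of 0] by (cases "S = {}") auto
  obtain s :: "'a \<Rightarrow> real" where s: "s \<in> borel_measurable borel" "\<And>x. s x \<in> {0..1}"
    and sinj: "\<And>e. 0 < e \<Longrightarrow> \<exists>d>0. \<forall>x\<in>S. \<forall>y\<in>S. \<bar>s x - s y\<bar> < d \<longrightarrow> dist x y < e"
    using compact_real_coding[OF S] by blast
  have inj: "inj_on s S"
  proof (rule inj_onI, rule ccontr)
    fix x y assume *: "x \<in> S" "y \<in> S" "s x = s y" "x \<noteq> y"
    with sinj[of "dist x y"] show False by force
  qed
  define A where "A = s ` S"
  define K where "K = closure A"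
  have "uniformly_continuous_on A (inv_into S s)"
    unfolding uniformly_continuous_on_def
  proof (intro allI impI)
    fix e :: real assume "0 < e"
    from sinj[OF this] obtain d where "d > 0"
      and d: "\<forall>x\<in>S. \<forall>y\<in>S. \<bar>s x - s y\<bar> < d \<longrightarrow> dist x y < e" by blast
    then show "\<exists>d>0. \<forall>x\<in>A. \<forall>x'\<in>A. dist x' x < d \<longrightarrow> dist (inv_into S s x') (inv_into S s x) < e"
      by (intro exI[of _ d]) (auto simp: A_def inv_into_f_f[OF inj] dist_real_def)
  qed
  from uniformly_continuous_on_extension_on_closure[OF this]
  obtain f where f: "uniformly_continuous_on K f" "\<And>t. t \<in> A \<Longrightarrow> inv_into S s t = f t"
    unfolding K_def by metis
  have fc: "continuous_on K f" using f(1) by (rule uniformly_continuous_imp_continuous)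
  have fs: "f (s x) = x" if "x \<in> S" for x
    using f(2)[of "s x"] that inv_into_f_f[OF inj that] by (auto simp: A_def)
  have fK: "f ` K \<subseteq> S"
    unfolding K_def
    by (rule image_closure_subset) (use fc fs compact_imp_closed[OF S] in \<open>auto simp: K_def A_def\<close>)
  have "A \<subseteq> {0..1}" using s(2) by (auto simp: A_def)
  then have "K \<subseteq> {0..1}" unfolding K_def by (rule closure_minimal) simp
  then have K: "compact K" "closed K"
    using compact_Int_closed[of "{0..1}" K] by (simp_all add: K_def Int_absorb1)
  have sK: "s x \<in> K" if "x \<in> S" for x using that closure_subset[of A] by (auto simp: K_def A_def)
  then have "K \<noteq> {}" using \<open>a \<in> S\<close> by auto
  have sm [measurable]: "s \<in> borel_measurable (u n)" for n
    using measurable_restrict_space1[OF s(1), of S] measurable_cong_sets[OF radon_measuresD(1)[OF u] refl]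
    by blast
  define p where "p n = distr (u n) borel s" for n
  have pr: "real_distribution (p n)" for n
    unfolding p_def using prob_space.real_distribution_distr[OF prob sm] .
  have "tight p"
    unfolding tight_def
  proof (intro conjI allI impI)
    fix e :: real assume "0 < e"
    \<comment> \<open>The interval is open on the left and 0 may be a code, hence the end
      -1.\<close>
    have "measure (p n) {-1<..1} = 1" for n
    proof -
      have "measure (p n) {-1<..1} = measure (u n) (s -` {-1<..1} \<inter> space (u n))"
        unfolding p_def by (rule measure_distr) auto
      also have "s -` {-1<..1} \<inter> space (u n) = S"
      proof -
        have "-1 < s x" "s x \<le> 1" for x using s(2)[of x] by (auto intro: less_le_trans[of _ 0])
        then show ?thesis by (auto simp: spu)
      qed
      finally show ?thesis using mass by simp
    qed
    then show "\<exists>a b. a < b \<and> (\<forall>n. 1 - e < measure (p n) {a<..b})"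
      using \<open>0 < e\<close> by (intro exI[of _ "-1"] exI[of _ 1]) auto
  qed (rule pr)
  from tight_imp_convergent_subsubsequence[OF this strict_mono_id]
  obtain r m where r: "strict_mono (r :: nat \<Rightarrow> nat)" and m: "real_distribution m" "weak_conv_m (p \<circ> r) m"
    unfolding comp_id by blast
  interpret m: real_distribution m by fact
  have conv: "(\<lambda>n. \<integral>x. h (s x) \<partial>u (r n)) \<longlonglongrightarrow> (\<integral>t. h t \<partial>m)"
    if h: "continuous_on UNIV h" "\<And>t. \<bar>h t\<bar> \<le> B" for h :: "real \<Rightarrow> real" and B
  proof -
    have [measurable]: "h \<in> borel_measurable borel" using h(1) by (rule borel_measurable_continuous_onI)
    have "(\<lambda>n. \<integral>t. h t \<partial>(p \<circ> r) n) \<longlonglongrightarrow> (\<integral>t. h t \<partial>m)"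
      by (rule weak_conv_imp_integral_bdd_continuous_conv[OF _ m(1) m(2)])
         (use pr h in \<open>auto simp: continuous_on_eq_continuous_at\<close>)
    then show ?thesis by (simp add: p_def integral_distr)
  qed
  \<comment> \<open>The limit law may charge points of K that are not codes, but nothing outside K:
    the distance to K, cut at 1, is a bounded continuous function that vanishes at every
    code.\<close>
  have aeK: "AE t in m. t \<in> K"
  proof -
    define h where "h t = min 1 (infdist t K)" for t
    have hc: "continuous_on UNIV h" unfolding h_def by (intro continuous_intros)
    have hb: "\<bar>h t\<bar> \<le> 1" "0 \<le> h t" for t using infdist_nonneg[of t K] by (auto simp: h_def)
    have h0: "h (s x) = 0" if "x \<in> space (u n)" for x n using sK that by (simp add: h_def spu)
    have "(\<integral>x. h (s x) \<partial>u n) = (\<integral>x. 0 \<partial>u n)" for n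
      by (rule Bochner_Integration.integral_cong[OF refl h0])
    with conv[OF hc hb(1)] have int0: "(\<integral>t. h t \<partial>m) = 0" by (simp add: LIMSEQ_const_iff)
    have [measurable]: "h \<in> borel_measurable borel" using hc by (rule borel_measurable_continuous_onI)
    have "integrable m h" by (rule m.integrable_const_bound[of _ 1]) (use hb in auto)
    from integral_nonneg_eq_0_iff_AE[OF this] hb(2) int0 have "AE t in m. h t = 0" by blast
    then show ?thesis
    proof eventually_elim
      case (elim t)
      then have "infdist t K = 0" by (simp add: h_def min_def split: if_splits)
      then show ?case using in_closed_iff_infdist_zero[OF K(2) \<open>K \<noteq> {}\<close>] by blast
    qed
  qed
  \<comment> \<open>Outside K, which is a null set for m, the value is an arbitrary point of S, so
    that f' maps the whole line into S.\<close>
  define f' where "f' t = (if t \<in> K then f t else a)" for t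
  have f'm: "f' \<in> measurable m (restrict_space borel S)"
  proof (rule measurable_restrict_space2)
    show "f' \<in> space m \<rightarrow> S" using imageI[of _ K f] fK \<open>a \<in> S\<close> unfolding f'_def by fastforce
    have "f' \<in> borel_measurable borel"
      unfolding f'_def
      by (rule borel_measurable_continuous_on_if)
         (simp_all add: fc borel_closed[OF K(2)] continuous_on_const)
    then show "f' \<in> borel_measurable m" by simp
  qed
  define l where "l = distr m (restrict_space borel S) f'"
  have l: "l \<in> radon_measures S"
    unfolding radon_measures_def l_def using m.finite_measure_distr[OF f'm] by simp
  have "weak_star_conv S (u \<circ> r) l"
    unfolding weak_star_conv_def
  proof (intro allI impI)
    fix g :: "'a \<Rightarrow> real" assume g: "continuous_on S g"
    obtain B where B: "0 < B" "\<And>x. x \<in> S \<Longrightarrow> \<bar>g x\<bar> \<le> B"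
      using continuous_on_compact_bounded[OF S g] by blast
    have gf: "continuous_on K (\<lambda>t. g (f t))"
      using continuous_on_compose2[OF g fc fK] .
    \<comment> \<open>Weak convergence on the line tests with functions defined everywhere; Tietze
      extends g composed with f from K and keeps the bound.\<close>
    obtain h where h: "continuous_on UNIV h" "\<And>t. t \<in> K \<Longrightarrow> h t = g (f t)" "\<And>t. h t \<in> cbox (-B) B"
      using Tietze_closed_interval_1[of K "\<lambda>t. g (f t)" UNIV "-B" B] gf K(2) B fK
      by (auto simp: abs_le_iff image_subset_iff minus_le_iff)
    have hb: "\<bar>h t\<bar> \<le> B" for t using h(3)[of t] by auto
    have hm [measurable]: "h \<in> borel_measurable borel" using h(1) by (rule borel_measurable_continuous_onI)
    have gm: "g \<in> borel_measurable (restrict_space borel S)"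
      using g by (rule borel_measurable_continuous_on_restrict)
    have "(\<integral>x. g x \<partial>l) = (\<integral>t. g (f' t) \<partial>m)"
      unfolding l_def by (rule integral_distr[OF f'm gm])
    also have "\<dots> = (\<integral>t. h t \<partial>m)"
    proof (rule integral_cong_AE)
      show "(\<lambda>t. g (f' t)) \<in> borel_measurable m" using measurable_compose[OF f'm gm] .
      show "AE t in m. g (f' t) = h t" using aeK by eventually_elim (simp add: f'_def h(2))
    qed simp
    finally have "(\<integral>x. g x \<partial>l) = (\<integral>t. h t \<partial>m)" .
    moreover have "(\<integral>x. h (s x) \<partial>u n) = (\<integral>x. g x \<partial>u n)" for n
      by (rule Bochner_Integration.integral_cong) (auto simp: spu sK h(2) fs)
    ultimately show "(\<lambda>n. \<integral>x. g x \<partial>(u \<circ> r) n) \<longlonglongrightarrow> (\<integral>x. g x \<partial>l)"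
      using conv[OF h(1) hb] by simp
  qed
  with r l show thesis by (rule that)
qed

lemma radon_measures_scale:
  assumes "\<mu> \<in> radon_measures S" "0 \<le> c"
  shows "density \<mu> (\<lambda>_. ennreal c) \<in> radon_measures S"
    and "measure (density \<mu> (\<lambda>_. ennreal c)) S = c * measure \<mu> S"
proof -
  interpret finite_measure \<mu> using radon_measuresD(3)[OF assms(1)] .
  have S: "S \<in> sets \<mu>" using radon_measuresD(2)[OF assms(1)] sets.top by metis
  have "emeasure (density \<mu> (\<lambda>_. ennreal c)) S = ennreal c * emeasure \<mu> S"
    by (rule emeasure_density_const[OF S])
  then show "density \<mu> (\<lambda>_. ennreal c) \<in> radon_measures S"
    using radon_measuresD[OF assms(1)]
    by (auto simp: radon_measures_def ennreal_mult_eq_top_iff intro!: finite_measureI)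
  show "measure (density \<mu> (\<lambda>_. ennreal c)) S = c * measure \<mu> S"
    using measure_density_const[OF S, of "ennreal c"] assms(2) by simp
qed

lemma integral_density_const:
  fixes f :: "'a \<Rightarrow> real"
  assumes "f \<in> borel_measurable \<mu>" "0 \<le> c"
  shows "(\<integral>x. f x \<partial>density \<mu> (\<lambda>_. ennreal c)) = c * (\<integral>x. f x \<partial>\<mu>)"
  using integral_density[of f \<mu> "\<lambda>_. c"] assms by simp

lemma bounded_radon_measuresD:
  "\<mu> \<in> bounded_radon_measures S M \<Longrightarrow> \<mu> \<in> radon_measures S"
  "\<mu> \<in> bounded_radon_measures S M \<Longrightarrow> measure \<mu> S \<le> M"
  by (auto simp: bounded_radon_measures_def)

text \<open>The masses converge along a subsequence. If their limit is 0, the measures tend to the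
  null measure; otherwise they can eventually be normalised to probability measures, and the limit
  is scaled back.\<close>

theorem radon_seq_compact:
  fixes S :: "'a::euclidean_space set" and u :: "nat \<Rightarrow> 'a measure"
  assumes S: "compact S" and u: "\<And>n. u n \<in> bounded_radon_measures S M"
  obtains r l where "strict_mono r" "l \<in> bounded_radon_measures S M" "weak_star_conv S (u \<circ> r) l"
proof -
  note ur = bounded_radon_measuresD(1)[OF u]
  define c where "c n = measure (u n) S" for n
  have c: "c n \<in> {0..M}" for n using bounded_radon_measuresD(2)[OF u] by (auto simp: c_def)
  then have "\<forall>n. c n \<in> {0..M}" by blast
  from seq_compactE[OF compact_Icc[unfolded compact_eq_seq_compact_metric] this]
  obtain c0 r0 where c0: "c0 \<in> {0..M}" and r0: "strict_mono r0" "(c \<circ> r0) \<longlonglongrightarrow> c0" .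
  have mass: "l \<in> bounded_radon_measures S M"
    if "l \<in> radon_measures S" "strict_mono r" "weak_star_conv S (u \<circ> r) l" for l r
  proof -
    have "(\<lambda>n. c (r n)) \<longlonglongrightarrow> measure l S"
      unfolding c_def using weak_star_conv_mass[OF that(3)] ur that(1) by simp
    then have "measure l S \<le> M" by (rule LIMSEQ_le_const2) (use c in auto)
    with that(1) show ?thesis by (simp add: bounded_radon_measures_def)
  qed
  show thesis
  proof (cases "c0 = 0")
    case True
    define l :: "'a measure" where "l = null_measure (restrict_space borel S)"
    have l: "l \<in> radon_measures S"
      by (auto simp: l_def radon_measures_def intro!: finite_measureI)
    have "weak_star_conv S (u \<circ> r0) l"
      unfolding weak_star_conv_def
    proof (intro allI impI)
      fix g :: "'a \<Rightarrow> real" assume g: "continuous_on S g"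
      obtain B where B: "0 < B" "\<And>x. x \<in> S \<Longrightarrow> \<bar>g x\<bar> \<le> B"
        using continuous_on_compact_bounded[OF S g] by blast
      have "\<bar>(\<integral>x. g x \<partial>u n) - (\<integral>x. 0 \<partial>u n)\<bar> \<le> B * measure (u n) S" for n
        by (rule radon_integral_diff_le[OF ur])
           (use radon_measurable_continuous[OF ur g] B radon_integrable_continuous[OF S ur g] in auto)
      then have *: "norm (\<integral>x. g x \<partial>(u \<circ> r0) n) \<le> B * (c \<circ> r0) n" for n by (simp add: c_def)
      have "(\<lambda>n. B * (c \<circ> r0) n) \<longlonglongrightarrow> B * 0"
        using r0(2) unfolding True by (rule tendsto_mult_left)
      then have "(\<lambda>n. \<integral>x. g x \<partial>(u \<circ> r0) n) \<longlonglongrightarrow> 0"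
        using Lim_null_comparison[of "\<lambda>n. \<integral>x. g x \<partial>(u \<circ> r0) n" "\<lambda>n. B * (c \<circ> r0) n" sequentially] *
        by simp
      then show "(\<lambda>n. \<integral>x. g x \<partial>(u \<circ> r0) n) \<longlonglongrightarrow> (\<integral>x. g x \<partial>l)" by (simp add: l_def)
    qed
    then show ?thesis using that[OF r0(1)] mass[OF l r0(1)] by blast
  next
    case False
    with c0 have "0 < c0" by auto
    then have "eventually (\<lambda>n. 0 < (c \<circ> r0) n) sequentially"
      using order_tendstoD(1)[OF r0(2)] by blast
    then obtain N where N: "\<And>n. n \<ge> N \<Longrightarrow> 0 < c (r0 n)" by (auto simp: eventually_sequentially)
    define q where "q n = r0 (n + N)" for n
    have q: "strict_mono q" using r0(1) by (auto simp: q_def strict_mono_def)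
    have qpos: "0 < c (q n)" for n using N by (simp add: q_def)
    have qlim: "(\<lambda>n. c (q n)) \<longlonglongrightarrow> c0"
      using LIMSEQ_ignore_initial_segment[OF r0(2), of N] by (simp add: q_def)
    define v where "v n = density (u (q n)) (\<lambda>_. ennreal (1 / c (q n)))" for n
    have v: "v n \<in> radon_measures S" "measure (v n) S = 1" for n
    proof -
      have "0 \<le> 1 / c (q n)" using qpos[of n] by simp
      from radon_measures_scale[OF ur[of "q n"] this]
      have *: "v n \<in> radon_measures S" "measure (v n) S = 1 / c (q n) * c (q n)"
        unfolding v_def c_def by this+
      show "v n \<in> radon_measures S" by (rule *)
      show "measure (v n) S = 1" using *(2) qpos[of n] by simp
    qed
    obtain r l where r: "strict_mono r" and l: "l \<in> radon_measures S" "weak_star_conv S (v \<circ> r) l"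
      by (rule prob_radon_seq_compact[OF S v])
    define l' where "l' = density l (\<lambda>_. ennreal c0)"
    have l': "l' \<in> radon_measures S"
      unfolding l'_def by (rule radon_measures_scale(1)[OF l(1)]) (use c0 in simp)
    have "weak_star_conv S (u \<circ> (q \<circ> r)) l'"
      unfolding weak_star_conv_def
    proof (intro allI impI)
      fix g :: "'a \<Rightarrow> real" assume g: "continuous_on S g"
      have *: "c (q n) * (\<integral>x. g x \<partial>v n) = (\<integral>x. g x \<partial>u (q n))" for n
        unfolding v_def using qpos[of n] radon_measurable_continuous[OF ur g]
        by (subst integral_density_const) auto
      have "(\<lambda>n. c (q (r n)) * (\<integral>x. g x \<partial>v (r n))) \<longlonglongrightarrow> c0 * (\<integral>x. g x \<partial>l)"
        using l(2) g LIMSEQ_subseq_LIMSEQ[OF qlim r] unfolding weak_star_conv_def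
        by (intro tendsto_mult) (auto simp: o_def)
      also have "c0 * (\<integral>x. g x \<partial>l) = (\<integral>x. g x \<partial>l')"
        unfolding l'_def using c0 radon_measurable_continuous[OF l(1) g]
        by (subst integral_density_const) auto
      finally show "(\<lambda>n. \<integral>x. g x \<partial>(u \<circ> (q \<circ> r)) n) \<longlonglongrightarrow> (\<integral>x. g x \<partial>l')"
        by (simp add: *)
    qed
    then show ?thesis using that[OF strict_mono_o[OF q r]] mass[OF l' strict_mono_o[OF q r]] by blast
  qed
qed


section \<open>Approximation by continuous functions\<close>

lemma continuous_approx_indicator_closed:
  fixes K :: "'a::metric_space set"
  assumes "closed K"
  obtains g :: "nat \<Rightarrow> 'a \<Rightarrow> real" where "\<And>k. continuous_on UNIV (g k)" "\<And>k x. 0 \<le> g k x" "\<And>k x. g k x \<le> 1"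
    "\<And>x. (\<lambda>k. g k x) \<longlonglongrightarrow> indicator K x"
proof (cases "K = {}")
  case True
  show ?thesis by (rule that[of "\<lambda>_ _. 0"]) (auto simp: True)
next
  case False
  show ?thesis
  proof (rule that[of "\<lambda>k x. max 0 (1 - real k * infdist x K)"])
    show "continuous_on UNIV (\<lambda>x. max 0 (1 - real k * infdist x K))" for k
      by (intro continuous_intros)
    show "max 0 (1 - real k * infdist x K) \<le> 1" for k x
      using infdist_nonneg[of x K] by (auto simp: max_def)
    show "(\<lambda>k. max 0 (1 - real k * infdist x K)) \<longlonglongrightarrow> indicator K x" for x
    proof (cases "x \<in> K")
      case True
      then show ?thesis by simp
    next
      case False
      then have pos: "0 < infdist x K"
        using infdist_pos_not_in_closed[OF assms \<open>K \<noteq> {}\<close>] by blast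
      obtain N where N: "1 / infdist x K < real N" using reals_Archimedean2 by blast
      have "max 0 (1 - real k * infdist x K) = 0" if "k \<ge> N" for k
      proof -
        have "1 / infdist x K \<le> real k" using N that by linarith
        then show ?thesis using pos by (simp add: field_simps max_def)
      qed
      then have "\<forall>\<^sub>F k in sequentially. max 0 (1 - real k * infdist x K) = 0"
        by (auto simp: eventually_sequentially)
      then show ?thesis using False by (simp add: tendsto_eventually)
    qed
  qed simp
qed

text \<open>Inner regularity refers to Borel measures on the whole space, so a measure on S is
  regarded there as one that vanishes outside S.\<close>

lemma radon_extend:
  assumes "\<mu> \<in> radon_measures S"
  shows "id \<in> borel_measurable \<mu>" "finite_measure (distr \<mu> borel id)"
    "B \<in> sets borel \<Longrightarrow> emeasure (distr \<mu> borel id) B = emeasure \<mu> (B \<inter> S)"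
proof -
  interpret finite_measure \<mu> using radon_measuresD(3)[OF assms] .
  have "id \<in> borel_measurable (restrict_space borel S)" unfolding id_def
    by (rule measurable_restrict_space1) simp
  then show m: "id \<in> borel_measurable \<mu>"
    using measurable_cong_sets[OF radon_measuresD(1)[OF assms] refl] by blast
  show "finite_measure (distr \<mu> borel id)" by (rule finite_measure_distr[OF m])
  show "emeasure (distr \<mu> borel id) B = emeasure \<mu> (B \<inter> S)" if "B \<in> sets borel"
    using emeasure_distr[OF m that] by (simp add: radon_measuresD(2)[OF assms])
qed

text \<open>Continuous approximations of indicators determine the measure of closed sets, and inner
  regularity by compact sets then determines the measure of every Borel set.\<close>

lemma radon_measure_eqI:
  fixes \<mu> \<nu> :: "'a::{metric_space, second_countable_topology, complete_space} measure"
  assumes \<mu>: "\<mu> \<in> radon_measures S" and \<nu>: "\<nu> \<in> radon_measures S"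
    and eq: "\<And>f :: 'a \<Rightarrow> real. continuous_on S f \<Longrightarrow> (\<integral>x. f x \<partial>\<mu>) = (\<integral>x. f x \<partial>\<nu>)"
  shows "\<mu> = \<nu>"
proof -
  define \<mu>' where "\<mu>' = distr \<mu> borel id"
  define \<nu>' where "\<nu>' = distr \<nu> borel id"
  have lim: "(\<lambda>k. \<integral>x. g k x \<partial>\<rho>) \<longlonglongrightarrow> measure (distr \<rho> borel id) K"
    if \<rho>: "\<rho> \<in> radon_measures S" and K: "closed K" and g: "\<And>k. continuous_on UNIV (g k)" "\<And>k x. 0 \<le> g k x" "\<And>k x. g k x \<le> 1"
      "\<And>x. (\<lambda>k. g k x) \<longlonglongrightarrow> indicator K x"
    for \<rho> :: "'a measure" and K and g :: "nat \<Rightarrow> 'a \<Rightarrow> real"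
  proof -
    interpret finite_measure \<rho> using radon_measuresD(3)[OF \<rho>] .
    have sets: "sets \<rho> = sets (restrict_space borel S)" "space \<rho> = S" using radon_measuresD[OF \<rho>] by auto
    have KS: "K \<inter> S \<in> sets \<rho>" using K by (auto simp: sets sets_restrict_space)
    have gm: "g k \<in> borel_measurable \<rho>" for k
      by (rule radon_measurable_continuous[OF \<rho>]) (rule continuous_on_subset[OF g(1)], simp)
    have "(\<lambda>k. \<integral>x. g k x \<partial>\<rho>) \<longlonglongrightarrow> (\<integral>x. indicator (K \<inter> S) x \<partial>\<rho>)"
    proof (rule integral_dominated_convergence[where w = "\<lambda>_. 1"])
      show "AE x in \<rho>. (\<lambda>k. g k x) \<longlonglongrightarrow> indicator (K \<inter> S) x"
        using g(4) by (intro AE_I2) (simp add: sets indicator_def)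
      show "AE x in \<rho>. norm (g k x) \<le> 1" for k
        using g(2,3) by (intro AE_I2) (simp add: abs_le_iff order_trans[OF _ g(2)])
    qed (use gm KS in auto)
    then show ?thesis
      using radon_extend(3)[OF \<rho>, of K] K KS by (simp add: measure_def sets Int_absorb2 Int_assoc)
  qed
  have closed: "emeasure \<mu>' K = emeasure \<nu>' K" if K: "closed K" for K
  proof -
    obtain g :: "nat \<Rightarrow> 'a \<Rightarrow> real" where g: "\<And>k. continuous_on UNIV (g k)" "\<And>k x. 0 \<le> g k x" "\<And>k x. g k x \<le> 1"
      "\<And>x. (\<lambda>k. g k x) \<longlonglongrightarrow> indicator K x"
      using continuous_approx_indicator_closed[OF K] by blast
    have "(\<integral>x. g k x \<partial>\<mu>) = (\<integral>x. g k x \<partial>\<nu>)" for k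
      by (rule eq) (rule continuous_on_subset[OF g(1)], simp)
    then have "measure \<mu>' K = measure \<nu>' K"
      using LIMSEQ_unique lim[OF \<mu> K g] lim[OF \<nu> K g] by (simp add: \<mu>'_def \<nu>'_def)
    then show ?thesis
      unfolding \<mu>'_def \<nu>'_def
      using finite_measure.emeasure_eq_measure[OF radon_extend(2)[OF \<mu>]]
        finite_measure.emeasure_eq_measure[OF radon_extend(2)[OF \<nu>]] by simp
  qed
  have "emeasure \<mu>' B = emeasure \<nu>' B" if "B \<in> sets borel" for B
  proof -
    have "emeasure \<mu>' B = (SUP K \<in> {K. K \<subseteq> B \<and> compact K}. emeasure \<mu>' K)"
      by (rule inner_regular)
        (use that finite_measure.emeasure_finite[OF radon_extend(2)[OF \<mu>]] in \<open>auto simp: \<mu>'_def\<close>)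
    also have "\<dots> = (SUP K \<in> {K. K \<subseteq> B \<and> compact K}. emeasure \<nu>' K)"
      by (rule SUP_cong) (auto intro!: closed compact_imp_closed)
    also have "\<dots> = emeasure \<nu>' B"
      by (rule inner_regular[symmetric])
        (use that finite_measure.emeasure_finite[OF radon_extend(2)[OF \<nu>]] in \<open>auto simp: \<nu>'_def\<close>)
    finally show ?thesis .
  qed
  note borel = this
  show ?thesis
  proof (rule measure_eqI)
    show "sets \<mu> = sets \<nu>" using radon_measuresD(1) \<mu> \<nu> by blast
    fix A assume "A \<in> sets \<mu>"
    then obtain B where B: "B \<in> sets borel" "A = B \<inter> S"
      by (auto simp: radon_measuresD(1)[OF \<mu>] sets_restrict_space)
    then show "emeasure \<mu> A = emeasure \<nu> A"
      using borel[OF B(1)] radon_extend(3)[OF \<mu> B(1)] radon_extend(3)[OF \<nu> B(1)] by (simp add: \<mu>'_def \<nu>'_def)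
  qed
qed

text \<open>Induction over integrable functions reduces the claim to a multiple of an indicator.
  There the Borel set is replaced by a compact subset of nearly full measure, and the indicator of
  this subset by a continuous approximation.\<close>

lemma continuous_dense_L1:
  fixes f :: "'a::{metric_space, second_countable_topology, complete_space} \<Rightarrow> real"
  assumes S: "compact S" and \<sigma>: "\<sigma> \<in> radon_measures S" and f: "integrable \<sigma> f" and "0 < e"
  shows "\<exists>g :: 'a \<Rightarrow> real. continuous_on S g \<and> (\<integral>x. \<bar>f x - g x\<bar> \<partial>\<sigma>) < e"
  using f \<open>0 < e\<close>
proof (induction arbitrary: e rule: integrable_induct)
  case (base A c)
  interpret finite_measure \<sigma> using radon_measuresD(3)[OF \<sigma>] .
  have sp: "space \<sigma> = S" using radon_measuresD(2)[OF \<sigma>] .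
  from base(1) obtain B where B: "B \<in> sets borel" "A = B \<inter> S"
    by (auto simp: radon_measuresD(1)[OF \<sigma>] sets_restrict_space)
  \<comment> \<open>Two errors of size \<bar>c\<bar> * d arise, one from the compact subset and one
    from smoothing its indicator; the summand 1 covers c = 0.\<close>
  define d where "d = e / (2 * (\<bar>c\<bar> + 1))"
  have d: "0 < d" "2 * (\<bar>c\<bar> * d) < e" using base(3) by (auto simp: d_def field_simps)
  define \<sigma>' where "\<sigma>' = distr \<sigma> borel id"
  interpret s': finite_measure \<sigma>' unfolding \<sigma>'_def using radon_extend(2)[OF \<sigma>] .
  have "emeasure \<sigma>' B = (SUP K \<in> {K. K \<subseteq> B \<and> compact K}. emeasure \<sigma>' K)"
    by (rule inner_regular) (use B s'.emeasure_finite in \<open>auto simp: \<sigma>'_def\<close>)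
  note sup = this
  have ne: "{K. K \<subseteq> B \<and> compact K} \<noteq> {}" using compact_empty by blast
  have "\<exists>K\<in>{K. K \<subseteq> B \<and> compact K}. emeasure \<sigma>' B < emeasure \<sigma>' K + ennreal d"
    by (rule SUP_approx_ennreal[OF d(1) ne sup]) (simp add: s'.emeasure_finite)
  then obtain K where K: "K \<subseteq> B" "compact K" "emeasure \<sigma>' B < emeasure \<sigma>' K + ennreal d"
    by blast
  have KS: "K \<inter> S \<in> sets \<sigma>"
    using compact_imp_closed[OF K(2)] by (auto simp: radon_measuresD(1)[OF \<sigma>] sets_restrict_space)
  have "emeasure \<sigma> A < emeasure \<sigma> (K \<inter> S) + ennreal d"
    using K(3) radon_extend(3)[OF \<sigma>, of K] radon_extend(3)[OF \<sigma> B(1)] compact_imp_closed[OF K(2)]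
    by (simp add: \<sigma>'_def B(2))
  then have mA: "measure \<sigma> A < measure \<sigma> (K \<inter> S) + d"
    using d(1) unfolding emeasure_eq_measure by (simp add: ennreal_less_iff flip: ennreal_plus)
  obtain g :: "nat \<Rightarrow> 'a \<Rightarrow> real" where g: "\<And>k. continuous_on UNIV (g k)" "\<And>k x. 0 \<le> g k x" "\<And>k x. g k x \<le> 1"
    "\<And>x. (\<lambda>k. g k x) \<longlonglongrightarrow> indicator K x"
    using continuous_approx_indicator_closed[OF compact_imp_closed[OF K(2)]] by blast
  have gc: "continuous_on S (g k)" for k by (rule continuous_on_subset[OF g(1)]) simp
  have gm [measurable]: "g k \<in> borel_measurable \<sigma>" for k by (rule radon_measurable_continuous[OF \<sigma> gc])
  have gi: "integrable \<sigma> (g k)" for k by (rule radon_integrable_continuous[OF S \<sigma> gc])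
  have "(\<lambda>k. \<integral>x. \<bar>indicator (K \<inter> S) x - g k x\<bar> \<partial>\<sigma>) \<longlonglongrightarrow> (\<integral>x. 0 \<partial>\<sigma>)"
  proof (rule integral_dominated_convergence[where w = "\<lambda>_. 1"])
    show "AE x in \<sigma>. (\<lambda>k. \<bar>indicator (K \<inter> S) x - g k x\<bar>) \<longlonglongrightarrow> 0"
    proof (rule AE_I2)
      fix x assume "x \<in> space \<sigma>"
      then have "(\<lambda>k. \<bar>indicator (K \<inter> S) x - g k x\<bar>) \<longlonglongrightarrow> \<bar>indicator (K \<inter> S) x - indicator K x\<bar>"
        by (intro tendsto_intros g(4))
      then show "(\<lambda>k. \<bar>indicator (K \<inter> S) x - g k x\<bar>) \<longlonglongrightarrow> 0"
        using \<open>x \<in> space \<sigma>\<close> by (simp add: sp indicator_def)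
    qed
    have *: "\<bar>indicator (K \<inter> S) x - g k x\<bar> \<le> 1" for x k
      using g(2,3)[of k x] by (auto simp: indicator_def)
    show "AE x in \<sigma>. norm \<bar>indicator (K \<inter> S) x - g k x\<bar> \<le> 1" for k
      using * by (intro AE_I2) simp
  qed (use KS in auto)
  then have "eventually (\<lambda>k. (\<integral>x. \<bar>indicator (K \<inter> S) x - g k x\<bar> \<partial>\<sigma>) < d) sequentially"
    using order_tendstoD(2)[of _ 0 sequentially d] d(1) by simp
  then obtain k where k: "(\<integral>x. \<bar>indicator (K \<inter> S) x - g k x\<bar> \<partial>\<sigma>) < d"
    by (auto simp: eventually_sequentially)
  have "(\<integral>x. \<bar>indicator A x *\<^sub>R c - c * g k x\<bar> \<partial>\<sigma>)
      \<le> (\<integral>x. \<bar>c\<bar> * (indicator A x - indicator (K \<inter> S) x) + \<bar>c\<bar> * \<bar>indicator (K \<inter> S) x - g k x\<bar> \<partial>\<sigma>)"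
  proof (rule integral_mono)
    show "integrable \<sigma> (\<lambda>x. \<bar>indicator A x *\<^sub>R c - c * g k x\<bar>)"
      "integrable \<sigma> (\<lambda>x. \<bar>c\<bar> * (indicator A x - indicator (K \<inter> S) x) + \<bar>c\<bar> * \<bar>indicator (K \<inter> S) x - g k x\<bar>)"
      using base(1) KS gi by (auto intro!: integrable_abs Bochner_Integration.integrable_diff
          Bochner_Integration.integrable_add integrable_mult_right integrable_real_indicator emeasure_finite simp: less_top[symmetric])
    fix x
    have "\<bar>indicator A x *\<^sub>R c - c * g k x\<bar> = \<bar>c * (indicator A x - indicator (K \<inter> S) x) + c * (indicator (K \<inter> S) x - g k x)\<bar>"
      by (simp add: algebra_simps)
    also have "\<dots> \<le> \<bar>c\<bar> * \<bar>indicator A x - indicator (K \<inter> S) x\<bar> + \<bar>c\<bar> * \<bar>indicator (K \<inter> S) x - g k x\<bar>"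
      by (rule order_trans[OF abs_triangle_ineq]) (simp add: abs_mult)
    also have "\<bar>indicator A x - indicator (K \<inter> S) x :: real\<bar> = indicator A x - indicator (K \<inter> S) x"
      using K(1) B(2) by (auto simp: indicator_def)
    finally show "\<bar>indicator A x *\<^sub>R c - c * g k x\<bar>
        \<le> \<bar>c\<bar> * (indicator A x - indicator (K \<inter> S) x) + \<bar>c\<bar> * \<bar>indicator (K \<inter> S) x - g k x\<bar>" .
  qed
  also have "\<dots> = \<bar>c\<bar> * (measure \<sigma> A - measure \<sigma> (K \<inter> S)) + \<bar>c\<bar> * (\<integral>x. \<bar>indicator (K \<inter> S) x - g k x\<bar> \<partial>\<sigma>)"
    using base(1) KS gi sets.sets_into_space[OF base(1)] sets.sets_into_space[OF KS]
    by (subst Bochner_Integration.integral_add)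
      (auto simp: integrable_real_indicator emeasure_finite less_top[symmetric] Int_absorb1 Int_absorb2)
  also have "\<dots> \<le> \<bar>c\<bar> * d + \<bar>c\<bar> * d"
    using mA k by (intro add_mono mult_left_mono) auto
  also have "\<dots> < e" using d(2) by (simp add: mult.commute)
  finally show ?case
    by (intro exI[of _ "\<lambda>x. c * g k x"] conjI continuous_intros gc)
next
  case (add f1 f2)
  from add.IH(1)[of "e / 2"] obtain g1 where g1: "continuous_on S g1" "(\<integral>x. \<bar>f1 x - g1 x\<bar> \<partial>\<sigma>) < e / 2"
    using add.prems by auto
  from add.IH(2)[of "e / 2"] obtain g2 where g2: "continuous_on S g2" "(\<integral>x. \<bar>f2 x - g2 x\<bar> \<partial>\<sigma>) < e / 2"
    using add.prems by auto
  note gi = radon_integrable_continuous[OF S \<sigma> g1(1)] radon_integrable_continuous[OF S \<sigma> g2(1)]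
  have "(\<integral>x. \<bar>f1 x + f2 x - (g1 x + g2 x)\<bar> \<partial>\<sigma>) \<le> (\<integral>x. \<bar>f1 x - g1 x\<bar> + \<bar>f2 x - g2 x\<bar> \<partial>\<sigma>)"
    using add.hyps gi by (intro integral_mono) auto
  also have "\<dots> = (\<integral>x. \<bar>f1 x - g1 x\<bar> \<partial>\<sigma>) + (\<integral>x. \<bar>f2 x - g2 x\<bar> \<partial>\<sigma>)"
    using add.hyps gi by (intro Bochner_Integration.integral_add) auto
  also have "\<dots> < e" using g1(2) g2(2) by simp
  finally show ?case using g1(1) g2(1) by (intro exI[of _ "\<lambda>x. g1 x + g2 x"] conjI continuous_intros)
next
  case (lim f s)
  have "(\<lambda>i. \<integral>x. \<bar>f x - s i x\<bar> \<partial>\<sigma>) \<longlonglongrightarrow> (\<integral>x. 0 \<partial>\<sigma>)"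
  \<comment> \<open>The simple approximations satisfy \<bar>s i x\<bar> \<le> 2 * \<bar>f x\<bar>,
    whence the factor 3.\<close>
  proof (rule integral_dominated_convergence[where w = "\<lambda>x. 3 * \<bar>f x\<bar>"])
    show "AE x in \<sigma>. (\<lambda>i. \<bar>f x - s i x\<bar>) \<longlonglongrightarrow> 0"
    proof (rule AE_I2)
      fix x assume "x \<in> space \<sigma>"
      then have "(\<lambda>i. \<bar>f x - s i x\<bar>) \<longlonglongrightarrow> \<bar>f x - f x\<bar>" by (intro tendsto_intros lim.hyps)
      then show "(\<lambda>i. \<bar>f x - s i x\<bar>) \<longlonglongrightarrow> 0" by simp
    qed
    show "AE x in \<sigma>. norm \<bar>f x - s i x\<bar> \<le> 3 * \<bar>f x\<bar>" for i
    proof (rule AE_I2)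
      fix x assume "x \<in> space \<sigma>"
      from lim.hyps(3)[OF this, of i] show "norm \<bar>f x - s i x\<bar> \<le> 3 * \<bar>f x\<bar>" by simp
    qed
  qed (use lim.hyps in auto)
  then have "eventually (\<lambda>i. (\<integral>x. \<bar>f x - s i x\<bar> \<partial>\<sigma>) < e / 2) sequentially"
    using order_tendstoD(2)[of _ 0 sequentially "e / 2"] lim.prems by simp
  then obtain i where i: "(\<integral>x. \<bar>f x - s i x\<bar> \<partial>\<sigma>) < e / 2" by (auto simp: eventually_sequentially)
  from lim.IH[of "e / 2" i] obtain g where g: "continuous_on S g" "(\<integral>x. \<bar>s i x - g x\<bar> \<partial>\<sigma>) < e / 2"
    using lim.prems by auto
  note gi = radon_integrable_continuous[OF S \<sigma> g(1)]
  have "(\<integral>x. \<bar>f x - g x\<bar> \<partial>\<sigma>) \<le> (\<integral>x. \<bar>f x - s i x\<bar> + \<bar>s i x - g x\<bar> \<partial>\<sigma>)"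
    using lim.hyps gi by (intro integral_mono) auto
  also have "\<dots> = (\<integral>x. \<bar>f x - s i x\<bar> \<partial>\<sigma>) + (\<integral>x. \<bar>s i x - g x\<bar> \<partial>\<sigma>)"
    using lim.hyps gi by (intro Bochner_Integration.integral_add) auto
  also have "\<dots> < e" using i g(2) by simp
  finally show ?case using g(1) by blast
qed


section \<open>Metrizability of the weak* topology on bounded sets\<close>

text \<open>The stages make countability a plain induction; closure under sums and products holds
  only for their union.\<close>

primrec rational_polynomials :: "nat \<Rightarrow> ('a::euclidean_space \<Rightarrow> real) set" where
  "rational_polynomials 0 = range (\<lambda>r x. of_rat r) \<union> (\<lambda>b x. x \<bullet> b) ` Basis"
| "rational_polynomials (Suc n) = rational_polynomials n
     \<union> (\<lambda>(f, g) x. f x + g x) ` (rational_polynomials n \<times> rational_polynomials n)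
     \<union> (\<lambda>(f, g) x. f x * g x) ` (rational_polynomials n \<times> rational_polynomials n)"

lemma countable_rational_polynomials: "countable (rational_polynomials n)"
  by (induction n) (auto intro!: countable_image countable_finite[OF finite_Basis])

lemma rational_polynomials_mono: "m \<le> n \<Longrightarrow> rational_polynomials m \<subseteq> rational_polynomials n"
  by (rule lift_Suc_mono_le[of rational_polynomials]) auto

lemma continuous_rational_polynomials: "f \<in> rational_polynomials n \<Longrightarrow> continuous_on S f"
  by (induction n arbitrary: f) (auto intro!: continuous_intros)

lemma rational_polynomials_closed:
  assumes "f \<in> (\<Union>n. rational_polynomials n)" "g \<in> (\<Union>n. rational_polynomials n)"
  shows "(\<lambda>x. f x + g x) \<in> (\<Union>n. rational_polynomials n)" "(\<lambda>x. f x * g x) \<in> (\<Union>n. rational_polynomials n)"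
proof -
  obtain m k where mk: "f \<in> rational_polynomials m" "g \<in> rational_polynomials k" using assms by auto
  then have *: "f \<in> rational_polynomials (max m k)" "g \<in> rational_polynomials (max m k)"
    using rational_polynomials_mono[of m "max m k"] rational_polynomials_mono[of k "max m k"] by auto
  have "(\<lambda>x. f x + g x) \<in> rational_polynomials (Suc (max m k))"
    using * by (auto intro!: image_eqI[of _ _ "(f, g)"])
  then show "(\<lambda>x. f x + g x) \<in> (\<Union>n. rational_polynomials n)" by blast
  have "(\<lambda>x. f x * g x) \<in> rational_polynomials (Suc (max m k))"
    using * by (auto intro!: image_eqI[of _ _ "(f, g)"])
  then show "(\<lambda>x. f x * g x) \<in> (\<Union>n. rational_polynomials n)" by blast
qed

lemma rational_polynomials_const: "(\<lambda>x. of_rat r) \<in> (\<Union>n. rational_polynomials n)"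
  by (rule UN_I[of 0], simp, unfold rational_polynomials.simps, blast)

text \<open>Continuity is included because approximating a product requires bounds of both factors
  on the compact set S.\<close>

definition rationally_approximable :: "'a::euclidean_space set \<Rightarrow> ('a \<Rightarrow> real) \<Rightarrow> bool" where
  "rationally_approximable S f \<longleftrightarrow> continuous_on S f \<and>
     (\<forall>e>0. \<exists>g\<in>(\<Union>n. rational_polynomials n). \<forall>x\<in>S. \<bar>f x - g x\<bar> < e)"

lemma rationally_approximable_const: "rationally_approximable S (\<lambda>x. c)"
  unfolding rationally_approximable_def
proof (intro conjI allI impI continuous_on_const)
  fix e :: real assume "0 < e"
  then obtain r where r: "c - e < of_rat r" "of_rat r < c" using of_rat_dense[of "c - e" c] by auto
  have "(\<lambda>x. of_rat r) \<in> (\<Union>n. rational_polynomials n)" by (rule rational_polynomials_const)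
  then show "\<exists>g\<in>\<Union> (range rational_polynomials). \<forall>x\<in>S. \<bar>c - g x\<bar> < e"
    using r by (intro bexI[of _ "\<lambda>x. of_rat r"]) auto
qed

lemma rationally_approximable_coordinate: "b \<in> Basis \<Longrightarrow> rationally_approximable S (\<lambda>x. x \<bullet> b)"
  unfolding rationally_approximable_def
proof (intro conjI allI impI)
  fix e :: real assume "0 < e" and "b \<in> Basis"
  then have "(\<lambda>x. x \<bullet> b) \<in> (\<Union>n. rational_polynomials n)" by (intro UN_I[of 0]) auto
  then show "\<exists>g\<in>\<Union> (range rational_polynomials). \<forall>x\<in>S. \<bar>x \<bullet> b - g x\<bar> < e"
    using \<open>0 < e\<close> by (intro bexI[of _ "\<lambda>x. x \<bullet> b"]) auto
qed (intro continuous_intros)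

lemma rationally_approximable_add:
  assumes f: "rationally_approximable S f" and g: "rationally_approximable S g"
  shows "rationally_approximable S (\<lambda>x. f x + g x)"
  unfolding rationally_approximable_def
proof (intro conjI allI impI)
  show "continuous_on S (\<lambda>x. f x + g x)"
    using assms by (auto simp: rationally_approximable_def intro: continuous_intros)
  fix e :: real assume "0 < e"
  obtain f' where f': "f' \<in> (\<Union>n. rational_polynomials n)" "\<forall>x\<in>S. \<bar>f x - f' x\<bar> < e / 2"
    using f \<open>0 < e\<close> unfolding rationally_approximable_def by (meson half_gt_zero)
  obtain g' where g': "g' \<in> (\<Union>n. rational_polynomials n)" "\<forall>x\<in>S. \<bar>g x - g' x\<bar> < e / 2"
    using g \<open>0 < e\<close> unfolding rationally_approximable_def by (meson half_gt_zero)
  have "\<bar>f x + g x - (f' x + g' x)\<bar> < e" if "x \<in> S" for x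
    using f'(2)[rule_format, OF that] g'(2)[rule_format, OF that] by linarith
  then show "\<exists>h\<in>\<Union> (range rational_polynomials). \<forall>x\<in>S. \<bar>f x + g x - h x\<bar> < e"
    by (intro bexI[OF _ rational_polynomials_closed(1)[OF f'(1) g'(1)]]) auto
qed

lemma rationally_approximable_mult:
  assumes S: "compact S" and f: "rationally_approximable S f" and g: "rationally_approximable S g"
  shows "rationally_approximable S (\<lambda>x. f x * g x)"
  unfolding rationally_approximable_def
proof (intro conjI allI impI)
  have fc: "continuous_on S f" and gc: "continuous_on S g"
    using assms by (auto simp: rationally_approximable_def)
  then show "continuous_on S (\<lambda>x. f x * g x)" by (intro continuous_intros)
  obtain A where A: "0 < A" "\<And>x. x \<in> S \<Longrightarrow> \<bar>f x\<bar> \<le> A" using continuous_on_compact_bounded[OF S fc] by blast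
  obtain B where B: "0 < B" "\<And>x. x \<in> S \<Longrightarrow> \<bar>g x\<bar> \<le> B" using continuous_on_compact_bounded[OF S gc] by blast
  fix e :: real assume "0 < e"
  \<comment> \<open>The cap 1 makes B + 1 a bound for g', so the error of the product is below A * d
    + d * (B + 1), which is at most e.\<close>
  define d where "d = min 1 (e / (A + B + 1))"
  have d: "0 < d" "d \<le> 1" using A(1) B(1) \<open>0 < e\<close> by (auto simp: d_def)
  have "(A + B + 1) * d \<le> (A + B + 1) * (e / (A + B + 1))"
    using A(1) B(1) by (intro mult_left_mono) (auto simp: d_def)
  then have d3: "(A + B + 1) * d \<le> e" using A(1) B(1) by simp
  obtain f' where f': "f' \<in> (\<Union>n. rational_polynomials n)" "\<forall>x\<in>S. \<bar>f x - f' x\<bar> < d"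
    using f d(1) unfolding rationally_approximable_def by meson
  obtain g' where g': "g' \<in> (\<Union>n. rational_polynomials n)" "\<forall>x\<in>S. \<bar>g x - g' x\<bar> < d"
    using g d(1) unfolding rationally_approximable_def by meson
  have "\<bar>f x * g x - f' x * g' x\<bar> < e" if "x \<in> S" for x
  proof -
    have 1: "\<bar>f x - f' x\<bar> < d" "\<bar>g x - g' x\<bar> < d" using f'(2) g'(2) that by auto
    have 2: "\<bar>g' x\<bar> \<le> B + 1" using 1(2) B(2)[OF that] d(2) by linarith
    have "f x * g x - f' x * g' x = f x * (g x - g' x) + (f x - f' x) * g' x" by (simp add: algebra_simps)
    then have "\<bar>f x * g x - f' x * g' x\<bar> \<le> \<bar>f x\<bar> * \<bar>g x - g' x\<bar> + \<bar>f x - f' x\<bar> * \<bar>g' x\<bar>"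
      by (metis abs_mult abs_triangle_ineq)
    also have "\<dots> \<le> A * \<bar>g x - g' x\<bar> + \<bar>f x - f' x\<bar> * (B + 1)"
      using 2 A(2)[OF that] by (intro add_mono mult_mono) auto
    also have "\<dots> < A * d + d * (B + 1)"
      using 1 A(1) B(1) by (intro add_strict_mono mult_strict_left_mono mult_strict_right_mono) auto
    also have "\<dots> \<le> e" using d3 by (simp add: algebra_simps)
    finally show ?thesis .
  qed
  then show "\<exists>h\<in>\<Union> (range rational_polynomials). \<forall>x\<in>S. \<bar>f x * g x - h x\<bar> < e"
    by (intro bexI[OF _ rational_polynomials_closed(2)[OF f'(1) g'(1)]]) auto
qed

lemma rationally_approximable_sum:
  "finite I \<Longrightarrow> (\<And>i. i \<in> I \<Longrightarrow> rationally_approximable S (f i)) \<Longrightarrow> rationally_approximable S (\<lambda>x. \<Sum>i\<in>I. f i x)"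
  by (induction I rule: finite_induct)
    (auto intro: rationally_approximable_const rationally_approximable_add)

lemma rationally_approximable_polynomial:
  assumes "compact S" "real_polynomial_function f"
  shows "rationally_approximable S f"
  using assms(2)
proof induction
  case (linear f)
  then interpret bounded_linear f .
  have "f = (\<lambda>x. \<Sum>b\<in>Basis. (x \<bullet> b) * f b)"
  proof
    fix x
    have "f x = f (\<Sum>b\<in>Basis. (x \<bullet> b) *\<^sub>R b)" by (simp add: euclidean_representation)
    also have "\<dots> = (\<Sum>b\<in>Basis. (x \<bullet> b) * f b)" by (simp add: sum scaleR)
    finally show "f x = (\<Sum>b\<in>Basis. (x \<bullet> b) * f b)" .
  qed
  moreover have "rationally_approximable S (\<lambda>x. \<Sum>b\<in>Basis. (x \<bullet> b) * f b)"
    by (intro rationally_approximable_sum finite_Basis rationally_approximable_mult[OF assms(1)]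
        rationally_approximable_coordinate rationally_approximable_const)
  ultimately show ?case by simp
qed (auto intro: rationally_approximable_const rationally_approximable_add
      rationally_approximable_mult[OF assms(1)])

definition dense_family :: "'a::topological_space set \<Rightarrow> (nat \<Rightarrow> 'a \<Rightarrow> real) \<Rightarrow> bool" where
  "dense_family S q \<longleftrightarrow> (\<forall>i. continuous_on S (q i)) \<and>
     (\<forall>f e. continuous_on S f \<longrightarrow> 0 < e \<longrightarrow> (\<exists>i. \<forall>x\<in>S. \<bar>f x - q i x\<bar> < e))"

text \<open>Stone-Weierstrass provides polynomials with real coefficients; half of the tolerance is
  kept for making the coefficients rational.\<close>

lemma dense_family_exists:
  fixes S :: "'a::euclidean_space set"
  assumes S: "compact S"
  shows "\<exists>q. dense_family S q"
proof -
  define P :: "('a \<Rightarrow> real) set" where "P = (\<Union>n. rational_polynomials n)"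
  have P: "countable P" unfolding P_def by (intro countable_UN countable_rational_polynomials) auto
  have "P \<noteq> {}" unfolding P_def using rational_polynomials_const by blast
  then have ran: "range (from_nat_into P) = P" using P by (rule range_from_nat_into)
  have "dense_family S (from_nat_into P)"
    unfolding dense_family_def
  proof (intro conjI allI impI)
    fix i
    have "from_nat_into P i \<in> P" using ran by blast
    then show "continuous_on S (from_nat_into P i)"
      unfolding P_def using continuous_rational_polynomials by blast
  next
    fix f :: "'a \<Rightarrow> real" and e :: real
    assume f: "continuous_on S f" and "0 < e"
    then have e2: "0 < e / 2" by simp
    obtain p where p: "real_polynomial_function p" "\<And>x. x \<in> S \<Longrightarrow> \<bar>f x - p x\<bar> < e / 2"
      using Stone_Weierstrass_real_polynomial_function[OF S f e2] by metis
    from rationally_approximable_polynomial[OF S p(1)] e2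
    obtain g where g: "g \<in> P" "\<forall>x\<in>S. \<bar>p x - g x\<bar> < e / 2"
      unfolding rationally_approximable_def P_def by meson
    from g(1) ran obtain i where i: "g = from_nat_into P i" by blast
    have "\<bar>f x - g x\<bar> < e" if "x \<in> S" for x
      using p(2)[OF that] g(2)[rule_format, OF that] by linarith
    then show "\<exists>i. \<forall>x\<in>S. \<bar>f x - from_nat_into P i x\<bar> < e" unfolding i by blast
  qed
  then show ?thesis by blast
qed

lemma bounded_radon_nonneg: "\<mu> \<in> bounded_radon_measures S M \<Longrightarrow> 0 \<le> M"
  using measure_nonneg[of \<mu> S] bounded_radon_measuresD(2)[of \<mu> S M] by linarith

lemma integral_approx_bounded_radon:
  fixes f g :: "'a::topological_space \<Rightarrow> real"
  assumes "compact S" "\<mu> \<in> bounded_radon_measures S M" "continuous_on S f" "continuous_on S g"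
    "\<And>x. x \<in> S \<Longrightarrow> \<bar>f x - g x\<bar> \<le> e" "0 \<le> e"
  shows "\<bar>(\<integral>x. f x \<partial>\<mu>) - (\<integral>x. g x \<partial>\<mu>)\<bar> \<le> e * M"
proof -
  note r = bounded_radon_measuresD(1)[OF assms(2)]
  have "\<bar>(\<integral>x. f x \<partial>\<mu>) - (\<integral>x. g x \<partial>\<mu>)\<bar> \<le> e * measure \<mu> S"
    by (rule radon_integral_diff_le[OF r radon_measurable_continuous[OF r assms(3)]
        radon_measurable_continuous[OF r assms(4)] assms(5) radon_integrable_continuous[OF assms(1) r assms(3)]
        radon_integrable_continuous[OF assms(1) r assms(4)]])
  also have "\<dots> \<le> e * M" using bounded_radon_measuresD(2)[OF assms(2)] assms(6) by (rule mult_left_mono)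
  finally show ?thesis .
qed

text \<open>The common mass bound M turns uniform closeness of test functions into closeness of
  their integrals, uniformly in n. Hence countably many test functions detect convergence.\<close>

lemma weak_star_conv_dense_family:
  assumes S: "compact S" and q: "dense_family S q"
    and u: "\<And>n. u n \<in> bounded_radon_measures S M" and l: "l \<in> bounded_radon_measures S M"
    and lim: "\<And>i. (\<lambda>n. \<integral>x. q i x \<partial>u n) \<longlonglongrightarrow> (\<integral>x. q i x \<partial>l)"
  shows "weak_star_conv S u l"
  unfolding weak_star_conv_def
proof (intro allI impI, rule LIMSEQ_I)
  fix f :: "'a \<Rightarrow> real" and e :: real
  assume f: "continuous_on S f" and "0 < e"
  have M: "0 \<le> M" using bounded_radon_nonneg[OF l] .
  define d where "d = e / (3 * (M + 1))"
  have d: "0 < d" "d * M < e / 3" using M \<open>0 < e\<close> by (auto simp: d_def field_simps)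
  obtain i where i: "\<And>x. x \<in> S \<Longrightarrow> \<bar>f x - q i x\<bar> < d" and qc: "continuous_on S (q i)"
    using q f d(1) unfolding dense_family_def by meson
  have approx: "\<bar>(\<integral>x. f x \<partial>\<mu>) - (\<integral>x. q i x \<partial>\<mu>)\<bar> < e / 3" if "\<mu> \<in> bounded_radon_measures S M" for \<mu>
    using integral_approx_bounded_radon[OF S that f qc less_imp_le[OF i] less_imp_le[OF d(1)]] d(2)
    by linarith
  from LIMSEQ_D[OF lim[of i], of "e / 3"] \<open>0 < e\<close>
  obtain N where N: "\<And>n. n \<ge> N \<Longrightarrow> norm ((\<integral>x. q i x \<partial>u n) - (\<integral>x. q i x \<partial>l)) < e / 3" by auto
  have "norm ((\<integral>x. f x \<partial>u n) - (\<integral>x. f x \<partial>l)) < e" if "n \<ge> N" for n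
    using N[OF that] approx[OF u[of n]] approx[OF l] unfolding real_norm_def by linarith
  then show "\<exists>N. \<forall>n\<ge>N. norm ((\<integral>x. f x \<partial>u n) - (\<integral>x. f x \<partial>l)) < e" by blast
qed

lemma continuous_map_integral_weak_star:
  fixes f :: "'a::topological_space \<Rightarrow> real"
  assumes "continuous_on S f"
  shows "continuous_map (weak_star S) euclidean (\<lambda>\<mu>. \<integral>x. f x \<partial>\<mu>)"
  unfolding continuous_map_def
proof (intro conjI allI impI)
  fix U :: "real set" assume "openin euclidean U"
  then have "open U" by (rule open_openin[THEN iffD2])
  with assms show "openin (weak_star S) {\<mu> \<in> topspace (weak_star S). (\<integral>x. f x \<partial>\<mu>) \<in> U}"
    unfolding topspace_weak_star unfolding weak_star_def
    by (intro topology_generated_by_Basis) blast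
qed simp

text \<open>With the countable index type \<open>nat\<close> and real values the product topology is
  metrizable, which makes \<open>nat \<Rightarrow> real\<close> a suitable target for the sequence
  of moments of a measure.\<close>

lemma LIMSEQ_fun_iff:
  fixes f :: "nat \<Rightarrow> 'b \<Rightarrow> 'c::topological_space"
  shows "f \<longlonglongrightarrow> l \<longleftrightarrow> (\<forall>i. (\<lambda>n. f n i) \<longlonglongrightarrow> l i)"
  using limitin_componentwise[of "\<lambda>_. euclidean :: 'c topology" UNIV f l sequentially]
  by (simp add: euclidean_product_topology limitin_canonical_iff)

section \<open>The moment map, an embedding of the bounded measures into a metric space\<close>

context
  fixes S :: "'a::euclidean_space set" and M :: real and q :: "nat \<Rightarrow> 'a \<Rightarrow> real"
    and moments :: "'a measure \<Rightarrow> nat \<Rightarrow> real"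
  assumes S: "compact S" and q: "dense_family S q"
  defines "moments \<mu> i \<equiv> \<integral>x. q i x \<partial>\<mu>"
begin

lemma moments_LIMSEQ_iff:
  assumes "\<And>n. u n \<in> bounded_radon_measures S M" "l \<in> bounded_radon_measures S M"
  shows "(\<lambda>n. moments (u n)) \<longlonglongrightarrow> moments l \<longleftrightarrow> weak_star_conv S u l"
proof
  assume "(\<lambda>n. moments (u n)) \<longlonglongrightarrow> moments l"
  then show "weak_star_conv S u l"
    unfolding LIMSEQ_fun_iff moments_def by (intro weak_star_conv_dense_family[OF S q assms]) blast
next
  assume "weak_star_conv S u l"
  then show "(\<lambda>n. moments (u n)) \<longlonglongrightarrow> moments l"
    using q unfolding LIMSEQ_fun_iff moments_def weak_star_conv_def dense_family_def by blast
qed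

lemma moments_inj: "inj_on moments (bounded_radon_measures S M)"
proof (rule inj_onI)
  fix \<mu> \<nu> assume \<mu>: "\<mu> \<in> bounded_radon_measures S M" and \<nu>: "\<nu> \<in> bounded_radon_measures S M"
    and eq: "moments \<mu> = moments \<nu>"
  \<comment> \<open>As the moments agree, the constant sequence \<mu> converges to \<nu>; hence all
    integrals of continuous functions agree.\<close>
  have "weak_star_conv S (\<lambda>_. \<mu>) \<nu>"
    using moments_LIMSEQ_iff[of "\<lambda>_. \<mu>" \<nu>] \<mu> \<nu> eq by simp
  then have "(\<integral>x. f x \<partial>\<mu>) = (\<integral>x. f x \<partial>\<nu>)" if "continuous_on S f" for f :: "'a \<Rightarrow> real"
    using that unfolding weak_star_conv_def LIMSEQ_const_iff by blast
  then show "\<mu> = \<nu>"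
    by (rule radon_measure_eqI[OF bounded_radon_measuresD(1)[OF \<mu>] bounded_radon_measuresD(1)[OF \<nu>]])
qed

text \<open>In the metric space of moments sequential compactness is compactness, an equivalence
  that the abstract topology \<open>weak_star S\<close> does not offer directly. Both the
  compactness of the bounded measures and the closedness of sequentially closed subsets are derived
  from this.\<close>

lemma seq_compact_moments:
  assumes C: "C \<subseteq> bounded_radon_measures S M"
    and seq: "\<And>u l. (\<And>n. u n \<in> C) \<Longrightarrow> l \<in> bounded_radon_measures S M \<Longrightarrow> weak_star_conv S u l \<Longrightarrow> l \<in> C"
  shows "seq_compact (moments ` C)"
proof (rule seq_compactI)
  fix y :: "nat \<Rightarrow> nat \<Rightarrow> real" assume "\<forall>n. y n \<in> moments ` C"
  then have "\<forall>n. \<exists>\<mu>. \<mu> \<in> C \<and> y n = moments \<mu>" by blast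
  then obtain u where u: "\<And>n. u n \<in> C" "\<And>n. y n = moments (u n)" by metis
  then have uB: "\<And>n. u n \<in> bounded_radon_measures S M" using C by blast
  obtain r l where r: "strict_mono r" "l \<in> bounded_radon_measures S M" "weak_star_conv S (u \<circ> r) l"
    by (rule radon_seq_compact[OF S uB])
  have "l \<in> C" using seq[OF _ r(2,3)] u(1) by simp
  moreover have "(y \<circ> r) \<longlonglongrightarrow> moments l"
    using moments_LIMSEQ_iff[of "u \<circ> r" l] uB r(2,3) by (simp add: u(2) o_def)
  ultimately show "\<exists>l\<in>moments ` C. \<exists>r. strict_mono r \<and> (y \<circ> r) \<longlonglongrightarrow> l" using r(1) by blast
qed

lemma continuous_map_moments: "continuous_map (weak_star S) euclidean moments"
proof -
  have "continuous_map (weak_star S) (product_topology (\<lambda>_. euclidean) UNIV) moments"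
    by (rule continuous_map_coordinatewise_then_product)
      (use q in \<open>auto simp: moments_def dense_family_def intro!: continuous_map_integral_weak_star\<close>)
  then show ?thesis by (simp only: euclidean_product_topology)
qed

text \<open>The bounded measures are the image of the compact set X of their moments under the
  inverse of the moment map. Continuity of this inverse is checked on the generating open sets,
  where sequences in X suffice because X is metric.\<close>

lemma compactin_via_moments: "compactin (weak_star S) (bounded_radon_measures S M)"
proof -
  define B where "B = bounded_radon_measures S M"
  define X where "X = moments ` B"
  define g where "g = inv_into B moments"
  have "seq_compact X" unfolding X_def B_def by (rule seq_compact_moments) auto
  then have X: "compact X" by (simp add: compact_eq_seq_compact_metric)
  have gB: "g y \<in> B" "moments (g y) = y" if "y \<in> X" for y
    using that inv_into_into[of y moments B] f_inv_into_f[of y moments B] by (auto simp: X_def g_def)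
  have "continuous_map (top_of_set X) (weak_star S) g"
    unfolding weak_star_def continuous_on_generated_topo_iff
  proof (intro conjI allI impI)
    fix U assume "U \<in> {{\<mu> \<in> radon_measures S. (\<integral>x. f x \<partial>\<mu>) \<in> U} | (f :: 'a \<Rightarrow> real) U. continuous_on S f \<and> open U}"
    then obtain f :: "'a \<Rightarrow> real" and V where f: "continuous_on S f" and "open V"
      and U: "U = {\<mu> \<in> radon_measures S. (\<integral>x. f x \<partial>\<mu>) \<in> V}" by blast
    have "continuous_on X (\<lambda>y. \<integral>x. f x \<partial>g y)"
      unfolding continuous_on_sequentially
    proof (intro allI ballI impI)
      fix y x assume "y \<in> X" and x: "(\<forall>n. x n \<in> X) \<and> x \<longlonglongrightarrow> y"
      have "weak_star_conv S (\<lambda>n. g (x n)) (g y)"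
        using moments_LIMSEQ_iff[of "\<lambda>n. g (x n)" "g y"] gB x \<open>y \<in> X\<close> by (simp add: B_def)
      then show "((\<lambda>y. \<integral>x. f x \<partial>g y) \<circ> x) \<longlonglongrightarrow> (\<integral>x. f x \<partial>g y)"
        using f unfolding weak_star_conv_def by (simp add: o_def)
    qed
    from continuous_openin_preimage_gen[OF this \<open>open V\<close>]
    have "openin (top_of_set X) (X \<inter> (\<lambda>y. \<integral>x. f x \<partial>g y) -` V)" .
    moreover have "g -` U \<inter> topspace (top_of_set X) = X \<inter> (\<lambda>y. \<integral>x. f x \<partial>g y) -` V"
      using gB(1) bounded_radon_measuresD(1) by (auto simp: U B_def)
    ultimately show "openin (top_of_set X) (g -` U \<inter> topspace (top_of_set X))" by simp
  next
    have "g ` X \<subseteq> radon_measures S" using gB(1) bounded_radon_measuresD(1) by (auto simp: B_def)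
    then show "g ` topspace (top_of_set X)
        \<subseteq> \<Union> {{\<mu> \<in> radon_measures S. (\<integral>x. f x \<partial>\<mu>) \<in> U} | (f :: 'a \<Rightarrow> real) U. continuous_on S f \<and> open U}"
      using topspace_weak_star[of S] unfolding weak_star_def topology_generated_by_topspace by simp
  qed
  then have "compactin (weak_star S) (g ` X)"
    by (rule image_compactin[rotated]) (simp add: X compactin_subtopology)
  moreover have "g ` X = B"
    unfolding X_def g_def using moments_inj by (simp add: B_def image_comp[symmetric] inv_into_image_cancel)
  ultimately show ?thesis by (simp add: B_def)
qed

text \<open>By injectivity, C is the preimage of its image under the continuous moment map, and this
  image is compact, hence closed.\<close>

lemma closedin_via_moments:
  assumes C: "C \<subseteq> bounded_radon_measures S M"
    and seq: "\<And>u l. (\<And>n. u n \<in> C) \<Longrightarrow> l \<in> bounded_radon_measures S M \<Longrightarrow> weak_star_conv S u l \<Longrightarrow> l \<in> C"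
  shows "closedin (subtopology (weak_star S) (bounded_radon_measures S M)) C"
proof -
  have "seq_compact (moments ` C)" by (rule seq_compact_moments[OF C seq])
  then have "closed (moments ` C)"
    by (simp add: compact_eq_seq_compact_metric[symmetric] compact_imp_closed)
  then have cl: "closedin euclidean (moments ` C)" by (rule closed_closedin[THEN iffD1])
  have "continuous_map (subtopology (weak_star S) (bounded_radon_measures S M)) euclidean moments"
    by (rule continuous_map_from_subtopology[OF continuous_map_moments])
  then have "closedin (subtopology (weak_star S) (bounded_radon_measures S M))
      {\<mu> \<in> topspace (subtopology (weak_star S) (bounded_radon_measures S M)). moments \<mu> \<in> moments ` C}"
    by (rule closedin_continuous_map_preimage) (rule cl)
  moreover have "{\<mu> \<in> topspace (subtopology (weak_star S) (bounded_radon_measures S M)). moments \<mu> \<in> moments ` C} = C"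
    using C inj_onD[OF moments_inj] bounded_radon_measuresD(1) by (fastforce simp: topspace_subtopology)
  ultimately show ?thesis by simp
qed

text \<open>A metric ball around the moments of l pulls back to a weak* open set, which the sequence
  enters at arbitrarily late indices; increasing indices are chosen for the radii 1 / (n +
  1).\<close>

lemma cluster_point_subseq_via_moments:
  assumes u: "\<And>n. u n \<in> bounded_radon_measures S M" and l: "l \<in> bounded_radon_measures S M"
    and cl: "cluster_point (weak_star S) u l"
  shows "\<exists>r. strict_mono r \<and> weak_star_conv S (u \<circ> r) l"
proof -
  have near: "\<exists>n>N. dist (moments (u n)) (moments l) < e" if "0 < e" for N e
  proof -
    have "openin (weak_star S) {\<mu> \<in> topspace (weak_star S). moments \<mu> \<in> ball (moments l) e}"
      by (rule openin_continuous_map_preimage[OF continuous_map_moments]) simp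
    then have "\<exists>\<^sub>F n in sequentially. u n \<in> {\<mu> \<in> topspace (weak_star S). moments \<mu> \<in> ball (moments l) e}"
      using cl that unfolding cluster_point_def by fastforce
    then show ?thesis
      unfolding frequently_sequentially by (auto dest!: spec[of _ "Suc N"] simp: dist_commute Suc_le_eq)
  qed
  have "\<exists>r. \<forall>n. dist (moments (u (r n))) (moments l) < 1 / real (Suc n) \<and> r n < r (Suc n)"
  proof (rule dependent_nat_choice)
    show "\<exists>x. dist (moments (u x)) (moments l) < 1 / real (Suc 0)" using near[of 1 0] by auto
    show "\<exists>y. dist (moments (u y)) (moments l) < 1 / real (Suc (Suc n)) \<and> x < y" for x n
      using near[of "1 / real (Suc (Suc n))" x] by auto
  qed
  then obtain r where r: "\<And>n. dist (moments (u (r n))) (moments l) < 1 / real (Suc n)" "\<And>n. r n < r (Suc n)"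
    by blast
  have "(\<lambda>n. dist (moments (u (r n))) (moments l)) \<longlonglongrightarrow> 0"
  proof (rule real_tendsto_sandwich[of "\<lambda>_. 0"])
    show "(\<lambda>n. 1 / real (Suc n)) \<longlonglongrightarrow> 0" by (rule LIMSEQ_Suc[OF lim_1_over_n])
  qed (use r(1) in \<open>auto intro!: always_eventually less_imp_le\<close>)
  then have "(\<lambda>n. moments (u (r n))) \<longlonglongrightarrow> moments l" by (simp add: tendsto_dist_iff[symmetric])
  then have "weak_star_conv S (u \<circ> r) l"
    using moments_LIMSEQ_iff[of "u \<circ> r" l] u l by (simp add: o_def)
  then show ?thesis using r(2) by (auto simp: strict_mono_Suc_iff)
qed

end

theorem compactin_bounded_radon_measures:
  fixes S :: "'a::euclidean_space set"
  assumes "compact S"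
  shows "compactin (weak_star S) (bounded_radon_measures S M)"
proof -
  obtain q where q: "dense_family S q" using dense_family_exists[OF assms] by blast
  show ?thesis by (rule compactin_via_moments[OF assms q])
qed

lemma closedin_bounded_radon_measures_seq:
  fixes S :: "'a::euclidean_space set"
  assumes S: "compact S" and C: "C \<subseteq> bounded_radon_measures S M"
    and seq: "\<And>u l. (\<And>n. u n \<in> C) \<Longrightarrow> l \<in> bounded_radon_measures S M \<Longrightarrow> weak_star_conv S u l \<Longrightarrow> l \<in> C"
  shows "closedin (subtopology (weak_star S) (bounded_radon_measures S M)) C"
proof -
  obtain q where q: "dense_family S q" using dense_family_exists[OF S] by blast
  show ?thesis by (rule closedin_via_moments[OF S q C seq])
qed

lemma closedin_bounded_radon_measures:
  "closedin (weak_star S) (bounded_radon_measures S M)"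
proof -
  have "continuous_map (weak_star S) euclidean (\<lambda>\<mu>. \<integral>x. (1 :: real) \<partial>\<mu>)"
    by (rule continuous_map_integral_weak_star) simp
  then have "closedin (weak_star S) {\<mu> \<in> topspace (weak_star S). (\<integral>x. (1 :: real) \<partial>\<mu>) \<in> {..M}}"
    by (rule closedin_continuous_map_preimage) simp
  moreover have "{\<mu> \<in> topspace (weak_star S). (\<integral>x. (1 :: real) \<partial>\<mu>) \<in> {..M}} = bounded_radon_measures S M"
    unfolding bounded_radon_measures_def topspace_weak_star using integral_one_radon by fastforce
  ultimately show ?thesis by simp
qed

lemma cluster_point_bounded_radon:
  assumes "\<And>n. u n \<in> bounded_radon_measures S M" "cluster_point (weak_star S) u l"
  shows "l \<in> bounded_radon_measures S M"
proof (rule ccontr)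
  assume "l \<notin> bounded_radon_measures S M"
  moreover have "openin (weak_star S) (topspace (weak_star S) - bounded_radon_measures S M)"
    using closedin_bounded_radon_measures by blast
  ultimately have "\<exists>\<^sub>F n in sequentially. u n \<in> topspace (weak_star S) - bounded_radon_measures S M"
    using assms(2) unfolding cluster_point_def by blast
  then obtain n where "u n \<in> topspace (weak_star S) - bounded_radon_measures S M"
    using frequently_ex by blast
  then show False using assms(1)[of n] by blast
qed

lemma cluster_point_subseq:
  fixes S :: "'a::euclidean_space set"
  assumes S: "compact S" and u: "\<And>n. u n \<in> bounded_radon_measures S M"
    and cl: "cluster_point (weak_star S) u l"
  obtains r where "strict_mono r" "weak_star_conv S (u \<circ> r) l"
proof -
  obtain q where q: "dense_family S q" using dense_family_exists[OF S] by blast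
  from cluster_point_subseq_via_moments[OF S q u cluster_point_bounded_radon[OF u cl] cl]
  obtain r where "strict_mono r" "weak_star_conv S (u \<circ> r) l" by auto
  then show ?thesis by (rule that)
qed

lemma precompact_bounded_radon:
  fixes S :: "'a::euclidean_space set"
  assumes S: "compact S" and A: "A \<subseteq> bounded_radon_measures S M"
  shows "precompact_in (weak_star S) A"
  unfolding precompact_in_def
proof
  show "A \<subseteq> topspace (weak_star S)" using A by (auto simp: bounded_radon_measures_def)
  show "compactin (weak_star S) (weak_star S closure_of A)"
    by (rule closed_compactin[OF compactin_bounded_radon_measures[OF S]
        closure_of_minimal[OF A closedin_bounded_radon_measures] closedin_closure_of])
qed

text \<open>Sequential lower semicontinuity suffices because the bounded measures are metrizable.\<close>

lemma borel_measurable_seq_lsc: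
  fixes S :: "'a::euclidean_space set" and F :: "'a measure \<Rightarrow> ennreal"
  assumes S: "compact S"
    and \<Lambda>: "\<Lambda> \<in> borel_prob_measures (subtopology (weak_star S) (bounded_radon_measures S M))"
    and lsc: "\<And>u l a. (\<And>n. u n \<in> bounded_radon_measures S M) \<Longrightarrow> l \<in> bounded_radon_measures S M \<Longrightarrow>
      weak_star_conv S u l \<Longrightarrow> (\<And>n. F (u n) \<le> a) \<Longrightarrow> F l \<le> a"
  shows "F \<in> borel_measurable \<Lambda>"
proof -
  define T where "T = subtopology (weak_star S) (bounded_radon_measures S M)"
  have sets: "sets \<Lambda> = sets (borel_of T)" using \<Lambda> by (simp add: borel_prob_measures_def T_def)
  have tT: "topspace T = bounded_radon_measures S M"
    by (auto simp: T_def topspace_subtopology bounded_radon_measures_def)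
  have Pow: "{U. openin T U} \<subseteq> Pow (topspace T)" using openin_subset by auto
  have sp: "space \<Lambda> = bounded_radon_measures S M"
    unfolding sets_eq_imp_space_eq[OF sets] borel_of_def space_measure_of[OF Pow] by (rule tT)
  show ?thesis
  proof (rule borel_measurableI_le)
    fix a
    define C where "C = {\<mu> \<in> bounded_radon_measures S M. F \<mu> \<le> a}"
    have "closedin T C"
      unfolding T_def
      by (rule closedin_bounded_radon_measures_seq[OF S]) (auto simp: C_def intro: lsc)
    then have "topspace T - C \<in> sets (borel_of T)"
      unfolding borel_of_def sets_measure_of[OF Pow] by (intro sigma_sets.Basic) blast
    then have "topspace T - C \<in> sets \<Lambda>" unfolding sets .
    from sets.compl_sets[OF this] have "space \<Lambda> - (topspace T - C) \<in> sets \<Lambda>" .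
    also have "space \<Lambda> - (topspace T - C) = {\<mu> \<in> space \<Lambda>. F \<mu> \<le> a}"
      unfolding sp tT C_def by blast
    finally show "{\<mu> \<in> space \<Lambda>. F \<mu> \<le> a} \<in> sets \<Lambda>" .
  qed
qed


section \<open>Dual formula for the relative entropy\<close>

text \<open>The convex conjugate of \<open>kl_entropy\<close> on the half-line is exp t - 1; the
  inequality is 1 + x \<le> exp x at x = t - ln s, with equality for t = ln s.\<close>

lemma kl_entropy_young:
  assumes "0 \<le> s"
  shows "s * t - (exp t - 1) \<le> kl_entropy s"
proof (cases "s = 0")
  case False
  with assms have s: "0 < s" by simp
  have "s * (1 + (t - ln s)) \<le> s * exp (t - ln s)"
    using s by (intro mult_left_mono exp_ge_add_one_self) auto
  also have "s * exp (t - ln s) = exp t" using s by (simp add: exp_diff)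
  finally show ?thesis using s by (simp add: kl_entropy_def algebra_simps)
qed (simp add: kl_entropy_def)

lemma kl_entropy_nonneg: "0 \<le> s \<Longrightarrow> 0 \<le> kl_entropy s"
  using kl_entropy_young[of s 0] by simp

lemma kl_entropy_eq_0:
  assumes "0 \<le> s" "kl_entropy s = 0"
  shows "s = 1"
proof -
  have s: "0 < s" using assms by (cases "s = 0") (auto simp: kl_entropy_def)
  then have "ln (1 / s) = 1 / s - 1"
    using assms(2) by (simp add: kl_entropy_def ln_div field_simps)
  then show "s = 1" using s ln_eq_minus_one[of "1 / s"] by simp
qed

lemma kl_entropy_measurable [measurable]: "kl_entropy \<in> borel_measurable borel"
  unfolding kl_entropy_def by measurable

text \<open>Replaces the Radon-Nikodym derivative, which is determined only almost everywhere, by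
  any given density.\<close>

lemma KL_density:
  assumes "finite_measure \<mu>" and [measurable]: "u \<in> borel_measurable \<mu>" and u: "\<And>x. 0 \<le> u x"
  shows "KL (density \<mu> (\<lambda>x. ennreal (u x))) \<mu> = (\<integral>\<^sup>+x. ennreal (kl_entropy (u x)) \<partial>\<mu>)"
proof -
  interpret finite_measure \<mu> by fact
  have *: "AE x in \<mu>. ennreal (u x) = RN_deriv \<mu> (density \<mu> (\<lambda>x. ennreal (u x))) x"
    by (rule RN_deriv_unique) auto
  have "(\<integral>\<^sup>+x. ennreal (kl_entropy (enn2real (RN_deriv \<mu> (density \<mu> (\<lambda>x. ennreal (u x))) x))) \<partial>\<mu>)
      = (\<integral>\<^sup>+x. ennreal (kl_entropy (u x)) \<partial>\<mu>)"
  proof (rule nn_integral_cong_AE)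
    show "AE x in \<mu>. ennreal (kl_entropy (enn2real (RN_deriv \<mu> (density \<mu> (\<lambda>x. ennreal (u x))) x)))
        = ennreal (kl_entropy (u x))"
      using * by eventually_elim (metis enn2real_ennreal u)
  qed
  then show ?thesis
    unfolding KL_def using absolutely_continuousI_density[of "\<lambda>x. ennreal (u x)" \<mu>] by simp
qed

lemma radon_density_exists:
  assumes \<rho>: "\<rho> \<in> radon_measures S" and \<mu>: "\<mu> \<in> radon_measures S" and ac: "absolutely_continuous \<mu> \<rho>"
  obtains u where "u \<in> borel_measurable \<mu>" "\<And>x. 0 \<le> u x" "\<rho> = density \<mu> (\<lambda>x. ennreal (u x))" "integrable \<mu> u"
proof -
  interpret m: finite_measure \<mu> using radon_measuresD(3)[OF \<mu>] .
  interpret r: finite_measure \<rho> using radon_measuresD(3)[OF \<rho>] .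
  have sets: "sets \<rho> = sets \<mu>" using radon_measuresD(1) \<rho> \<mu> by blast
  define u where "u x = enn2real (RN_deriv \<mu> \<rho> x)" for x
  have [measurable]: "u \<in> borel_measurable \<mu>" unfolding u_def by measurable
  have "AE x in \<mu>. RN_deriv \<mu> \<rho> x = ennreal (u x)"
    using m.RN_deriv_finite[OF r.sigma_finite_measure_axioms ac sets]
    by eventually_elim (simp add: u_def less_top)
  then have "density \<mu> (RN_deriv \<mu> \<rho>) = density \<mu> (\<lambda>x. ennreal (u x))"
    by (intro density_cong) auto
  then have d: "\<rho> = density \<mu> (\<lambda>x. ennreal (u x))"
    using m.density_RN_deriv[OF ac sets] by simp
  have "(\<integral>\<^sup>+x. ennreal (u x) \<partial>\<mu>) = emeasure \<rho> (space \<mu>)"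
    by (subst d) (simp add: emeasure_density cong: nn_integral_cong)
  also have "\<dots> < \<infinity>" by (simp add: r.emeasure_eq_measure)
  finally have "integrable \<mu> u"
    by (intro integrableI_bounded) (auto simp: u_def)
  with d show ?thesis by (intro that[of u]) (auto simp: u_def)
qed

text \<open>The dual functional of the relative entropy of measures that need not be normalised: its
  supremum over test functions f is \<open>KL \<rho> \<mu>\<close>.\<close>

definition kl_dual :: "'a measure \<Rightarrow> 'a measure \<Rightarrow> ('a \<Rightarrow> real) \<Rightarrow> real" where
  "kl_dual \<rho> \<mu> f = (\<integral>x. f x \<partial>\<rho>) - (\<integral>x. exp (f x) - 1 \<partial>\<mu>)"

lemma ennreal_integral_le_nn_integral:
  fixes h :: "'a \<Rightarrow> real"
  assumes "integrable \<mu> h"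
  shows "ennreal (\<integral>x. h x \<partial>\<mu>) \<le> (\<integral>\<^sup>+x. ennreal (h x) \<partial>\<mu>)"
proof -
  have i: "integrable \<mu> (\<lambda>x. max 0 (h x))" using assms by auto
  have "ennreal (\<integral>x. h x \<partial>\<mu>) \<le> ennreal (\<integral>x. max 0 (h x) \<partial>\<mu>)"
    using assms i by (intro ennreal_leI integral_mono) auto
  also have "\<dots> = (\<integral>\<^sup>+x. ennreal (max 0 (h x)) \<partial>\<mu>)"
    by (rule nn_integral_eq_integral[OF i, symmetric]) simp
  also have "\<dots> = (\<integral>\<^sup>+x. ennreal (h x) \<partial>\<mu>)"
    by (rule nn_integral_cong) (simp add: max_def ennreal_neg)
  finally show ?thesis .
qed

lemma measurable_radon_iff:
  "\<mu> \<in> radon_measures S \<Longrightarrow> borel_measurable \<mu> = borel_measurable (restrict_space borel S)"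
  using measurable_cong_sets[OF radon_measuresD(1) refl] by blast

lemma exp_bounded_integrable:
  fixes f :: "'a::topological_space \<Rightarrow> real"
  assumes "\<mu> \<in> radon_measures S" "f \<in> borel_measurable \<mu>" "\<forall>x\<in>S. \<bar>f x\<bar> \<le> B"
  shows "integrable \<mu> (\<lambda>x. exp (f x) - 1)"
proof (rule radon_integrable_bounded[OF assms(1)])
  show "(\<lambda>x. exp (f x) - 1) \<in> borel_measurable \<mu>" using assms(2) by measurable
  show "\<bar>exp (f x) - 1\<bar> \<le> exp B + 1" if "x \<in> S" for x
  proof -
    have "exp (f x) \<le> exp B" using assms(3) that by (auto simp: abs_le_iff)
    then show ?thesis using exp_gt_zero[of "f x"] exp_gt_zero[of B] unfolding abs_le_iff by linarith
  qed
qed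

lemma kl_dual_density:
  fixes f :: "'a::topological_space \<Rightarrow> real"
  assumes \<mu>: "\<mu> \<in> radon_measures S" and f: "f \<in> borel_measurable \<mu>" "\<forall>x\<in>S. \<bar>f x\<bar> \<le> B"
    and u: "u \<in> borel_measurable \<mu>" "\<And>x. 0 \<le> u x" "integrable \<mu> u"
  shows "integrable \<mu> (\<lambda>x. u x * f x - (exp (f x) - 1))"
    and "kl_dual (density \<mu> (\<lambda>x. ennreal (u x))) \<mu> f = (\<integral>x. u x * f x - (exp (f x) - 1) \<partial>\<mu>)"
proof -
  have i1: "integrable \<mu> (\<lambda>x. u x * f x)"
  proof (rule Bochner_Integration.integrable_bound)
    show "integrable \<mu> (\<lambda>x. \<bar>B\<bar> * u x)" using u(3) by simp
    show "(\<lambda>x. u x * f x) \<in> borel_measurable \<mu>" using u(1) f(1) by measurable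
    show "AE x in \<mu>. norm (u x * f x) \<le> norm (\<bar>B\<bar> * u x)"
    proof (rule AE_I2)
      fix x assume "x \<in> space \<mu>"
      then have "\<bar>f x\<bar> \<le> \<bar>B\<bar>" using f(2) by (auto simp: radon_measuresD(2)[OF \<mu>])
      from mult_left_mono[OF this u(2)[of x]] show "norm (u x * f x) \<le> norm (\<bar>B\<bar> * u x)"
        using u(2)[of x] by (simp add: abs_mult mult.commute)
    qed
  qed
  note i2 = exp_bounded_integrable[OF \<mu> f]
  show "integrable \<mu> (\<lambda>x. u x * f x - (exp (f x) - 1))" using i1 i2 by (rule Bochner_Integration.integrable_diff)
  have "(\<integral>x. f x \<partial>density \<mu> (\<lambda>x. ennreal (u x))) = (\<integral>x. u x * f x \<partial>\<mu>)"
    using integral_density[OF f(1) u(1)] u(2) by simp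
  then show "kl_dual (density \<mu> (\<lambda>x. ennreal (u x))) \<mu> f = (\<integral>x. u x * f x - (exp (f x) - 1) \<partial>\<mu>)"
    unfolding kl_dual_def using Bochner_Integration.integral_diff[OF i1 i2] by simp
qed

lemma kl_dual_le_KL:
  fixes f :: "'a::topological_space \<Rightarrow> real"
  assumes \<rho>: "\<rho> \<in> radon_measures S" and \<mu>: "\<mu> \<in> radon_measures S"
    and f: "f \<in> borel_measurable \<mu>" "\<forall>x\<in>S. \<bar>f x\<bar> \<le> B"
  shows "ennreal (kl_dual \<rho> \<mu> f) \<le> KL \<rho> \<mu>"
proof (cases "absolutely_continuous \<mu> \<rho>")
  case True
  obtain u where u: "u \<in> borel_measurable \<mu>" "\<And>x. 0 \<le> u x" "integrable \<mu> u"
    and d: "\<rho> = density \<mu> (\<lambda>x. ennreal (u x))"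
    using radon_density_exists[OF \<rho> \<mu> True] by metis
  note k = kl_dual_density[OF \<mu> f u]
  have "ennreal (kl_dual \<rho> \<mu> f) \<le> (\<integral>\<^sup>+x. ennreal (u x * f x - (exp (f x) - 1)) \<partial>\<mu>)"
    unfolding d k(2) by (rule ennreal_integral_le_nn_integral[OF k(1)])
  also have "\<dots> \<le> (\<integral>\<^sup>+x. ennreal (kl_entropy (u x)) \<partial>\<mu>)"
    by (intro nn_integral_mono ennreal_leI kl_entropy_young u(2))
  also have "\<dots> = KL \<rho> \<mu>"
    unfolding d by (rule KL_density[symmetric, OF radon_measuresD(3)[OF \<mu>] u(1,2)])
  finally show ?thesis .
qed (simp add: KL_def)

text \<open>For \<rho> with density u the optimal test function is ln u, which may be unbounded; u
  is therefore clipped to the range from exp (-k) to exp k, and Fatou's lemma removes the clipping.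
  Without absolute continuity, large multiples of the indicator of a set that is null for \<mu> but
  not for \<rho> make the dual value arbitrarily large.\<close>

lemma KL_le_SUP_bounded:
  assumes \<rho>: "\<rho> \<in> radon_measures S" and \<mu>: "\<mu> \<in> radon_measures S"
    and bound: "\<And>f B. f \<in> borel_measurable \<mu> \<Longrightarrow> (\<And>x. \<bar>f x\<bar> \<le> B) \<Longrightarrow> ennreal (kl_dual \<rho> \<mu> f) \<le> c"
  shows "KL \<rho> \<mu> \<le> c"
proof (cases "absolutely_continuous \<mu> \<rho>")
  case True
  interpret m: finite_measure \<mu> using radon_measuresD(3)[OF \<mu>] .
  obtain u where u: "u \<in> borel_measurable \<mu>" "\<And>x. 0 \<le> u x" "integrable \<mu> u"
    and d: "\<rho> = density \<mu> (\<lambda>x. ennreal (u x))"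
    using radon_density_exists[OF \<rho> \<mu> True] by metis
  define v where "v k x = max (exp (- real k)) (min (exp (real k)) (u x))" for k x
  define f where "f k x = ln (v k x)" for k x
  have v: "exp (- real k) \<le> v k x" "v k x \<le> exp (real k)" for k x
    by (auto simp: v_def min_def)
  have vpos: "0 < v k x" for k x using v(1) less_le_trans[OF exp_gt_zero] by blast
  have fb: "\<bar>f k x\<bar> \<le> real k" for k x
    using v[of k x] vpos[of k x] ln_le_cancel_iff[OF exp_gt_zero vpos, of "- real k" k x]
      ln_le_cancel_iff[OF vpos exp_gt_zero, of k x "real k"]
    by (auto simp: f_def abs_le_iff)
  have fm [measurable]: "f k \<in> borel_measurable \<mu>" for k
    unfolding f_def v_def using u(1) by measurable
  have um [measurable]: "u \<in> borel_measurable \<mu>" by fact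
  have ef: "exp (f k x) = v k x" for k x by (simp add: f_def vpos)
  \<comment> \<open>The integrand of the dual value at f k. Fatou's lemma requires it to be
    nonnegative, which is shown by comparison with \<open>kl_entropy (v k x)\<close>.\<close>
  define h where "h k x = u x * f k x - (exp (f k x) - 1)" for k x
  have h0: "0 \<le> h k x" for k x
  proof -
    have "0 \<le> kl_entropy (v k x)" using vpos[of k x] by (intro kl_entropy_nonneg) simp
    also have "kl_entropy (v k x) = v k x * f k x - (v k x - 1)"
      using vpos[of k x] by (simp add: kl_entropy_def f_def)
    also have "\<dots> \<le> h k x"
    proof -
      \<comment> \<open>This product is h k x - kl_entropy (v k x). Where clipping changes u, both
        factors have the same sign: clipping from above leaves f k x = k, clipping from below f k x
        = -k.\<close>
      have "0 \<le> (u x - v k x) * f k x"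
      proof (cases "v k x = u x")
        case False
        then consider "v k x = exp (real k)" "exp (real k) < u x" | "v k x = exp (- real k)" "u x < exp (- real k)"
        proof -
          have "exp (- real k) \<le> exp (real k)" by simp
          then show ?thesis using False that unfolding v_def by (auto simp: max_def min_def split: if_splits)
        qed
        then show ?thesis
        proof cases
          case 1
          then show ?thesis by (intro mult_nonneg_nonneg) (simp_all add: f_def)
        next
          case 2
          then show ?thesis by (intro mult_nonpos_nonpos) (simp_all add: f_def)
        qed
      qed simp
      then show ?thesis by (simp add: h_def ef algebra_simps)
    qed
    finally show ?thesis .
  qed
  have lim: "(\<lambda>k. h k x) \<longlonglongrightarrow> kl_entropy (u x)" for x
  proof (cases "u x = 0")
    case True
    have *: "h k x = 1 - exp (- real k)" for k using True by (simp add: h_def ef v_def max_def)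
    have "(\<lambda>k. 1 - exp (- real k)) \<longlonglongrightarrow> 1 - 0"
      by (intro tendsto_intros filterlim_compose[OF exp_at_bot] filterlim_compose[OF filterlim_uminus_at_bot_at_top]
          filterlim_real_sequentially)
    then show ?thesis unfolding * using True by (simp add: kl_entropy_def)
  next
    case False
    with u(2)[of x] have ux: "0 < u x" by simp
    obtain N where N: "\<bar>ln (u x)\<bar> \<le> real N" using real_arch_simple by blast
    have "h k x = kl_entropy (u x)" if "k \<ge> N" for k
    proof -
      have "\<bar>ln (u x)\<bar> \<le> real k" using N that by linarith
      then have "exp (- real k) \<le> exp (ln (u x))" "exp (ln (u x)) \<le> exp (real k)"
        by (auto simp: abs_le_iff)
      then have "v k x = u x" using ux by (simp add: v_def)
      then show ?thesis using ux by (simp add: h_def f_def kl_entropy_def)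
    qed
    then show ?thesis by (intro tendsto_eventually) (auto simp: eventually_sequentially)
  qed
  have "KL \<rho> \<mu> = (\<integral>\<^sup>+x. ennreal (kl_entropy (u x)) \<partial>\<mu>)"
    unfolding d by (rule KL_density[OF radon_measuresD(3)[OF \<mu>] u(1,2)])
  also have "\<dots> = (\<integral>\<^sup>+x. liminf (\<lambda>k. ennreal (h k x)) \<partial>\<mu>)"
    by (intro nn_integral_cong lim_imp_Liminf[symmetric] tendsto_ennrealI lim) simp
  also have "\<dots> \<le> liminf (\<lambda>k. \<integral>\<^sup>+x. ennreal (h k x) \<partial>\<mu>)"
    by (rule nn_integral_liminf) (simp add: h_def)
  also have "\<dots> \<le> liminf (\<lambda>k :: nat. c)"
  proof (rule Liminf_mono, rule always_eventually, rule allI)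
    fix k
    have "\<forall>x\<in>S. \<bar>f k x\<bar> \<le> real k" using fb by blast
    note kd = kl_dual_density[OF \<mu> fm this u]
    have "(\<integral>\<^sup>+x. ennreal (h k x) \<partial>\<mu>) = ennreal (\<integral>x. h k x \<partial>\<mu>)"
      using kd(1) h0 unfolding h_def by (intro nn_integral_eq_integral) auto
    also have "\<dots> = ennreal (kl_dual \<rho> \<mu> (f k))" unfolding d kd(2) h_def ..
    also have "\<dots> \<le> c" by (rule bound[OF fm fb])
    finally show "(\<integral>\<^sup>+x. ennreal (h k x) \<partial>\<mu>) \<le> c" .
  qed
  also have "\<dots> = c" by (simp add: Liminf_const)
  finally show ?thesis .
next
  case False
  interpret r: finite_measure \<rho> using radon_measuresD(3)[OF \<rho>] .
  have sets: "sets \<rho> = sets \<mu>" using radon_measuresD(1) \<rho> \<mu> by blast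
  from False obtain A where A: "A \<in> null_sets \<mu>" "A \<notin> null_sets \<rho>"
    by (auto simp: absolutely_continuous_def)
  then have As: "A \<in> sets \<mu>" "A \<in> sets \<rho>" using sets by auto
  then have pos: "0 < measure \<rho> A" using A(2) r.emeasure_eq_measure[of A] by (auto simp: zero_less_measure_iff null_sets_def)
  have "ennreal (real k * measure \<rho> A) \<le> c" for k :: nat
  proof -
    define f where "f x = real k * indicator A x" for x
    have [measurable]: "f \<in> borel_measurable \<mu>" unfolding f_def using As by measurable
    have "(\<integral>x. exp (f x) - 1 \<partial>\<mu>) = (\<integral>x. 0 \<partial>\<mu>)"
    proof (rule integral_cong_AE)
      show "(\<lambda>x. exp (f x) - 1) \<in> borel_measurable \<mu>" by measurable
      show "AE x in \<mu>. exp (f x) - 1 = 0" using AE_not_in[OF A(1)] by eventually_elim (simp add: f_def)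
    qed simp
    moreover have "(\<integral>x. f x \<partial>\<rho>) = real k * measure \<rho> A"
      using As sets.sets_into_space[OF As(2)] by (simp add: f_def Int_absorb2)
    ultimately have "kl_dual \<rho> \<mu> f = real k * measure \<rho> A" by (simp add: kl_dual_def)
    moreover have "ennreal (kl_dual \<rho> \<mu> f) \<le> c"
      by (rule bound[of _ "real k"]) (auto simp: f_def indicator_def)
    ultimately show ?thesis by simp
  qed
  then have "c = \<infinity>"
  proof (cases c)
    case (real t)
    obtain k :: nat where "t < real k * measure \<rho> A"
      using reals_Archimedean3[OF pos] by blast
    then show ?thesis using \<open>ennreal (real k * measure \<rho> A) \<le> c\<close> real by (simp add: ennreal_le_iff)
  qed simp
  then show ?thesis by simp
qed

lemma sum_radon_measure:
  assumes \<rho>: "\<rho> \<in> radon_measures S" and \<mu>: "\<mu> \<in> radon_measures S"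
  shows "sum_measure \<rho> \<mu> \<in> radon_measures S" "\<rho> \<le> sum_measure \<rho> \<mu>" "\<mu> \<le> sum_measure \<rho> \<mu>"
proof -
  have sets: "sets \<rho> = sets \<mu>" using radon_measuresD(1) \<rho> \<mu> by blast
  note s = sets_sum_measure[OF sets] emeasure_sum_measure[OF sets]
  have sp: "space (sum_measure \<rho> \<mu>) = S" "space \<rho> = S" "space \<mu> = S"
    using sets_eq_imp_space_eq[OF s(1)] radon_measuresD(2)[OF \<rho>] radon_measuresD(2)[OF \<mu>] by auto
  have top: "S \<in> sets \<rho>" using sets.top[of \<rho>] radon_measuresD(2)[OF \<rho>] by simp
  have "finite_measure (sum_measure \<rho> \<mu>)"
    using s(2)[OF top] finite_measure.emeasure_finite[OF radon_measuresD(3)[OF \<rho>]]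
      finite_measure.emeasure_finite[OF radon_measuresD(3)[OF \<mu>]]
    by (intro finite_measureI) (simp add: sp)
  then show "sum_measure \<rho> \<mu> \<in> radon_measures S"
    using s(1) radon_measuresD(1)[OF \<rho>] by (simp add: radon_measures_def)
  have "emeasure \<rho> A \<le> emeasure (sum_measure \<rho> \<mu>) A" "emeasure \<mu> A \<le> emeasure (sum_measure \<rho> \<mu>) A" for A
  proof -
    show "emeasure \<rho> A \<le> emeasure (sum_measure \<rho> \<mu>) A"
      by (cases "A \<in> sets \<rho>") (auto simp: s(2) emeasure_notin_sets)
    show "emeasure \<mu> A \<le> emeasure (sum_measure \<rho> \<mu>) A"
      by (cases "A \<in> sets \<rho>") (auto simp: s(2) emeasure_notin_sets sets)
  qed
  then show "\<rho> \<le> sum_measure \<rho> \<mu>" "\<mu> \<le> sum_measure \<rho> \<mu>"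
    using s(1) sp sets by (auto simp: le_measure_iff le_fun_def)
qed

lemma integral_abs_mono_measure:
  fixes h :: "'a \<Rightarrow> real"
  assumes "\<rho> \<le> \<sigma>" "sets \<rho> = sets \<sigma>" "integrable \<sigma> h" "integrable \<rho> h"
  shows "(\<integral>x. \<bar>h x\<bar> \<partial>\<rho>) \<le> (\<integral>x. \<bar>h x\<bar> \<partial>\<sigma>)"
proof -
  have "ennreal (\<integral>x. \<bar>h x\<bar> \<partial>\<rho>) = (\<integral>\<^sup>+x. ennreal \<bar>h x\<bar> \<partial>\<rho>)"
    using assms(4) by (intro nn_integral_eq_integral[symmetric]) auto
  also have "\<dots> \<le> (\<integral>\<^sup>+x. ennreal \<bar>h x\<bar> \<partial>\<sigma>)" by (rule nn_integral_mono_measure[OF assms(2,1)])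
  also have "\<dots> = ennreal (\<integral>x. \<bar>h x\<bar> \<partial>\<sigma>)"
    using assms(3) by (intro nn_integral_eq_integral) auto
  finally show ?thesis by (simp add: ennreal_le_iff integral_nonneg_AE)
qed

lemma exp_lipschitz:
  fixes a b :: real
  assumes "a \<le> B" "b \<le> B"
  shows "\<bar>exp a - exp b\<bar> \<le> exp B * \<bar>a - b\<bar>"
proof -
  have *: "exp x - exp y \<le> exp B * (x - y)" if "y \<le> x" "x \<le> B" for x y :: real
  proof -
    have "exp x - exp y = exp x * (1 - exp (y - x))" by (simp add: algebra_simps exp_diff)
    also have "\<dots> \<le> exp x * (x - y)"
    proof (rule mult_left_mono)
      show "1 - exp (y - x) \<le> x - y" using exp_ge_add_one_self[of "y - x"] by linarith
    qed simp
    also have "\<dots> \<le> exp B * (x - y)" using that by (intro mult_right_mono) auto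
    finally show ?thesis .
  qed
  show ?thesis
  proof (cases "a \<le> b")
    case True
    then have "exp a \<le> exp b" by simp
    then show ?thesis using *[OF True assms(2)] True by (simp add: abs_if)
  next
    case False
    then have "exp b < exp a" "b \<le> a" by simp_all
    then show ?thesis using *[OF _ assms(1), of b] by (simp add: abs_if)
  qed
qed

text \<open>Approximation with respect to the sum of \<rho> and \<mu> controls both integrals at
  once. Clipping the approximant at B does not increase its distance to f and makes exp Lipschitz
  with constant exp B.\<close>

lemma kl_dual_continuous_approx:
  fixes \<rho> \<mu> :: "'a::{metric_space, second_countable_topology, complete_space} measure"
  assumes S: "compact S" and \<rho>: "\<rho> \<in> radon_measures S" and \<mu>: "\<mu> \<in> radon_measures S"
    and f: "f \<in> borel_measurable \<mu>" "\<And>x. \<bar>f x\<bar> \<le> B" and "0 < e"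
  obtains g where "continuous_on S g" "kl_dual \<rho> \<mu> f \<le> kl_dual \<rho> \<mu> g + e"
proof -
  define \<sigma> where "\<sigma> = sum_measure \<rho> \<mu>"
  note sr = sum_radon_measure[OF \<rho> \<mu>, folded \<sigma>_def]
  have fm: "f \<in> borel_measurable \<sigma>" "f \<in> borel_measurable \<rho>"
    using f(1) measurable_radon_iff[OF \<mu>] measurable_radon_iff[OF \<rho>] measurable_radon_iff[OF sr(1)] by auto
  have sets: "sets \<rho> = sets \<sigma>" "sets \<mu> = sets \<sigma>"
    using radon_measuresD(1) \<rho> \<mu> sr(1) by blast+
  have fi: "integrable \<sigma> f" "integrable \<rho> f" "integrable \<mu> f"
    using radon_integrable_bounded[OF sr(1) fm(1) f(2)] radon_integrable_bounded[OF \<rho> fm(2) f(2)]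
      radon_integrable_bounded[OF \<mu> f(1) f(2)] by auto
  \<comment> \<open>The integral against \<rho> contributes an error d, the exponential integral
    against \<mu> an error exp B * d.\<close>
  define d where "d = e / (1 + exp B)"
  have pos: "0 < 1 + exp B" by (simp add: add_pos_pos)
  have d: "0 < d" "(1 + exp B) * d = e" using \<open>0 < e\<close> pos by (auto simp: d_def)
  obtain g0 :: "'a \<Rightarrow> real" where g0: "continuous_on S g0" "(\<integral>x. \<bar>f x - g0 x\<bar> \<partial>\<sigma>) < d"
    using continuous_dense_L1[OF S sr(1) fi(1) d(1)] by blast
  define g where "g x = max (- B) (min B (g0 x))" for x
  have gc: "continuous_on S g" unfolding g_def by (intro continuous_intros g0(1))
  have B: "0 \<le> B" using f(2)[of undefined] by simp
  have gB: "\<bar>g x\<bar> \<le> B" for x using B by (auto simp: g_def abs_le_iff)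
  have fg: "\<bar>f x - g x\<bar> \<le> \<bar>f x - g0 x\<bar>" for x
    using f(2)[of x] by (auto simp: g_def abs_le_iff max_def min_def)
  note gi = radon_integrable_continuous[OF S sr(1) gc] radon_integrable_continuous[OF S \<rho> gc]
    radon_integrable_continuous[OF S \<mu> gc]
  have "(\<integral>x. \<bar>f x - g x\<bar> \<partial>\<sigma>) \<le> (\<integral>x. \<bar>f x - g0 x\<bar> \<partial>\<sigma>)"
    using fi(1) gi(1) radon_integrable_continuous[OF S sr(1) g0(1)] fg by (intro integral_mono) auto
  with g0(2) have small: "(\<integral>x. \<bar>f x - g x\<bar> \<partial>\<sigma>) \<le> d" by simp
  have r: "(\<integral>x. \<bar>f x - g x\<bar> \<partial>\<rho>) \<le> d"
    by (rule order_trans[OF integral_abs_mono_measure[OF sr(2) sets(1)] small]) (use fi gi in auto)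
  have m: "(\<integral>x. \<bar>f x - g x\<bar> \<partial>\<mu>) \<le> d"
    by (rule order_trans[OF integral_abs_mono_measure[OF sr(3) sets(2)] small]) (use fi gi in auto)
  have "\<bar>(\<integral>x. f x \<partial>\<rho>) - (\<integral>x. g x \<partial>\<rho>)\<bar> = \<bar>\<integral>x. f x - g x \<partial>\<rho>\<bar>" using fi gi by simp
  also have "\<dots> \<le> d" by (rule order_trans[OF integral_abs_bound r])
  finally have 1: "(\<integral>x. f x \<partial>\<rho>) \<le> (\<integral>x. g x \<partial>\<rho>) + d" by simp
  have "\<forall>x\<in>S. \<bar>f x\<bar> \<le> B" "\<forall>x\<in>S. \<bar>g x\<bar> \<le> B" using f(2) gB by auto
  note ei = exp_bounded_integrable[OF \<mu> f(1) this(1)]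
    exp_bounded_integrable[OF \<mu> radon_measurable_continuous[OF \<mu> gc] this(2)]
  have "(\<integral>x. exp (g x) - 1 \<partial>\<mu>) - (\<integral>x. exp (f x) - 1 \<partial>\<mu>) = (\<integral>x. (exp (g x) - 1) - (exp (f x) - 1) \<partial>\<mu>)"
    by (rule Bochner_Integration.integral_diff[symmetric, OF ei(2,1)])
  also have "\<dots> \<le> (\<integral>x. exp B * \<bar>f x - g x\<bar> \<partial>\<mu>)"
  proof (rule integral_mono)
    show "integrable \<mu> (\<lambda>x. (exp (g x) - 1) - (exp (f x) - 1))" by (rule Bochner_Integration.integrable_diff[OF ei(2,1)])
    show "integrable \<mu> (\<lambda>x. exp B * \<bar>f x - g x\<bar>)" using fi gi by auto
    show "exp (g x) - 1 - (exp (f x) - 1) \<le> exp B * \<bar>f x - g x\<bar>" for x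
    proof -
      have "f x \<le> B" "g x \<le> B" using f(2)[of x] gB[of x] by auto
      from exp_lipschitz[OF this(2,1)] show ?thesis by (simp add: abs_minus_commute)
    qed
  qed
  also have "\<dots> \<le> exp B * d" using m by simp
  finally have 2: "(\<integral>x. exp (g x) - 1 \<partial>\<mu>) \<le> (\<integral>x. exp (f x) - 1 \<partial>\<mu>) + exp B * d" by simp
  have "kl_dual \<rho> \<mu> f \<le> kl_dual \<rho> \<mu> g + e"
    using 1 2 d(2) unfolding kl_dual_def by (simp add: algebra_simps)
  with gc show thesis by (rule that)
qed

text \<open>For continuous f the dual value is weak* continuous in the pair of measures. As a
  supremum of such functionals, the entropy is lower semicontinuous in both arguments
  jointly.\<close>

theorem KL_eq_SUP_kl_dual:
  fixes \<rho> \<mu> :: "'a::{metric_space, second_countable_topology, complete_space} measure"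
  assumes S: "compact S" and \<rho>: "\<rho> \<in> radon_measures S" and \<mu>: "\<mu> \<in> radon_measures S"
  shows "KL \<rho> \<mu> = (SUP f\<in>{f. continuous_on S f}. ennreal (kl_dual \<rho> \<mu> f))"
proof (rule antisym)
  show "KL \<rho> \<mu> \<le> (SUP f\<in>{f. continuous_on S f}. ennreal (kl_dual \<rho> \<mu> f))"
  proof (rule KL_le_SUP_bounded[OF \<rho> \<mu>])
    fix f B assume f: "f \<in> borel_measurable \<mu>" "\<And>x. \<bar>f x\<bar> \<le> (B :: real)"
    show "ennreal (kl_dual \<rho> \<mu> f) \<le> (SUP f\<in>{f. continuous_on S f}. ennreal (kl_dual \<rho> \<mu> f))"
    proof (rule ennreal_le_epsilon)
      fix e :: real assume "0 < e"
      obtain g where g: "continuous_on S g" "kl_dual \<rho> \<mu> f \<le> kl_dual \<rho> \<mu> g + e"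
        by (rule kl_dual_continuous_approx[OF S \<rho> \<mu> f \<open>0 < e\<close>])
      have "ennreal (kl_dual \<rho> \<mu> f) \<le> ennreal (kl_dual \<rho> \<mu> g) + ennreal e"
        using g(2) \<open>0 < e\<close> ennreal_leI[OF g(2)]
        by (cases "0 \<le> kl_dual \<rho> \<mu> g") (auto simp: ennreal_plus ennreal_neg intro: ennreal_leI)
      also have "\<dots> \<le> (SUP f\<in>{f. continuous_on S f}. ennreal (kl_dual \<rho> \<mu> f)) + ennreal e"
        by (intro add_right_mono SUP_upper) (use g(1) in simp)
      finally show "ennreal (kl_dual \<rho> \<mu> f) \<le> (SUP f\<in>{f. continuous_on S f}. ennreal (kl_dual \<rho> \<mu> f)) + ennreal e" .
    qed
  qed
  show "(SUP f\<in>{f. continuous_on S f}. ennreal (kl_dual \<rho> \<mu> f)) \<le> KL \<rho> \<mu>"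
  proof (rule SUP_least)
    fix f :: "'a \<Rightarrow> real" assume "f \<in> {f. continuous_on S f}"
    then have f: "continuous_on S f" by simp
    obtain B where "0 < B" "\<And>x. x \<in> S \<Longrightarrow> \<bar>f x\<bar> \<le> B" using continuous_on_compact_bounded[OF S f] by blast
    then show "ennreal (kl_dual \<rho> \<mu> f) \<le> KL \<rho> \<mu>"
      by (intro kl_dual_le_KL[OF \<rho> \<mu> radon_measurable_continuous[OF \<mu> f]]) blast
  qed
qed

lemma KL_self:
  assumes "\<mu> \<in> radon_measures S"
  shows "KL \<mu> \<mu> = 0"
proof -
  have "KL (density \<mu> (\<lambda>x. ennreal 1)) \<mu> = (\<integral>\<^sup>+x. ennreal (kl_entropy 1) \<partial>\<mu>)"
    by (rule KL_density[OF radon_measuresD(3)[OF assms]]) auto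
  then show ?thesis by (simp add: kl_entropy_def density_1)
qed

lemma KL_eq_0_imp_eq:
  assumes \<rho>: "\<rho> \<in> radon_measures S" and \<mu>: "\<mu> \<in> radon_measures S" and "KL \<rho> \<mu> = 0"
  shows "\<rho> = \<mu>"
proof -
  have ac: "absolutely_continuous \<mu> \<rho>" using assms(3) by (auto simp: KL_def split: if_splits)
  obtain u where u: "u \<in> borel_measurable \<mu>" "\<And>x. 0 \<le> u x"
    and d: "\<rho> = density \<mu> (\<lambda>x. ennreal (u x))"
    using radon_density_exists[OF \<rho> \<mu> ac] by metis
  have [measurable]: "u \<in> borel_measurable \<mu>" by fact
  have "(\<integral>\<^sup>+x. ennreal (kl_entropy (u x)) \<partial>\<mu>) = 0"
    using assms(3) KL_density[OF radon_measuresD(3)[OF \<mu>] u] by (simp add: d)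
  then have "AE x in \<mu>. ennreal (kl_entropy (u x)) = 0" by (subst (asm) nn_integral_0_iff_AE) auto
  then have "AE x in \<mu>. ennreal (u x) = 1"
    by eventually_elim (use u(2) kl_entropy_eq_0 kl_entropy_nonneg in \<open>metis antisym ennreal_eq_0_iff ennreal_1\<close>)
  then have "density \<mu> (\<lambda>x. ennreal (u x)) = density \<mu> (\<lambda>_. 1)" by (intro density_cong) auto
  then show ?thesis by (simp add: d density_1)
qed


section \<open>Lower semicontinuity of entropy-transport functionals\<close>

lemma marginal_measurable:
  fixes S :: "'a::second_countable_topology set"
  assumes "\<gamma> \<in> radon_measures (S \<times> S)"
  shows "fst \<in> measurable \<gamma> (restrict_space borel S)" "snd \<in> measurable \<gamma> (restrict_space borel S)"
proof -
  have "fst \<in> borel_measurable \<gamma>" "snd \<in> borel_measurable \<gamma>"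
    by (intro radon_measurable_continuous[OF assms] continuous_intros)+
  then show "fst \<in> measurable \<gamma> (restrict_space borel S)" "snd \<in> measurable \<gamma> (restrict_space borel S)"
    by (intro measurable_restrict_space2; simp add: radon_measuresD(2)[OF assms] mem_Times_iff Pi_def)+
qed

lemma marginal_radon:
  fixes S :: "'a::second_countable_topology set"
  assumes "\<gamma> \<in> radon_measures (S \<times> S)"
  shows "marginal1 S \<gamma> \<in> radon_measures S" "marginal2 S \<gamma> \<in> radon_measures S"
  using finite_measure.finite_measure_distr[OF radon_measuresD(3)[OF assms] marginal_measurable(1)[OF assms]]
    finite_measure.finite_measure_distr[OF radon_measuresD(3)[OF assms] marginal_measurable(2)[OF assms]]
  by (simp_all add: radon_measures_def marginal1_def marginal2_def)

lemma integral_marginal: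
  fixes S :: "'a::second_countable_topology set" and f :: "'a \<Rightarrow> real"
  assumes "\<gamma> \<in> radon_measures (S \<times> S)" "continuous_on S f"
  shows "(\<integral>x. f x \<partial>marginal1 S \<gamma>) = (\<integral>z. f (fst z) \<partial>\<gamma>)" "(\<integral>x. f x \<partial>marginal2 S \<gamma>) = (\<integral>z. f (snd z) \<partial>\<gamma>)"
  unfolding marginal1_def marginal2_def
  by (rule integral_distr[OF marginal_measurable(1)[OF assms(1)] borel_measurable_continuous_on_restrict[OF assms(2)]],
      rule integral_distr[OF marginal_measurable(2)[OF assms(1)] borel_measurable_continuous_on_restrict[OF assms(2)]])

lemma measure_marginal:
  fixes S :: "'a::second_countable_topology set"
  assumes "\<gamma> \<in> radon_measures (S \<times> S)"
  shows "measure (marginal1 S \<gamma>) S = measure \<gamma> (S \<times> S)" "measure (marginal2 S \<gamma>) S = measure \<gamma> (S \<times> S)"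
  using integral_marginal[OF assms, of "\<lambda>_. 1"]
  unfolding integral_one_radon[OF marginal_radon(1)[OF assms]] integral_one_radon[OF marginal_radon(2)[OF assms]]
    integral_one_radon[OF assms] by simp_all

lemma weak_star_conv_marginal:
  fixes S :: "'a::second_countable_topology set"
  assumes "weak_star_conv (S \<times> S) g \<gamma>" "\<And>n. g n \<in> radon_measures (S \<times> S)" "\<gamma> \<in> radon_measures (S \<times> S)"
  shows "weak_star_conv S (\<lambda>n. marginal1 S (g n)) (marginal1 S \<gamma>)"
    "weak_star_conv S (\<lambda>n. marginal2 S (g n)) (marginal2 S \<gamma>)"
proof -
  have lim: "(\<lambda>n. \<integral>z. h z \<partial>g n) \<longlonglongrightarrow> (\<integral>z. h z \<partial>\<gamma>)" if "continuous_on (S \<times> S) h" for h :: "'a \<times> 'a \<Rightarrow> real"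
    using assms(1) that unfolding weak_star_conv_def by blast
  have c: "continuous_on (S \<times> S) (\<lambda>z. f (fst z))" "continuous_on (S \<times> S) (\<lambda>z. f (snd z))"
    if "continuous_on S f" for f :: "'a \<Rightarrow> real"
    by (rule continuous_on_compose2[OF that]; auto intro: continuous_intros)+
  show "weak_star_conv S (\<lambda>n. marginal1 S (g n)) (marginal1 S \<gamma>)"
    "weak_star_conv S (\<lambda>n. marginal2 S (g n)) (marginal2 S \<gamma>)"
    unfolding weak_star_conv_def
    by (simp_all add: integral_marginal assms(2,3) lim c)
qed

lemma kl_dual_tendsto:
  fixes f :: "'a::topological_space \<Rightarrow> real"
  assumes "weak_star_conv S r \<rho>" "weak_star_conv S u \<mu>" "continuous_on S f"
  shows "(\<lambda>n. kl_dual (r n) (u n) f) \<longlonglongrightarrow> kl_dual \<rho> \<mu> f"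
  unfolding kl_dual_def
proof (rule tendsto_diff)
  show "(\<lambda>n. \<integral>x. f x \<partial>r n) \<longlonglongrightarrow> (\<integral>x. f x \<partial>\<rho>)"
    using assms(1,3) unfolding weak_star_conv_def by blast
  have "continuous_on S (\<lambda>x. exp (f x) - 1)" by (intro continuous_intros assms(3))
  then show "(\<lambda>n. \<integral>x. exp (f x) - 1 \<partial>u n) \<longlonglongrightarrow> (\<integral>x. exp (f x) - 1 \<partial>\<mu>)"
    using assms(2) unfolding weak_star_conv_def by blast
qed

text \<open>The dual bound at the constant test function 1. It gives the a priori mass bound for
  plans whose marginals are only penalised.\<close>

lemma mass_le_KL:
  fixes \<rho> \<mu> :: "'a::topological_space measure"
  assumes "\<rho> \<in> radon_measures S" "\<mu> \<in> radon_measures S" "KL \<rho> \<mu> \<le> ennreal C" "0 \<le> C"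
  shows "measure \<rho> S \<le> C + (exp 1 - 1) * measure \<mu> S"
proof -
  have "ennreal (kl_dual \<rho> \<mu> (\<lambda>_. 1)) \<le> KL \<rho> \<mu>"
    by (rule kl_dual_le_KL[OF assms(1,2), of _ 1]) auto
  also have "\<dots> \<le> ennreal C" by fact
  finally have "kl_dual \<rho> \<mu> (\<lambda>_. 1) \<le> C" using assms(4) by (simp add: ennreal_le_iff)
  moreover have "kl_dual \<rho> \<mu> (\<lambda>_. 1) = measure \<rho> S - (exp 1 - 1) * measure \<mu> S"
    unfolding kl_dual_def using radon_measuresD(2)[OF assms(1)] radon_measuresD(2)[OF assms(2)]
    by (simp add: mult.commute)
  ultimately show ?thesis by simp
qed

definition entropy_transport ::
    "'a::euclidean_space set \<Rightarrow> ('a \<times> 'a \<Rightarrow> ennreal) \<Rightarrow> ennreal \<Rightarrow> 'a measure \<Rightarrow> 'a measure \<Rightarrow> ennreal" where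
  "entropy_transport S c \<alpha> \<mu> \<nu> = (INF \<gamma>\<in>radon_measures (S \<times> S).
     (\<integral>\<^sup>+z. c z \<partial>\<gamma>) + \<alpha> * (KL (marginal1 S \<gamma>) \<mu> + KL (marginal2 S \<gamma>) \<nu>))"

lemma frequently_subseq:
  assumes "\<exists>\<^sub>F n in sequentially. P n"
  shows "\<exists>r :: nat \<Rightarrow> nat. strict_mono r \<and> (\<forall>k. P (r k))"
proof -
  have "infinite {n. P n}"
    using assms INFM_iff_infinite[of P] by (simp add: cofinite_eq_sequentially)
  from infinite_enumerate[OF this] show ?thesis by auto
qed

text \<open>Since the weights are at least 1, plans with values below a common constant have bounded
  entropies and hence bounded masses, so they converge along a subsequence. The limit is taken with
  one continuous minorant of the cost and one test function for each entropy held fixed; the suprema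
  follow only afterwards. Therefore each g j has to stay below the costs only eventually.\<close>

theorem entropy_transport_lsc:
  fixes S :: "'a::euclidean_space set" and c' :: "nat \<Rightarrow> 'a \<times> 'a \<Rightarrow> ennreal" and g :: "nat \<Rightarrow> 'a \<times> 'a \<Rightarrow> real"
  assumes S: "compact S"
    and g: "\<And>j. continuous_on (S \<times> S) (g j)" "\<And>j z. z \<in> S \<times> S \<Longrightarrow> 0 \<le> g j z"
      "\<And>j z. z \<in> S \<times> S \<Longrightarrow> g j z \<le> g (Suc j) z"
    and c: "\<And>z. z \<in> S \<times> S \<Longrightarrow> c z = (SUP j. ennreal (g j z))"
    and c': "\<And>j. \<forall>\<^sub>F n in sequentially. \<forall>z\<in>S \<times> S. ennreal (g j z) \<le> c' n z"
    and \<alpha>: "\<alpha>' \<longlonglongrightarrow> \<alpha>" "\<forall>\<^sub>F n in sequentially. 1 \<le> \<alpha>' n"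
    and u: "\<And>n. u n \<in> bounded_radon_measures S M" "\<mu> \<in> bounded_radon_measures S M" "weak_star_conv S u \<mu>"
    and v: "\<And>n. v n \<in> bounded_radon_measures S M" "\<nu> \<in> bounded_radon_measures S M" "weak_star_conv S v \<nu>"
  shows "entropy_transport S c \<alpha> \<mu> \<nu> \<le> liminf (\<lambda>n. entropy_transport S (c' n) (\<alpha>' n) (u n) (v n))"
    (is "_ \<le> liminf ?E")
proof (rule ccontr)
  assume "\<not> ?thesis"
  then have "liminf ?E < entropy_transport S c \<alpha> \<mu> \<nu>" by simp
  then obtain C0 where C0: "liminf ?E < C0" "C0 < entropy_transport S c \<alpha> \<mu> \<nu>" using dense by blast
  then obtain C where C: "C0 = ennreal C" "0 \<le> C" by (cases C0) auto
  have "\<not> (\<forall>\<^sub>F n in sequentially. C0 \<le> ?E n)"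
    using Liminf_bounded[of C0 ?E sequentially] C0(1) by auto
  then have "\<exists>\<^sub>F n in sequentially. ?E n < C0" by (simp add: not_eventually not_le)
  from frequently_eventually_frequently[OF this \<alpha>(2)]
  have "\<exists>\<^sub>F n in sequentially. ?E n < C0 \<and> 1 \<le> \<alpha>' n" .
  from frequently_subseq[OF this]
  obtain r :: "nat \<Rightarrow> nat" where r: "strict_mono r" and Er: "\<And>k. ?E (r k) < C0 \<and> 1 \<le> \<alpha>' (r k)"
    by blast
  define F where "F n \<gamma> = (\<integral>\<^sup>+z. c' n z \<partial>\<gamma>) + \<alpha>' n * (KL (marginal1 S \<gamma>) (u n) + KL (marginal2 S \<gamma>) (v n))" for n \<gamma>
  have "\<exists>\<gamma>\<in>radon_measures (S \<times> S). F (r k) \<gamma> < C0" for k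
    using Er[of k] unfolding entropy_transport_def INF_less_iff F_def by blast
  then obtain \<gamma> where \<gamma>: "\<And>k. \<gamma> k \<in> radon_measures (S \<times> S)" "\<And>k. F (r k) (\<gamma> k) < C0" by metis
  define B where "B = C + (exp 1 - 1) * M"
  have "\<gamma> k \<in> bounded_radon_measures (S \<times> S) B" for k
  proof -
    let ?K = "KL (marginal1 S (\<gamma> k)) (u (r k))"
    have "?K \<le> 1 * (?K + KL (marginal2 S (\<gamma> k)) (v (r k)))" by simp
    also have "\<dots> \<le> \<alpha>' (r k) * (?K + KL (marginal2 S (\<gamma> k)) (v (r k)))"
      using Er[of k] by (intro mult_right_mono) auto
    also have "\<dots> \<le> F (r k) (\<gamma> k)" by (simp add: F_def)
    also have "\<dots> \<le> ennreal C" using \<gamma>(2)[of k] C(1) by simp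
    finally have "measure (\<gamma> k) (S \<times> S) \<le> C + (exp 1 - 1) * measure (u (r k)) S"
      using mass_le_KL[OF marginal_radon(1)[OF \<gamma>(1)] bounded_radon_measuresD(1)[OF u(1)] _ C(2)]
      unfolding measure_marginal(1)[OF \<gamma>(1)] by blast
    also have "\<dots> \<le> B"
      unfolding B_def using bounded_radon_measuresD(2)[OF u(1), of "r k"]
      by (intro add_left_mono mult_left_mono) auto
    finally show ?thesis using \<gamma>(1) by (simp add: bounded_radon_measures_def)
  qed
  note \<gamma>B = this
  obtain q \<gamma>' where q: "strict_mono q" and \<gamma>': "\<gamma>' \<in> bounded_radon_measures (S \<times> S) B"
    "weak_star_conv (S \<times> S) (\<gamma> \<circ> q) \<gamma>'"
    by (rule radon_seq_compact[OF compact_Times[OF S S] \<gamma>B])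
  note \<gamma>'r = bounded_radon_measuresD(1)[OF \<gamma>'(1)]
  define s where "s = r \<circ> q"
  have s: "strict_mono s" unfolding s_def using r q by (rule strict_mono_o)
  have u': "weak_star_conv S (\<lambda>k. u (s k)) \<mu>" and v': "weak_star_conv S (\<lambda>k. v (s k)) \<nu>"
    using weak_star_conv_subseq[OF u(3) s] weak_star_conv_subseq[OF v(3) s] by (simp_all add: o_def)
  have gq: "\<And>k. (\<gamma> \<circ> q) k \<in> radon_measures (S \<times> S)" using \<gamma>(1) by simp
  note marg = weak_star_conv_marginal[OF \<gamma>'(2) gq \<gamma>'r]
  define x where "x j = ennreal (\<integral>z. g j z \<partial>\<gamma>')" for j
  define y where "y f = ennreal (kl_dual (marginal1 S \<gamma>') \<mu> f)" for f
  define w where "w f = ennreal (kl_dual (marginal2 S \<gamma>') \<nu> f)" for f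
  have main: "x j + \<alpha> * (y f + w h) \<le> C0" if f: "continuous_on S f" and h: "continuous_on S h" for j f h
  proof -
    define a where "a k = (\<integral>z. g j z \<partial>\<gamma> (q k))" for k
    define b where "b k = ennreal (kl_dual (marginal1 S (\<gamma> (q k))) (u (s k)) f)
      + ennreal (kl_dual (marginal2 S (\<gamma> (q k))) (v (s k)) h)" for k
    have a: "(\<lambda>k. ennreal (a k)) \<longlonglongrightarrow> x j"
      using \<gamma>'(2) g(1)[of j] unfolding weak_star_conv_def a_def x_def o_def by (intro tendsto_ennrealI) blast
    have b: "b \<longlonglongrightarrow> y f + w h"
      unfolding b_def y_def w_def
      using kl_dual_tendsto[OF marg(1) u' f] kl_dual_tendsto[OF marg(2) v' h]
      by (intro tendsto_add tendsto_ennrealI) (simp_all add: o_def)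
    have \<alpha>s: "(\<lambda>k. \<alpha>' (s k)) \<longlonglongrightarrow> \<alpha>" using LIMSEQ_subseq_LIMSEQ[OF \<alpha>(1) s] by (simp add: o_def)
    have "\<alpha> \<ge> 1"
      by (rule LIMSEQ_le_const[OF \<alpha>s]) (use Er in \<open>auto simp: s_def\<close>)
    have "\<forall>\<^sub>F k in sequentially. \<forall>z\<in>S \<times> S. ennreal (g j z) \<le> c' (s k) z"
      using eventually_subseq[OF s c'[of j]] .
    then have ev: "\<forall>\<^sub>F k in sequentially. ennreal (a k) + \<alpha>' (s k) * b k \<le> C0"
    proof eventually_elim
      case (elim k)
      note gk = \<gamma>(1)[of "q k"]
      have "ennreal (a k) = (\<integral>\<^sup>+z. ennreal (g j z) \<partial>\<gamma> (q k))"
        unfolding a_def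
        by (rule nn_integral_eq_integral[symmetric, OF radon_integrable_continuous[OF compact_Times[OF S S] gk g(1)]])
          (use g(2) radon_measuresD(2)[OF gk] in auto)
      also have "\<dots> \<le> (\<integral>\<^sup>+z. c' (s k) z \<partial>\<gamma> (q k))"
        using elim by (intro nn_integral_mono) (auto simp: radon_measuresD(2)[OF gk])
      finally have 1: "ennreal (a k) \<le> (\<integral>\<^sup>+z. c' (s k) z \<partial>\<gamma> (q k))" .
      have up: "ennreal (kl_dual \<rho> \<sigma> f) \<le> KL \<rho> \<sigma>" if "\<rho> \<in> radon_measures S" "\<sigma> \<in> radon_measures S" "continuous_on S f"
        for \<rho> \<sigma> and f :: "'a \<Rightarrow> real"
        unfolding KL_eq_SUP_kl_dual[OF S that(1,2)] by (rule SUP_upper) (use that(3) in simp)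
      have 2: "b k \<le> KL (marginal1 S (\<gamma> (q k))) (u (s k)) + KL (marginal2 S (\<gamma> (q k))) (v (s k))"
        unfolding b_def
        by (intro add_mono up marginal_radon gk bounded_radon_measuresD(1)[OF u(1)] bounded_radon_measuresD(1)[OF v(1)] f h)
      have "ennreal (a k) + \<alpha>' (s k) * b k \<le> F (s k) (\<gamma> (q k))"
        unfolding F_def by (intro add_mono 1 mult_left_mono 2) simp
      also have "\<dots> \<le> C0" using \<gamma>(2)[of "q k"] by (simp add: s_def)
      finally show ?case .
    qed
    show ?thesis
    proof (cases "y f + w h = 0")
      case True
      have "x j \<le> C0"
      proof (rule tendsto_upperbound[OF a])
        show "\<forall>\<^sub>F k in sequentially. ennreal (a k) \<le> C0"
          using ev by eventually_elim (rule order_trans[rotated], assumption, simp)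
      qed simp
      then show ?thesis unfolding True by simp
    next
      case False
      have "(\<lambda>k. ennreal (a k) + \<alpha>' (s k) * b k) \<longlonglongrightarrow> x j + \<alpha> * (y f + w h)"
        using \<open>\<alpha> \<ge> 1\<close> False
        by (intro tendsto_add a tendsto_mult_ennreal \<alpha>s b) (auto simp: y_def w_def)
      then show ?thesis by (rule tendsto_upperbound[OF _ ev]) simp
    qed
  qed
  have X: "(\<integral>\<^sup>+z. c z \<partial>\<gamma>') = (SUP j. x j)"
  proof -
    have sp: "space \<gamma>' = S \<times> S" using radon_measuresD(2)[OF \<gamma>'r] .
    have "(\<integral>\<^sup>+z. c z \<partial>\<gamma>') = (\<integral>\<^sup>+z. (SUP j. ennreal (g j z)) \<partial>\<gamma>')"
      by (rule nn_integral_cong) (simp add: sp c)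
    also have "\<dots> = (SUP j. \<integral>\<^sup>+z. ennreal (g j z) \<partial>\<gamma>')"
    proof (rule nn_integral_monotone_convergence_SUP_AE)
      show "AE z in \<gamma>'. ennreal (g j z) \<le> ennreal (g (Suc j) z)" for j
        by (intro AE_I2 ennreal_leI g(3)) (simp add: sp)
      show "(\<lambda>z. ennreal (g j z)) \<in> borel_measurable \<gamma>'" for j
        using radon_measurable_continuous[OF \<gamma>'r g(1)] by measurable
    qed
    also have "\<dots> = (SUP j. x j)"
      unfolding x_def
      by (intro SUP_cong refl nn_integral_eq_integral radon_integrable_continuous[OF compact_Times[OF S S] \<gamma>'r g(1)] AE_I2 g(2))
        (simp add: sp)
    finally show ?thesis .
  qed
  define CS where "CS = {f :: 'a \<Rightarrow> real. continuous_on S f}"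
  have ne: "CS \<noteq> {}" unfolding CS_def using continuous_on_const by blast
  have Y: "KL (marginal1 S \<gamma>') \<mu> = (SUP f\<in>CS. y f)" and W: "KL (marginal2 S \<gamma>') \<nu> = (SUP f\<in>CS. w f)"
    unfolding y_def w_def CS_def
    by (rule KL_eq_SUP_kl_dual[OF S marginal_radon(1)[OF \<gamma>'r] bounded_radon_measuresD(1)[OF u(2)]],
        rule KL_eq_SUP_kl_dual[OF S marginal_radon(2)[OF \<gamma>'r] bounded_radon_measuresD(1)[OF v(2)]])
  \<comment> \<open>The three suprema are restored in turn: over the minorants of the cost, then
    over each of the two test functions.\<close>
  have 1: "(SUP j. x j) + \<alpha> * (y f + w h) \<le> C0" if "f \<in> CS" "h \<in> CS" for f h
    unfolding ennreal_SUP_add_left[OF UNIV_not_empty, symmetric] using main that by (intro SUP_least) (auto simp: CS_def)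
  have 2: "(SUP j. x j) + \<alpha> * ((SUP f\<in>CS. y f) + w h) \<le> C0" if "h \<in> CS" for h
    unfolding ennreal_SUP_add_left[OF ne, symmetric] SUP_mult_left_ennreal ennreal_SUP_add_right[OF ne]
    using 1 that by (intro SUP_least) auto
  have "(SUP j. x j) + \<alpha> * ((SUP f\<in>CS. y f) + (SUP h\<in>CS. w h)) \<le> C0"
    unfolding ennreal_SUP_add_right[OF ne] SUP_mult_left_ennreal
    using 2 by (intro SUP_least) auto
  then have "entropy_transport S c \<alpha> \<mu> \<nu> \<le> C0"
    unfolding entropy_transport_def X[symmetric] Y[symmetric] W[symmetric]
    by (rule INF_lower2[OF \<gamma>'r])
  with C0(2) show False by simp
qed


section \<open>The Hellinger--Kantorovich cost\<close>

text \<open>The value at 0 is the limit of the costs as the parameter decreases to 0. It needs its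
  own case, since \<open>HK_cost 0\<close> is infinite on the diagonal too:
  \<open>dist x y < 0\<close> never holds.\<close>

definition HK_limit_cost :: "real \<Rightarrow> 'a::metric_space \<times> 'a \<Rightarrow> ennreal" where
  "HK_limit_cost k z = (if k = 0 then if fst z = snd z then 0 else \<infinity> else HK_cost k (fst z) (snd z))"

text \<open>Equal to the minimum of \<open>j\<close> and the cost; in this form the truncation is visibly continuous.\<close>

definition HK_cost_trunc :: "real \<Rightarrow> real \<Rightarrow> 'a::metric_space \<times> 'a \<Rightarrow> real" where
  "HK_cost_trunc k j z = - 2 * ln (max (cos (min (dist (fst z) (snd z) / k) (pi / 2))) (exp (- j / 2)))"

lemma continuous_on_HK_cost_trunc:
  assumes "k \<noteq> 0"
  shows "continuous_on A (HK_cost_trunc k j)"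
proof -
  have "max (cos (min (dist (fst z) (snd z) / k) (pi / 2))) (exp (- j / 2)) \<noteq> 0" for z :: "'a \<times> 'a"
    using exp_gt_zero[of "- j / 2"] by (auto simp: max_def)
  then show ?thesis
    unfolding HK_cost_trunc_def using assms by (intro continuous_intros) auto
qed

lemma HK_cost_trunc_nonneg:
  assumes "0 \<le> j"
  shows "0 \<le> HK_cost_trunc k j z"
proof -
  have "ln (max (cos (min (dist (fst z) (snd z) / k) (pi / 2))) (exp (- j / 2))) \<le> ln 1"
    using exp_gt_zero[of "- j / 2"] assms by (subst ln_le_cancel_iff) (auto simp: less_max_iff_disj)
  then show ?thesis by (simp add: HK_cost_trunc_def)
qed

lemma cos_min_antimono:
  assumes "0 < k" "k \<le> k'" "0 \<le> d"
  shows "cos (min (d / k) (pi / 2)) \<le> cos (min (d / k') (pi / 2))"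
proof (rule cos_monotone_0_pi_le)
  have "d / k' \<le> d / k" using assms by (intro divide_left_mono) auto
  then show "min (d / k') (pi / 2) \<le> min (d / k) (pi / 2)" by (intro min.mono order_refl)
  show "0 \<le> min (d / k') (pi / 2)" using assms by auto
  show "min (d / k) (pi / 2) \<le> pi" using pi_gt_zero by linarith
qed

lemma HK_cost_trunc_mono:
  assumes "0 < k" "k \<le> k'" "j \<le> j'"
  shows "HK_cost_trunc k' j z \<le> HK_cost_trunc k j' z"
proof -
  have "max (cos (min (dist (fst z) (snd z) / k) (pi / 2))) (exp (- j' / 2))
      \<le> max (cos (min (dist (fst z) (snd z) / k') (pi / 2))) (exp (- j / 2))"
    using cos_min_antimono[OF assms(1,2) zero_le_dist[of "fst z" "snd z"]] assms(3)
    by (intro max.mono) auto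
  then have "ln (max (cos (min (dist (fst z) (snd z) / k) (pi / 2))) (exp (- j' / 2)))
      \<le> ln (max (cos (min (dist (fst z) (snd z) / k') (pi / 2))) (exp (- j / 2)))"
    by (subst ln_le_cancel_iff) (auto simp: less_max_iff_disj)
  then show ?thesis by (simp add: HK_cost_trunc_def)
qed

text \<open>A truncation at k' lies below all costs with positive parameter up to k' simultaneously;
  this makes the minorants stable under perturbation of the parameter.\<close>

lemma HK_cost_trunc_le:
  assumes "0 < k" "k \<le> k'"
  shows "ennreal (HK_cost_trunc k' j z) \<le> HK_cost k (fst z) (snd z)"
proof (cases "dist (fst z) (snd z) < k * pi / 2")
  case True
  define d where "d = dist (fst z) (snd z)"
  have d: "0 \<le> d" "d / k < pi / 2" using True assms(1) by (auto simp: d_def field_simps)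
  have "0 \<le> d / k" using d(1) assms(1) by simp
  then have c: "0 < cos (d / k)" using d(2) by (intro cos_gt_zero_pi) auto
  have "cos (d / k) = cos (min (d / k) (pi / 2))" using d(2) by simp
  also have "\<dots> \<le> cos (min (d / k') (pi / 2))" by (rule cos_min_antimono[OF assms d(1)])
  finally have "cos (d / k) \<le> max (cos (min (d / k') (pi / 2))) (exp (- j / 2))" by auto
  then have "ln (cos (d / k)) \<le> ln (max (cos (min (d / k') (pi / 2))) (exp (- j / 2)))"
    using c by (subst ln_le_cancel_iff) auto
  then have "HK_cost_trunc k' j z \<le> - 2 * ln (cos (d / k))" by (simp add: HK_cost_trunc_def d_def)
  then show ?thesis using True by (auto simp: HK_cost_def d_def intro!: ennreal_leI)
qed (simp add: HK_cost_def)

text \<open>The offset 1 / (j + 1) keeps the parameter positive when k = 0 and strictly above k, so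
  that parameters converging to k are eventually below it. The limit t of the clipped argument of
  cos equals pi / 2 exactly where the limit cost is infinite; for k = 0 that means off the
  diagonal.\<close>

lemma HK_cost_trunc_tendsto:
  assumes "0 \<le> k"
  shows "(\<lambda>j. ennreal (HK_cost_trunc (k + 1 / real (Suc j)) (real j) z)) \<longlonglongrightarrow> HK_limit_cost k z"
proof -
  define d where "d = dist (fst z) (snd z)"
  have d0: "0 \<le> d" by (simp add: d_def)
  define t where "t = (if k = 0 then if d = 0 then 0 else pi / 2 else min (d / k) (pi / 2))"
  define m where "m j = max (cos (min (d / (k + 1 / real (Suc j))) (pi / 2))) (exp (- real j / 2))" for j
  have t: "0 \<le> t" "t \<le> pi / 2"
    using assms d0 pi_ge_zero unfolding t_def by (simp_all del: le_divide_eq_numeral1)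
  have kj: "(\<lambda>j. k + 1 / real (Suc j)) \<longlonglongrightarrow> k"
    using tendsto_add[OF tendsto_const[of k] LIMSEQ_Suc[OF lim_1_over_n]] by simp
  have "(\<lambda>j. min (d / (k + 1 / real (Suc j))) (pi / 2)) \<longlonglongrightarrow> t"
  proof (cases "k = 0")
    case True
    show ?thesis
    proof (cases "d = 0")
      case False
      have "0 < d" using d0 False by simp
      from reals_Archimedean3[OF this] obtain N :: nat where N: "pi / 2 < real N * d" by blast
      have "min (d / (k + 1 / real (Suc j))) (pi / 2) = t" if "j \<ge> N" for j
      proof -
        have "real N * d \<le> real (Suc j) * d" using that d0 by (intro mult_right_mono) auto
        with N have "pi / 2 \<le> real (Suc j) * d" by linarith
        then show ?thesis using True False by (simp add: t_def mult.commute)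
      qed
      then show ?thesis by (intro tendsto_eventually) (auto simp: eventually_sequentially)
    qed (simp add: t_def True)
  next
    case False
    then show ?thesis unfolding t_def using kj by (auto intro!: tendsto_min tendsto_divide tendsto_const)
  qed
  moreover have "(\<lambda>j. exp (- real j / 2)) \<longlonglongrightarrow> 0"
  proof -
    have "(\<lambda>j. exp (- 1 / 2 :: real) ^ j) \<longlonglongrightarrow> 0" by (rule LIMSEQ_realpow_zero) auto
    then show ?thesis by (simp add: exp_of_nat_mult[symmetric])
  qed
  ultimately have "m \<longlonglongrightarrow> max (cos t) 0"
    unfolding m_def by (intro tendsto_max tendsto_cos)
  moreover have c0: "0 \<le> cos t" using t by (intro cos_ge_zero) auto
  ultimately have m: "m \<longlonglongrightarrow> cos t" by simp
  have mpos: "0 < m j" for j by (simp add: m_def less_max_iff_disj)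
  have tr: "HK_cost_trunc (k + 1 / real (Suc j)) (real j) z = - 2 * ln (m j)" for j
    by (simp add: HK_cost_trunc_def m_def d_def)
  show ?thesis
  proof (cases "cos t = 0")
    case True
    have "t = pi / 2"
    proof (rule ccontr)
      assume "t \<noteq> pi / 2"
      then have "0 < cos t" using t by (intro cos_gt_zero_pi) auto
      with True show False by simp
    qed
    then have "HK_limit_cost k z = \<infinity>"
      using assms unfolding t_def HK_limit_cost_def HK_cost_def d_def
      by (auto simp: min_def field_simps split: if_splits)
    moreover have "m j \<noteq> 0" for j using mpos[of j] by simp
    then have "filterlim m (at_right 0) sequentially"
      using m mpos True unfolding filterlim_at by simp
    then have "filterlim (\<lambda>j. ln (m j)) at_bot sequentially" by (rule filterlim_compose[OF ln_at_0])
    then have "filterlim (\<lambda>j. - 2 * ln (m j)) at_top sequentially"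
      by (subst filterlim_tendsto_neg_mult_at_top_iff[OF tendsto_const]) simp_all
    then have "(\<lambda>j. ennreal (- 2 * ln (m j))) \<longlonglongrightarrow> \<infinity>"
      by (simp add: ennreal_tendsto_top_eq_at_top)
    ultimately show ?thesis unfolding tr by simp
  next
    case False
    with c0 have cp: "0 < cos t" by simp
    then have "t \<noteq> pi / 2" using cos_pi_half by fastforce
    have "HK_limit_cost k z = ennreal (- 2 * ln (cos t))"
    proof (cases "k = 0")
      case True
      then show ?thesis using \<open>t \<noteq> pi / 2\<close> by (auto simp: t_def HK_limit_cost_def d_def split: if_splits)
    next
      case False
      then have "t = d / k" "d / k < pi / 2" using \<open>t \<noteq> pi / 2\<close> by (auto simp: t_def min_def split: if_splits)
      moreover have "d < k * pi / 2" using calculation(2) False assms by (simp add: field_simps)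
      ultimately show ?thesis using False by (simp add: HK_limit_cost_def HK_cost_def d_def)
    qed
    moreover have "(\<lambda>j. ennreal (- 2 * ln (m j))) \<longlonglongrightarrow> ennreal (- 2 * ln (cos t))"
      using m cp by (intro tendsto_ennrealI tendsto_mult tendsto_const tendsto_ln) auto
    ultimately show ?thesis unfolding tr by simp
  qed
qed

lemma HK_limit_cost_eq_SUP:
  assumes "0 \<le> k"
  shows "HK_limit_cost k z = (SUP j. ennreal (HK_cost_trunc (k + 1 / real (Suc j)) (real j) z))"
proof (rule LIMSEQ_unique[OF HK_cost_trunc_tendsto[OF assms] LIMSEQ_SUP])
  show "incseq (\<lambda>j. ennreal (HK_cost_trunc (k + 1 / real (Suc j)) (real j) z))"
    using assms by (intro incseq_SucI ennreal_leI HK_cost_trunc_mono) (auto simp: add_nonneg_pos frac_le)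
qed

lemma HK_limit_cost_measurable:
  assumes "\<gamma> \<in> radon_measures (S \<times> S)" "0 \<le> k"
  shows "HK_limit_cost k \<in> borel_measurable \<gamma>"
proof -
  have "HK_cost_trunc (k + 1 / real (Suc j)) (real j) \<in> borel_measurable \<gamma>" for j
    using assms(2)
    by (intro radon_measurable_continuous[OF assms(1)] continuous_on_HK_cost_trunc) (simp add: add_nonneg_eq_0_iff)
  then have *: "(\<lambda>z. SUP j. ennreal (HK_cost_trunc (k + 1 / real (Suc j)) (real j) z)) \<in> borel_measurable \<gamma>"
    by measurable
  have eq: "HK_limit_cost k = (\<lambda>z. SUP j. ennreal (HK_cost_trunc (k + 1 / real (Suc j)) (real j) z))"
    using HK_limit_cost_eq_SUP[OF assms(2)] by (rule ext)
  show ?thesis unfolding eq by (rule *)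
qed

lemma HK_cost_tendsto:
  assumes "0 < k" "kn \<longlonglongrightarrow> k" "HK_cost k x y < \<infinity>"
  shows "(\<lambda>n. HK_cost (kn n) x y) \<longlonglongrightarrow> HK_cost k x y"
proof -
  have d: "dist x y < k * pi / 2" using assms(3) by (auto simp: HK_cost_def split: if_splits)
  have "(\<lambda>n. kn n * pi / 2) \<longlonglongrightarrow> k * pi / 2" by (intro tendsto_intros assms(2)) auto
  then have ev: "\<forall>\<^sub>F n in sequentially. dist x y < kn n * pi / 2" using d by (rule order_tendstoD(1))
  have "dist x y / k < pi / 2" "0 \<le> dist x y / k" using d assms(1) by (auto simp: field_simps)
  then have c: "0 < cos (dist x y / k)" by (intro cos_gt_zero_pi) auto
  have "(\<lambda>n. ennreal (- 2 * ln (cos (dist x y / kn n)))) \<longlonglongrightarrow> ennreal (- 2 * ln (cos (dist x y / k)))"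
    using assms(1,2) c by (intro tendsto_intros) auto
  then have "(\<lambda>n. HK_cost (kn n) x y) \<longlonglongrightarrow> ennreal (- 2 * ln (cos (dist x y / k)))"
    by (rule Lim_transform_eventually) (use ev in \<open>eventually_elim, simp add: HK_cost_def\<close>)
  then show ?thesis using d by (simp add: HK_cost_def)
qed

section \<open>Comparison of -2 ln (cos t) with the square of t\<close>

lemma tan_ge_self:
  assumes "0 \<le> t" "t < pi / 2"
  shows "t \<le> tan t"
proof -
  have "tan 0 - 0 \<le> tan t - t"
  proof (rule DERIV_nonneg_imp_nondecreasing[OF assms(1)])
    fix x assume x: "0 \<le> x" "x \<le> t"
    then have c: "0 < cos x" using assms by (intro cos_gt_zero_pi) auto
    have "(cos x)\<^sup>2 \<le> 1" by (simp add: abs_square_le_1)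
    then have "1 \<le> inverse ((cos x)\<^sup>2)" using c by (intro one_le_inverse) auto
    then show "\<exists>y. ((\<lambda>x. tan x - x) has_real_derivative y) (at x) \<and> 0 \<le> y"
      using c by (intro exI[of _ "inverse ((cos x)\<^sup>2) - 1"]) (auto intro!: derivative_eq_intros)
  qed
  then show ?thesis by simp
qed

lemma neg_ln_cos_ge:
  assumes "0 \<le> t" "t < pi / 2"
  shows "t\<^sup>2 \<le> - 2 * ln (cos t)"
proof -
  have "- 2 * ln (cos 0) - 0\<^sup>2 \<le> - 2 * ln (cos t) - t\<^sup>2"
  proof (rule DERIV_nonneg_imp_nondecreasing[OF assms(1)])
    fix x assume x: "0 \<le> x" "x \<le> t"
    then have c: "0 < cos x" using assms by (intro cos_gt_zero_pi) auto
    have "x \<le> tan x" using x assms by (intro tan_ge_self) auto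
    then show "\<exists>y. ((\<lambda>t. - 2 * ln (cos t) - t\<^sup>2) has_real_derivative y) (at x) \<and> 0 \<le> y"
      using c by (intro exI[of _ "2 * tan x - 2 * x"])
        (auto intro!: derivative_eq_intros simp: tan_def field_simps)
  qed
  then show ?thesis by simp
qed

text \<open>Uses ln x \<le> x - 1 at the reciprocal of the squared cosine, and \<bar>sin t\<bar>
  \<le> \<bar>t\<bar>. The factor tends to 1 at t = 0, which suffices for large parameters.\<close>

lemma neg_ln_cos_le:
  assumes "0 \<le> t" "t < pi / 2"
  shows "- 2 * ln (cos t) \<le> t\<^sup>2 / (cos t)\<^sup>2"
proof -
  have c: "0 < cos t" using assms by (intro cos_gt_zero_pi) auto
  have "- 2 * ln (cos t) = ln (1 / (cos t)\<^sup>2)" using c by (simp add: ln_div ln_realpow)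
  also have "\<dots> \<le> 1 / (cos t)\<^sup>2 - 1" using c by (intro ln_le_minus_one) auto
  also have "\<dots> = (sin t)\<^sup>2 / (cos t)\<^sup>2" using c by (simp add: field_simps sin_squared_eq)
  also have "\<dots> \<le> t\<^sup>2 / (cos t)\<^sup>2"
    using abs_sin_x_le_abs_x[of t] by (intro divide_right_mono) (simp_all add: abs_le_square_iff)
  finally show ?thesis .
qed

lemma dist_sq_le_scaled_HK_cost:
  assumes "0 < k"
  shows "ennreal ((dist x y)\<^sup>2) \<le> ennreal (k\<^sup>2) * HK_cost k x y"
proof (cases "dist x y < k * pi / 2")
  case True
  have "(dist x y / k)\<^sup>2 \<le> - 2 * ln (cos (dist x y / k))"
    using True assms by (intro neg_ln_cos_ge) (auto simp: field_simps)
  then have "(dist x y)\<^sup>2 \<le> k\<^sup>2 * (- 2 * ln (cos (dist x y / k)))"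
    using assms by (simp add: power_divide field_simps)
  then show ?thesis
    using True assms by (simp add: HK_cost_def ennreal_mult'[symmetric] ennreal_leI)
next
  case False
  then show ?thesis using assms by (simp add: HK_cost_def ennreal_mult_top)
qed

text \<open>For large k all ratios dist x y / k are uniformly small, and near 0 the reciprocal of
  the squared cosine is below 1 + e.\<close>

lemma scaled_HK_cost_le:
  assumes "0 < e"
  shows "\<exists>K>0. \<forall>k\<ge>K. \<forall>x y. dist x y \<le> D \<longrightarrow>
    ennreal (k\<^sup>2) * HK_cost k x y \<le> ennreal ((1 + e) * (dist x y)\<^sup>2)"
proof -
  have "isCont (\<lambda>t. 1 / (cos t)\<^sup>2 :: real) 0" by (intro continuous_intros) auto
  then have "((\<lambda>t. 1 / (cos t)\<^sup>2 :: real) \<longlongrightarrow> 1) (at 0)" by (simp add: isCont_def)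
  then have "\<forall>\<^sub>F t in at (0::real). 1 / (cos t)\<^sup>2 < 1 + e" using assms by (intro order_tendstoD(2)) auto
  then obtain s where s: "0 < s" "\<And>t :: real. t \<noteq> 0 \<Longrightarrow> \<bar>t\<bar> < s \<Longrightarrow> 1 / (cos t)\<^sup>2 < 1 + e"
    unfolding eventually_at by (auto simp: dist_real_def)
  \<comment> \<open>Being below s gives the estimate and being below pi / 2 the finiteness of the
    cost. The maximum with 1 in K below keeps K positive even if D is not.\<close>
  define b where "b = min (s / 2) (1 / 2)"
  have b: "0 < b" "b < s" "b < pi / 2" using s(1) pi_ge_two by (auto simp: b_def min_def)
  define K where "K = max 1 (D / b)"
  show ?thesis
  proof (intro exI[of _ K] conjI allI impI)
    show "0 < K" by (simp add: K_def)
    fix k x y assume k: "K \<le> k" and D: "dist x (y :: 'a) \<le> D"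
    have kp: "0 < k" "D / b \<le> k" using k by (auto simp: K_def)
    define t where "t = dist x y / k"
    have "D \<le> k * b" using kp(2) b(1) by (simp add: field_simps)
    then have "dist x y \<le> k * b" using D by simp
    then have tb: "t \<le> b" using kp(1) by (simp add: t_def field_simps)
    have "0 \<le> t" using kp(1) by (simp add: t_def)
    with tb b have t: "0 \<le> t" "t < s" "t < pi / 2" by linarith+
    have "- 2 * ln (cos t) \<le> (1 + e) * t\<^sup>2"
    proof (cases "t = 0")
      case False
      have "- 2 * ln (cos t) \<le> t\<^sup>2 * (1 / (cos t)\<^sup>2)" using neg_ln_cos_le[OF t(1,3)] by simp
      also have "\<dots> \<le> t\<^sup>2 * (1 + e)" using s(2)[of t] False t by (intro mult_left_mono) auto
      finally show ?thesis by (simp add: mult.commute)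
    qed simp
    then have "k\<^sup>2 * (- 2 * ln (cos t)) \<le> k\<^sup>2 * ((1 + e) * t\<^sup>2)" by (intro mult_left_mono) auto
    also have "\<dots> = (1 + e) * (dist x y)\<^sup>2" using kp(1) by (simp add: t_def power_divide)
    finally have le: "k\<^sup>2 * (- 2 * ln (cos t)) \<le> (1 + e) * (dist x y)\<^sup>2" .
    have "dist x y < k * pi / 2" using t(3) kp(1) by (simp add: t_def field_simps)
    then show "ennreal (k\<^sup>2) * HK_cost k x y \<le> ennreal ((1 + e) * (dist x y)\<^sup>2)"
      using le by (simp add: HK_cost_def t_def ennreal_mult'[symmetric] ennreal_leI)
  qed
qed


section \<open>The three distances as entropy-transport problems\<close>

lemma HK_sq_eq_entropy_transport:
  assumes "0 < k"
  shows "HK_sq S k \<mu> \<nu> = entropy_transport S (HK_limit_cost k) 1 \<mu> \<nu>"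
  using assms by (simp add: HK_sq_def entropy_transport_def HK_limit_cost_def[abs_def] add.assoc)

lemma KL_zero_iff:
  assumes "\<rho> \<in> radon_measures S" "\<mu> \<in> radon_measures S"
  shows "KL \<rho> \<mu> = 0 \<longleftrightarrow> \<rho> = \<mu>"
  using KL_eq_0_imp_eq[OF assms] KL_self[OF assms(1)] by auto

text \<open>An infinite penalty turns the entropy terms into marginal constraints, since
  \<open>\<infinity> * 0 = 0\<close> in \<^typ>\<open>ennreal\<close>.\<close>

lemma W_sq_eq_entropy_transport:
  assumes \<mu>: "\<mu> \<in> radon_measures S" and \<nu>: "\<nu> \<in> radon_measures S"
  shows "W_sq S \<mu> \<nu> = entropy_transport S (\<lambda>z. ennreal ((dist (fst z) (snd z))\<^sup>2)) \<infinity> \<mu> \<nu>"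
proof (rule antisym)
  show "W_sq S \<mu> \<nu> \<le> entropy_transport S (\<lambda>z. ennreal ((dist (fst z) (snd z))\<^sup>2)) \<infinity> \<mu> \<nu>"
    unfolding entropy_transport_def
  proof (rule INF_greatest)
    fix \<gamma> assume \<gamma>: "\<gamma> \<in> radon_measures (S \<times> S)"
    note m = marginal_radon[OF \<gamma>]
    show "W_sq S \<mu> \<nu> \<le> (\<integral>\<^sup>+z. ennreal ((dist (fst z) (snd z))\<^sup>2) \<partial>\<gamma>)
        + \<infinity> * (KL (marginal1 S \<gamma>) \<mu> + KL (marginal2 S \<gamma>) \<nu>)"
    proof (cases "marginal1 S \<gamma> = \<mu> \<and> marginal2 S \<gamma> = \<nu>")
      case True
      then have "W_sq S \<mu> \<nu> \<le> (\<integral>\<^sup>+z. ennreal ((dist (fst z) (snd z))\<^sup>2) \<partial>\<gamma>)"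
        unfolding W_sq_def using \<gamma> by (intro INF_lower) simp
      then show ?thesis by (rule order_trans) simp
    next
      case False
      define K where "K = KL (marginal1 S \<gamma>) \<mu> + KL (marginal2 S \<gamma>) \<nu>"
      have "K \<noteq> 0" using False KL_zero_iff[OF m(1) \<mu>] KL_zero_iff[OF m(2) \<nu>] by (simp add: K_def)
      then show ?thesis unfolding K_def[symmetric] by (simp add: ennreal_top_mult)
    qed
  qed
  show "entropy_transport S (\<lambda>z. ennreal ((dist (fst z) (snd z))\<^sup>2)) \<infinity> \<mu> \<nu> \<le> W_sq S \<mu> \<nu>"
    unfolding W_sq_def
  proof (rule INF_greatest)
    fix \<gamma> assume "\<gamma> \<in> {\<gamma> \<in> radon_measures (S \<times> S). marginal1 S \<gamma> = \<mu> \<and> marginal2 S \<gamma> = \<nu>}"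
    then show "entropy_transport S (\<lambda>z. ennreal ((dist (fst z) (snd z))\<^sup>2)) \<infinity> \<mu> \<nu>
        \<le> (\<integral>\<^sup>+z. ennreal ((dist (fst z) (snd z))\<^sup>2) \<partial>\<gamma>)"
      unfolding entropy_transport_def
      by (intro INF_lower2[of \<gamma>]) (auto simp: KL_self[OF \<mu>] KL_self[OF \<nu>])
  qed
qed

text \<open>Young's inequality is applied with the opposite slopes x and -x, where x is the
  logarithm of the optimal s = sqrt (v / u). The terms linear in s and t then cancel, because u * s
  and v * t are the same density of a common marginal.\<close>

lemma hellinger_pointwise_le:
  assumes "0 \<le> u" "0 \<le> v" "0 \<le> s" "0 \<le> t" "u * s = v * t"
  shows "(sqrt u - sqrt v)\<^sup>2 \<le> u * kl_entropy s + v * kl_entropy t"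
proof -
  have sq: "(sqrt u - sqrt v)\<^sup>2 = u + v - 2 * (sqrt u * sqrt v)"
    using assms(1,2) by (simp add: power2_diff)
  consider "u = 0" | "v = 0" | "0 < u" "0 < v" using assms(1,2) by fastforce
  then show ?thesis
  proof cases
    case 1
    then have "v = 0 \<or> t = 0" using assms(5) by simp
    then show ?thesis using 1 assms(2) by (auto simp: kl_entropy_def)
  next
    case 2
    then have "u = 0 \<or> s = 0" using assms(5) by simp
    then show ?thesis using 2 assms(1) by (auto simp: kl_entropy_def)
  next
    case 3
    define x where "x = ln (sqrt v / sqrt u)"
    have ex: "exp x = sqrt v / sqrt u" "exp (- x) = sqrt u / sqrt v"
      using 3 by (simp_all add: x_def exp_minus)
    have "u * exp x = u / sqrt u * sqrt v" by (simp add: ex)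
    then have eu: "u * exp x = sqrt u * sqrt v" using 3 by (simp add: real_div_sqrt)
    have "v * exp (- x) = v / sqrt v * sqrt u" by (simp add: ex)
    then have ev: "v * exp (- x) = sqrt u * sqrt v" using 3 by (simp add: real_div_sqrt)
    have "u * (s * x - (exp x - 1)) + v * (t * (- x) - (exp (- x) - 1))
        = (u * s - v * t) * x + u + v - u * exp x - v * exp (- x)" by (simp add: algebra_simps)
    also have "\<dots> = u + v - 2 * (sqrt u * sqrt v)" using eu ev assms(5) by simp
    finally have "(sqrt u - sqrt v)\<^sup>2 = u * (s * x - (exp x - 1)) + v * (t * (- x) - (exp (- x) - 1))"
      using sq by simp
    also have "\<dots> \<le> u * kl_entropy s + v * kl_entropy t"
      using assms by (intro add_mono mult_left_mono kl_entropy_young)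
    finally show ?thesis .
  qed
qed

text \<open>Equality in the pointwise bound, attained when the common marginal has density sqrt (u *
  v). If u or v is 0, both quotients are 0 by the convention for division, and
  \<open>kl_entropy 0 = 1\<close> gives the right value.\<close>

lemma hellinger_pointwise_eq:
  assumes "0 \<le> u" "0 \<le> v"
  shows "u * kl_entropy (sqrt (v / u)) + v * kl_entropy (sqrt (u / v)) = (sqrt u - sqrt v)\<^sup>2"
proof -
  consider "u = 0" | "v = 0" | "0 < u" "0 < v" using assms(1,2) by fastforce
  then show ?thesis
  proof cases
    case 3
    define a b where "a = sqrt u" and "b = sqrt v"
    have ab: "0 < a" "0 < b" "u = a\<^sup>2" "v = b\<^sup>2" using 3 by (auto simp: a_def b_def)
    have s: "sqrt (v / u) = b / a" "sqrt (u / v) = a / b" by (simp_all add: a_def b_def real_sqrt_divide)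
    have l: "ln (b / a) = ln b - ln a" "ln (a / b) = ln a - ln b" using ab by (simp_all add: ln_div)
    have "u * kl_entropy (sqrt (v / u)) = a * b * (ln b - ln a) - a * b + a\<^sup>2"
      unfolding s kl_entropy_def l using ab by (simp add: field_simps power2_eq_square)
    moreover have "v * kl_entropy (sqrt (u / v)) = a * b * (ln a - ln b) - a * b + b\<^sup>2"
      unfolding s kl_entropy_def l using ab by (simp add: field_simps power2_eq_square)
    ultimately show ?thesis
      unfolding a_def[symmetric] b_def[symmetric] by (simp add: algebra_simps power2_eq_square)
  qed (auto simp: kl_entropy_def assms)
qed

lemma Hell_sq_density:
  assumes "sum_measure \<mu> \<nu> = \<tau>" "finite_measure \<tau>"
    and u: "u \<in> borel_measurable \<tau>" "\<And>x. 0 \<le> u x" "\<mu> = density \<tau> (\<lambda>x. ennreal (u x))"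
    and v: "v \<in> borel_measurable \<tau>" "\<And>x. 0 \<le> v x" "\<nu> = density \<tau> (\<lambda>x. ennreal (v x))"
  shows "Hell_sq \<mu> \<nu> = (\<integral>\<^sup>+x. ennreal ((sqrt (u x) - sqrt (v x))\<^sup>2) \<partial>\<tau>)"
proof -
  interpret finite_measure \<tau> by fact
  have [measurable]: "u \<in> borel_measurable \<tau>" "v \<in> borel_measurable \<tau>" by fact+
  have 1: "AE x in \<tau>. ennreal (u x) = RN_deriv \<tau> \<mu> x" by (rule RN_deriv_unique) (auto simp: u(3))
  have 2: "AE x in \<tau>. ennreal (v x) = RN_deriv \<tau> \<nu> x" by (rule RN_deriv_unique) (auto simp: v(3))
  show ?thesis
    unfolding Hell_sq_def Hell_sq_wrt_def assms(1)
  proof (rule nn_integral_cong_AE)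
    show "AE x in \<tau>. ennreal ((sqrt (enn2real (RN_deriv \<tau> \<mu> x)) - sqrt (enn2real (RN_deriv \<tau> \<nu> x)))\<^sup>2)
        = ennreal ((sqrt (u x) - sqrt (v x))\<^sup>2)"
      using 1 2 by eventually_elim (metis enn2real_ennreal u(2) v(2))
  qed
qed

lemma absolutely_continuous_sum_measure:
  assumes "sets \<mu> = sets \<nu>"
  shows "absolutely_continuous (sum_measure \<mu> \<nu>) \<mu>" "absolutely_continuous (sum_measure \<mu> \<nu>) \<nu>"
  unfolding absolutely_continuous_def null_sets_def
  using sets_sum_measure[OF assms] emeasure_sum_measure[OF assms] assms by auto

text \<open>These plans leave all mass in place and are the competitors for a cost that is infinite
  off the diagonal.\<close>

lemma diagonal_transport:
  fixes S :: "'a::euclidean_space set"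
  assumes \<sigma>: "\<sigma> \<in> radon_measures S"
  defines "\<gamma> \<equiv> distr \<sigma> (restrict_space borel (S \<times> S)) (\<lambda>x. (x, x))"
  shows "\<gamma> \<in> radon_measures (S \<times> S)" "marginal1 S \<gamma> = \<sigma>" "marginal2 S \<gamma> = \<sigma>" "AE z in \<gamma>. fst z = snd z"
proof -
  have m: "(\<lambda>x. (x, x)) \<in> measurable \<sigma> (restrict_space borel (S \<times> S))"
  proof (rule measurable_restrict_space2)
    show "(\<lambda>x. (x, x)) \<in> borel_measurable \<sigma>"
      by (intro radon_measurable_continuous[OF \<sigma>] continuous_intros)
  qed (simp add: radon_measuresD(2)[OF \<sigma>])
  show \<gamma>: "\<gamma> \<in> radon_measures (S \<times> S)"
    using finite_measure.finite_measure_distr[OF radon_measuresD(3)[OF \<sigma>] m]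
    by (simp add: radon_measures_def \<gamma>_def)
  have f: "fst \<in> measurable (restrict_space borel (S \<times> S)) (restrict_space borel S)"
    "snd \<in> measurable (restrict_space borel (S \<times> S)) (restrict_space borel S)"
    using marginal_measurable[OF \<gamma>] by (simp_all add: \<gamma>_def)
  show "marginal1 S \<gamma> = \<sigma>" "marginal2 S \<gamma> = \<sigma>"
    unfolding marginal1_def marginal2_def \<gamma>_def distr_distr[OF f(1) m] distr_distr[OF f(2) m]
    using distr_id2[OF radon_measuresD(1)[OF \<sigma>, symmetric]] by (simp_all add: o_def)
  show "AE z in \<gamma>. fst z = snd z"
    unfolding \<gamma>_def
  proof (subst AE_distr_iff[OF m])
    have "fst \<in> borel_measurable (restrict_space borel (S \<times> S))"
      "snd \<in> borel_measurable (restrict_space borel (S \<times> S))"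
      by (intro borel_measurable_continuous_on_restrict continuous_intros)+
    then show "{z \<in> space (restrict_space borel (S \<times> S)). fst z = snd z} \<in> sets (restrict_space borel (S \<times> S))"
      by (rule measurable_equality_set)
  qed simp
qed

text \<open>A plan of finite cost lives on the diagonal, so its marginals are one measure \<sigma>,
  and the problem is to minimise KL \<sigma> \<mu> + KL \<sigma> \<nu>. In terms of densities this
  is a pointwise problem solved by the geometric mean.\<close>

lemma Hell_sq_eq_entropy_transport:
  fixes S :: "'a::euclidean_space set"
  assumes \<mu>: "\<mu> \<in> radon_measures S" and \<nu>: "\<nu> \<in> radon_measures S"
  shows "Hell_sq \<mu> \<nu> = entropy_transport S (HK_limit_cost 0) 1 \<mu> \<nu>"
proof -
  define \<tau> where "\<tau> = sum_measure \<mu> \<nu>"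
  have \<tau>: "\<tau> \<in> radon_measures S" unfolding \<tau>_def by (rule sum_radon_measure(1)[OF \<mu> \<nu>])
  interpret \<tau>: finite_measure \<tau> using radon_measuresD(3)[OF \<tau>] .
  have sets: "sets \<mu> = sets \<nu>" using radon_measuresD(1) \<mu> \<nu> by blast
  note ac = absolutely_continuous_sum_measure[OF sets, folded \<tau>_def]
  obtain u where u: "u \<in> borel_measurable \<tau>" "\<And>x. 0 \<le> u x" "\<mu> = density \<tau> (\<lambda>x. ennreal (u x))" "integrable \<tau> u"
    using radon_density_exists[OF \<mu> \<tau> ac(1)] by metis
  obtain v where v: "v \<in> borel_measurable \<tau>" "\<And>x. 0 \<le> v x" "\<nu> = density \<tau> (\<lambda>x. ennreal (v x))" "integrable \<tau> v"
    using radon_density_exists[OF \<nu> \<tau> ac(2)] by metis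
  have [measurable]: "u \<in> borel_measurable \<tau>" "v \<in> borel_measurable \<tau>" by fact+
  note Hell = Hell_sq_density[OF \<tau>_def[symmetric] radon_measuresD(3)[OF \<tau>] u(1-3) v(1-3)]
  have meas: "borel_measurable \<mu> = borel_measurable \<tau>" "borel_measurable \<nu> = borel_measurable \<tau>"
    using measurable_radon_iff[OF \<mu>] measurable_radon_iff[OF \<nu>] measurable_radon_iff[OF \<tau>] by auto
  \<comment> \<open>Expresses densities relative to \<mu> or \<nu> through \<tau>, so that both
    entropies become integrals against the same measure.\<close>
  have KL_weight: "KL (density \<rho> (\<lambda>x. ennreal (s x))) \<rho> = (\<integral>\<^sup>+x. ennreal (w x * kl_entropy (s x)) \<partial>\<tau>)"
    and density_weight: "density \<rho> (\<lambda>x. ennreal (s x)) = density \<tau> (\<lambda>x. ennreal (w x * s x))"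
    if \<rho>: "finite_measure \<rho>" and w: "w \<in> borel_measurable \<tau>" "\<And>x. 0 \<le> w x" "\<rho> = density \<tau> (\<lambda>x. ennreal (w x))"
      and s: "s \<in> borel_measurable \<tau>" "\<And>x. 0 \<le> s x" for \<rho> w s
  proof -
    have "KL (density \<rho> (\<lambda>x. ennreal (s x))) \<rho> = (\<integral>\<^sup>+x. ennreal (kl_entropy (s x)) \<partial>\<rho>)"
      by (rule KL_density[OF \<rho>]) (use s w(3) in auto)
    also have "\<dots> = (\<integral>\<^sup>+x. ennreal (w x) * ennreal (kl_entropy (s x)) \<partial>\<tau>)"
      unfolding w(3) using s(1) w(1) by (intro nn_integral_density) auto
    also have "\<dots> = (\<integral>\<^sup>+x. ennreal (w x * kl_entropy (s x)) \<partial>\<tau>)"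
      by (intro nn_integral_cong) (simp add: ennreal_mult' w(2))
    finally show "KL (density \<rho> (\<lambda>x. ennreal (s x))) \<rho> = (\<integral>\<^sup>+x. ennreal (w x * kl_entropy (s x)) \<partial>\<tau>)" .
    show "density \<rho> (\<lambda>x. ennreal (s x)) = density \<tau> (\<lambda>x. ennreal (w x * s x))"
      unfolding w(3) using s(1) w(1) by (subst density_density_eq) (auto simp: ennreal_mult' w(2))
  qed
  note KL\<mu> = KL_weight[OF radon_measuresD(3)[OF \<mu>] u(1-3)] and KL\<nu> = KL_weight[OF radon_measuresD(3)[OF \<nu>] v(1-3)]
  note dens\<mu> = density_weight[OF radon_measuresD(3)[OF \<mu>] u(1-3)] and dens\<nu> = density_weight[OF radon_measuresD(3)[OF \<nu>] v(1-3)]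
  show ?thesis
  proof (rule antisym)
    show "Hell_sq \<mu> \<nu> \<le> entropy_transport S (HK_limit_cost 0) 1 \<mu> \<nu>"
      unfolding entropy_transport_def
    proof (rule INF_greatest)
      fix \<gamma> assume \<gamma>: "\<gamma> \<in> radon_measures (S \<times> S)"
      note m = marginal_radon[OF \<gamma>]
      let ?F = "(\<integral>\<^sup>+z. HK_limit_cost 0 z \<partial>\<gamma>) + 1 * (KL (marginal1 S \<gamma>) \<mu> + KL (marginal2 S \<gamma>) \<nu>)"
      show "Hell_sq \<mu> \<nu> \<le> ?F"
      proof (cases "(\<integral>\<^sup>+z. HK_limit_cost 0 z \<partial>\<gamma>) = \<infinity> \<or> KL (marginal1 S \<gamma>) \<mu> = \<infinity> \<or> KL (marginal2 S \<gamma>) \<nu> = \<infinity>")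
        case True
        then show ?thesis by (elim disjE) simp_all
      next
        case False
        then have fin: "(\<integral>\<^sup>+z. HK_limit_cost 0 z \<partial>\<gamma>) \<noteq> \<infinity>"
          and ac1: "absolutely_continuous \<mu> (marginal1 S \<gamma>)" and ac2: "absolutely_continuous \<nu> (marginal2 S \<gamma>)"
          by (auto simp: KL_def split: if_splits)
        have "AE z in \<gamma>. HK_limit_cost 0 z \<noteq> \<infinity>"
          by (rule nn_integral_PInf_AE[OF HK_limit_cost_measurable[OF \<gamma>] fin]) simp
        then have "AE z in \<gamma>. fst z = snd z"
          by eventually_elim (auto simp: HK_limit_cost_def split: if_splits)
        then have eq: "marginal2 S \<gamma> = marginal1 S \<gamma>"
          unfolding marginal1_def marginal2_def
          by (intro distr_cong_AE refl marginal_measurable[OF \<gamma>]) (auto elim!: eventually_mono)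
        obtain s where s: "s \<in> borel_measurable \<mu>" "\<And>x. 0 \<le> s x" "marginal1 S \<gamma> = density \<mu> (\<lambda>x. ennreal (s x))"
          using radon_density_exists[OF m(1) \<mu> ac1] by metis
        obtain t where t: "t \<in> borel_measurable \<nu>" "\<And>x. 0 \<le> t x" "marginal2 S \<gamma> = density \<nu> (\<lambda>x. ennreal (t x))"
          using radon_density_exists[OF m(2) \<nu> ac2] by metis
        have [measurable]: "s \<in> borel_measurable \<tau>" "t \<in> borel_measurable \<tau>" using s(1) t(1) meas by auto
        \<comment> \<open>Equality of the two marginals becomes the side condition u * s = v * t of
          the pointwise bound.\<close>
        have "density \<tau> (\<lambda>x. ennreal (u x * s x)) = density \<tau> (\<lambda>x. ennreal (v x * t x))"
          using s(2,3) t(2,3) eq by (simp add: dens\<mu> dens\<nu>)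
        then have "AE x in \<tau>. ennreal (u x * s x) = ennreal (v x * t x)"
          by (subst (asm) \<tau>.density_unique_iff) auto
        then have ae: "AE x in \<tau>. u x * s x = v x * t x"
          by eventually_elim (simp add: u(2) v(2) s(2) t(2))
        have "Hell_sq \<mu> \<nu> = (\<integral>\<^sup>+x. ennreal ((sqrt (u x) - sqrt (v x))\<^sup>2) \<partial>\<tau>)" by (rule Hell)
        also have "\<dots> \<le> (\<integral>\<^sup>+x. ennreal (u x * kl_entropy (s x)) + ennreal (v x * kl_entropy (t x)) \<partial>\<tau>)"
        proof (rule nn_integral_mono_AE)
          show "AE x in \<tau>. ennreal ((sqrt (u x) - sqrt (v x))\<^sup>2)
              \<le> ennreal (u x * kl_entropy (s x)) + ennreal (v x * kl_entropy (t x))"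
            using ae
          proof eventually_elim
            case (elim x)
            have "ennreal ((sqrt (u x) - sqrt (v x))\<^sup>2) \<le> ennreal (u x * kl_entropy (s x) + v x * kl_entropy (t x))"
              by (intro ennreal_leI hellinger_pointwise_le u(2) v(2) s(2) t(2) elim)
            also have "\<dots> = ennreal (u x * kl_entropy (s x)) + ennreal (v x * kl_entropy (t x))"
              by (intro ennreal_plus mult_nonneg_nonneg kl_entropy_nonneg u(2) v(2) s(2) t(2))
            finally show ?case .
          qed
        qed
        also have "\<dots> = KL (marginal1 S \<gamma>) \<mu> + KL (marginal2 S \<gamma>) \<nu>"
          unfolding s(3) t(3) by (subst nn_integral_add) (auto simp: KL\<mu> KL\<nu> s(2) t(2))
        also have "\<dots> \<le> ?F" by simp
        finally show ?thesis .
      qed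
    qed
    \<comment> \<open>The geometric mean of \<mu> and \<nu>, finite by the inequality of arithmetic
      and geometric means.\<close>
    define \<sigma> where "\<sigma> = density \<tau> (\<lambda>x. ennreal (sqrt (u x * v x)))"
    have "integrable \<tau> (\<lambda>x. sqrt (u x * v x))"
    proof (rule Bochner_Integration.integrable_bound)
      show "integrable \<tau> (\<lambda>x. (u x + v x) / 2)" using u(4) v(4) by auto
      show "AE x in \<tau>. norm (sqrt (u x * v x)) \<le> norm ((u x + v x) / 2)"
        using u(2) v(2) arith_geo_mean_sqrt by (intro AE_I2) (simp add: add_nonneg_nonneg)
    qed measurable
    then have "(\<integral>\<^sup>+x. ennreal (sqrt (u x * v x)) \<partial>\<tau>) < \<infinity>"
      by (subst nn_integral_eq_integral) (auto simp: u(2) v(2))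
    then have "finite_measure \<sigma>"
      unfolding \<sigma>_def by (intro finite_measureI) (simp add: emeasure_density less_top cong: nn_integral_cong)
    then have \<sigma>: "\<sigma> \<in> radon_measures S"
      using radon_measuresD(1)[OF \<tau>] by (simp add: radon_measures_def \<sigma>_def)
    define \<gamma> where "\<gamma> = distr \<sigma> (restrict_space borel (S \<times> S)) (\<lambda>x. (x, x))"
    note \<gamma> = diagonal_transport[OF \<sigma>, folded \<gamma>_def]
    have s\<mu>: "\<sigma> = density \<mu> (\<lambda>x. ennreal (sqrt (v x / u x)))"
    proof -
      have "u x * sqrt (v x / u x) = sqrt (u x * v x)" for x
      proof -
        have "u x * sqrt (v x / u x) = u x / sqrt (u x) * sqrt (v x)" by (simp add: real_sqrt_divide)
        also have "\<dots> = sqrt (u x * v x)" using u(2)[of x] by (simp add: real_div_sqrt real_sqrt_mult)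
        finally show ?thesis .
      qed
      then show ?thesis by (subst dens\<mu>) (simp_all add: \<sigma>_def u(2) v(2))
    qed
    have s\<nu>: "\<sigma> = density \<nu> (\<lambda>x. ennreal (sqrt (u x / v x)))"
    proof -
      have "v x * sqrt (u x / v x) = sqrt (u x * v x)" for x
      proof -
        have "v x * sqrt (u x / v x) = v x / sqrt (v x) * sqrt (u x)" by (simp add: real_sqrt_divide)
        also have "\<dots> = sqrt (u x * v x)" using v(2)[of x] by (simp add: real_div_sqrt real_sqrt_mult mult.commute)
        finally show ?thesis .
      qed
      then show ?thesis by (subst dens\<nu>) (simp_all add: \<sigma>_def u(2) v(2))
    qed
    have n: "0 \<le> sqrt (v x / u x)" "0 \<le> sqrt (u x / v x)" for x using u(2)[of x] v(2)[of x] by simp_all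
    have "(\<integral>\<^sup>+z. HK_limit_cost 0 z \<partial>\<gamma>) = (\<integral>\<^sup>+z. 0 \<partial>\<gamma>)"
      using \<gamma>(4) by (intro nn_integral_cong_AE) (auto simp: HK_limit_cost_def elim!: eventually_mono)
    moreover have "KL \<sigma> \<mu> + KL \<sigma> \<nu> = Hell_sq \<mu> \<nu>"
    proof -
      have 1: "KL \<sigma> \<mu> = (\<integral>\<^sup>+x. ennreal (u x * kl_entropy (sqrt (v x / u x))) \<partial>\<tau>)"
        by (subst s\<mu>, rule KL\<mu>) (simp_all add: u(2) v(2))
      have 2: "KL \<sigma> \<nu> = (\<integral>\<^sup>+x. ennreal (v x * kl_entropy (sqrt (u x / v x))) \<partial>\<tau>)"
        by (subst s\<nu>, rule KL\<nu>) (simp_all add: u(2) v(2))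
      have "KL \<sigma> \<mu> + KL \<sigma> \<nu> = (\<integral>\<^sup>+x. ennreal (u x * kl_entropy (sqrt (v x / u x)))
          + ennreal (v x * kl_entropy (sqrt (u x / v x))) \<partial>\<tau>)"
        unfolding 1 2 by (rule nn_integral_add[symmetric]) measurable
      also have "\<dots> = (\<integral>\<^sup>+x. ennreal ((sqrt (u x) - sqrt (v x))\<^sup>2) \<partial>\<tau>)"
        by (intro nn_integral_cong)
          (simp add: ennreal_plus[symmetric] hellinger_pointwise_eq u(2) v(2) kl_entropy_nonneg n del: ennreal_plus)
      finally show ?thesis using Hell by simp
    qed
    ultimately have "(\<integral>\<^sup>+z. HK_limit_cost 0 z \<partial>\<gamma>) + 1 * (KL (marginal1 S \<gamma>) \<mu> + KL (marginal2 S \<gamma>) \<nu>) = Hell_sq \<mu> \<nu>"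
      unfolding \<gamma>(2,3) by simp
    then show "entropy_transport S (HK_limit_cost 0) 1 \<mu> \<nu> \<le> Hell_sq \<mu> \<nu>"
      unfolding entropy_transport_def by (intro INF_lower2[OF \<gamma>(1)]) simp
  qed
qed


section \<open>Upper bounds\<close>

lemma emeasure_radon: "\<mu> \<in> radon_measures S \<Longrightarrow> emeasure \<mu> A = ennreal (measure \<mu> A)"
  by (rule finite_measure.emeasure_eq_measure[OF radon_measuresD(3)])

lemma entropy_transport_mono:
  assumes "\<And>z. z \<in> S \<times> S \<Longrightarrow> c z \<le> c' z" "\<alpha> \<le> \<alpha>'"
  shows "entropy_transport S c \<alpha> \<mu> \<nu> \<le> entropy_transport S c' \<alpha>' \<mu> \<nu>"
  unfolding entropy_transport_def
proof (rule INF_mono, rule bexI)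
  fix \<gamma> assume \<gamma>: "\<gamma> \<in> radon_measures (S \<times> S)"
  then show "\<gamma> \<in> radon_measures (S \<times> S)" .
  show "(\<integral>\<^sup>+z. c z \<partial>\<gamma>) + \<alpha> * (KL (marginal1 S \<gamma>) \<mu> + KL (marginal2 S \<gamma>) \<nu>)
      \<le> (\<integral>\<^sup>+z. c' z \<partial>\<gamma>) + \<alpha>' * (KL (marginal1 S \<gamma>) \<mu> + KL (marginal2 S \<gamma>) \<nu>)"
    using assms radon_measuresD(2)[OF \<gamma>] by (intro add_mono nn_integral_mono mult_right_mono) auto
qed

text \<open>Both costs vanish on the diagonal, and off it the Hellinger cost is infinite. This bound
  for every single k is already the upper bound for parameters tending to 0.\<close>

lemma HK_sq_le_Hell_sq:
  fixes S :: "'a::euclidean_space set"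
  assumes "0 < k" "\<mu> \<in> radon_measures S" "\<nu> \<in> radon_measures S"
  shows "HK_sq S k \<mu> \<nu> \<le> Hell_sq \<mu> \<nu>"
  unfolding HK_sq_eq_entropy_transport[OF assms(1)] Hell_sq_eq_entropy_transport[OF assms(2,3)]
  using assms(1) by (intro entropy_transport_mono) (auto simp: HK_limit_cost_def HK_cost_def)

text \<open>The bound does not depend on k and so serves as the dominating function for reverse
  Fatou. It comes from the Hellinger distance, whose integrand is at most u + v.\<close>

lemma HK_sq_le_mass:
  fixes S :: "'a::euclidean_space set"
  assumes \<mu>: "\<mu> \<in> radon_measures S" and \<nu>: "\<nu> \<in> radon_measures S" and "0 < k"
  shows "HK_sq S k \<mu> \<nu> \<le> ennreal (measure \<mu> S + measure \<nu> S)"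
proof -
  define \<tau> where "\<tau> = sum_measure \<mu> \<nu>"
  have \<tau>: "\<tau> \<in> radon_measures S" unfolding \<tau>_def by (rule sum_radon_measure(1)[OF \<mu> \<nu>])
  have sets: "sets \<mu> = sets \<nu>" using radon_measuresD(1) \<mu> \<nu> by blast
  note ac = absolutely_continuous_sum_measure[OF sets, folded \<tau>_def]
  obtain u where u: "u \<in> borel_measurable \<tau>" "\<And>x. 0 \<le> u x" "\<mu> = density \<tau> (\<lambda>x. ennreal (u x))"
    using radon_density_exists[OF \<mu> \<tau> ac(1)] by metis
  obtain v where v: "v \<in> borel_measurable \<tau>" "\<And>x. 0 \<le> v x" "\<nu> = density \<tau> (\<lambda>x. ennreal (v x))"
    using radon_density_exists[OF \<nu> \<tau> ac(2)] by metis
  have [measurable]: "u \<in> borel_measurable \<tau>" "v \<in> borel_measurable \<tau>" by fact+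
  have mass: "(\<integral>\<^sup>+x. ennreal (w x) \<partial>\<tau>) = ennreal (measure \<rho> S)"
    if \<rho>: "\<rho> \<in> radon_measures S" and [measurable]: "w \<in> borel_measurable \<tau>" and w: "\<rho> = density \<tau> (\<lambda>x. ennreal (w x))"
    for w \<rho>
  proof -
    have "emeasure \<rho> (space \<tau>) = (\<integral>\<^sup>+x. ennreal (w x) * indicator (space \<tau>) x \<partial>\<tau>)"
      unfolding w by (rule emeasure_density) simp_all
    also have "\<dots> = (\<integral>\<^sup>+x. ennreal (w x) \<partial>\<tau>)" by (rule nn_integral_cong) simp
    finally show ?thesis unfolding emeasure_radon[OF \<rho>] radon_measuresD(2)[OF \<tau>] by (rule sym)
  qed
  have "HK_sq S k \<mu> \<nu> \<le> Hell_sq \<mu> \<nu>" by (rule HK_sq_le_Hell_sq[OF assms(3) \<mu> \<nu>])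
  also have "\<dots> = (\<integral>\<^sup>+x. ennreal ((sqrt (u x) - sqrt (v x))\<^sup>2) \<partial>\<tau>)"
    by (rule Hell_sq_density[OF \<tau>_def[symmetric] radon_measuresD(3)[OF \<tau>] u v])
  also have "\<dots> \<le> (\<integral>\<^sup>+x. ennreal (u x) + ennreal (v x) \<partial>\<tau>)"
  proof (rule nn_integral_mono)
    fix x
    have "(sqrt (u x) - sqrt (v x))\<^sup>2 \<le> u x + v x"
      using u(2)[of x] v(2)[of x] by (simp add: power2_diff)
    then show "ennreal ((sqrt (u x) - sqrt (v x))\<^sup>2) \<le> ennreal (u x) + ennreal (v x)"
      using u(2)[of x] v(2)[of x] by (simp add: ennreal_plus[symmetric] ennreal_leI del: ennreal_plus)
  qed
  also have "\<dots> = ennreal (measure \<mu> S) + ennreal (measure \<nu> S)"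
    using mass[OF \<mu> u(1,3)] mass[OF \<nu> v(1,3)] by (simp add: nn_integral_add)
  finally show ?thesis by simp
qed

lemma ennreal_mult_INF_ge:
  fixes f :: "'b \<Rightarrow> ennreal"
  assumes "0 < c" "\<And>i. i \<in> I \<Longrightarrow> X \<le> ennreal c * f i"
  shows "X \<le> ennreal c * (INF i\<in>I. f i)"
proof -
  have c: "ennreal (1 / c) * ennreal c = 1" using assms(1) by (simp add: ennreal_mult'[symmetric])
  have "ennreal (1 / c) * X \<le> (INF i\<in>I. f i)"
  proof (rule INF_greatest)
    fix i assume "i \<in> I"
    from mult_left_mono[OF assms(2)[OF this], of "ennreal (1 / c)"]
    show "ennreal (1 / c) * X \<le> f i" unfolding mult.assoc[symmetric] c by simp
  qed
  from mult_left_mono[OF this, of "ennreal c"]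
  show ?thesis unfolding mult.assoc[symmetric] mult.commute[of "ennreal c"] c by (simp add: mult.commute)
qed

lemma scaled_HK_sq_ge_entropy_transport:
  fixes S :: "'a::euclidean_space set"
  assumes k: "0 < k"
  shows "entropy_transport S (\<lambda>z. ennreal (k\<^sup>2) * HK_limit_cost k z) (ennreal (k\<^sup>2)) \<mu> \<nu>
    \<le> ennreal (k\<^sup>2) * HK_sq S k \<mu> \<nu>"
  unfolding HK_sq_eq_entropy_transport[OF k]
  unfolding entropy_transport_def[of S "HK_limit_cost k"]
proof (rule ennreal_mult_INF_ge)
  fix \<gamma> assume \<gamma>: "\<gamma> \<in> radon_measures (S \<times> S)"
  have "(\<integral>\<^sup>+z. ennreal (k\<^sup>2) * HK_limit_cost k z \<partial>\<gamma>) = ennreal (k\<^sup>2) * (\<integral>\<^sup>+z. HK_limit_cost k z \<partial>\<gamma>)"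
    using k by (intro nn_integral_cmult HK_limit_cost_measurable[OF \<gamma>]) simp
  then show "entropy_transport S (\<lambda>z. ennreal (k\<^sup>2) * HK_limit_cost k z) (ennreal (k\<^sup>2)) \<mu> \<nu>
      \<le> ennreal (k\<^sup>2) * ((\<integral>\<^sup>+z. HK_limit_cost k z \<partial>\<gamma>) + 1 * (KL (marginal1 S \<gamma>) \<mu> + KL (marginal2 S \<gamma>) \<nu>))"
    unfolding entropy_transport_def by (intro INF_lower2[OF \<gamma>]) (simp add: distrib_left)
qed (use k in simp)

text \<open>A coupling of \<mu> and \<nu> is a plan with vanishing entropies, so only the costs have
  to be compared. K depends on S and e but not on the measures, so the bound can be integrated
  against \<Lambda>.\<close>

lemma scaled_HK_sq_le_W_sq:
  fixes S :: "'a::euclidean_space set"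
  assumes S: "bounded S" and e: "0 < e"
  shows "\<exists>K>0. \<forall>k\<ge>K. \<forall>\<mu>\<in>radon_measures S. \<forall>\<nu>\<in>radon_measures S.
    ennreal (k\<^sup>2) * HK_sq S k \<mu> \<nu> \<le> ennreal (1 + e) * W_sq S \<mu> \<nu>"
proof -
  obtain D where D: "\<And>x y. x \<in> S \<Longrightarrow> y \<in> S \<Longrightarrow> dist x y \<le> D" using S unfolding bounded_two_points by blast
  obtain K where K: "0 < K" and le: "\<And>k x y :: 'a. K \<le> k \<Longrightarrow> dist x y \<le> D \<Longrightarrow>
      ennreal (k\<^sup>2) * HK_cost k x y \<le> ennreal ((1 + e) * (dist x y)\<^sup>2)"
    using scaled_HK_cost_le[OF e, of D, where 'a = 'a] by blast
  show ?thesis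
  proof (intro exI[of _ K] conjI K allI impI ballI)
    fix k :: real and \<mu> \<nu> :: "'a measure"
    assume k: "K \<le> k" and \<mu>: "\<mu> \<in> radon_measures S" and \<nu>: "\<nu> \<in> radon_measures S"
    have k0: "0 < k" using k K by simp
    show "ennreal (k\<^sup>2) * HK_sq S k \<mu> \<nu> \<le> ennreal (1 + e) * W_sq S \<mu> \<nu>"
      unfolding W_sq_def
    proof (rule ennreal_mult_INF_ge)
      fix \<gamma> assume "\<gamma> \<in> {\<gamma> \<in> radon_measures (S \<times> S). marginal1 S \<gamma> = \<mu> \<and> marginal2 S \<gamma> = \<nu>}"
      then have \<gamma>: "\<gamma> \<in> radon_measures (S \<times> S)" "marginal1 S \<gamma> = \<mu>" "marginal2 S \<gamma> = \<nu>" by auto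
      have dm: "(\<lambda>z. ennreal ((dist (fst z) (snd z))\<^sup>2)) \<in> borel_measurable \<gamma>"
        by (intro measurable_compose[OF _ measurable_ennreal] radon_measurable_continuous[OF \<gamma>(1)] continuous_intros)
      have "HK_sq S k \<mu> \<nu> \<le> (\<integral>\<^sup>+z. HK_limit_cost k z \<partial>\<gamma>)"
        unfolding HK_sq_eq_entropy_transport[OF k0] entropy_transport_def
        by (intro INF_lower2[OF \<gamma>(1)]) (simp add: \<gamma> KL_self[OF \<mu>] KL_self[OF \<nu>])
      then have "ennreal (k\<^sup>2) * HK_sq S k \<mu> \<nu> \<le> ennreal (k\<^sup>2) * (\<integral>\<^sup>+z. HK_limit_cost k z \<partial>\<gamma>)"
        by (rule mult_left_mono) simp
      also have "\<dots> = (\<integral>\<^sup>+z. ennreal (k\<^sup>2) * HK_limit_cost k z \<partial>\<gamma>)"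
        using k0 by (intro nn_integral_cmult[symmetric] HK_limit_cost_measurable[OF \<gamma>(1)]) simp
      also have "\<dots> \<le> (\<integral>\<^sup>+z. ennreal (1 + e) * ennreal ((dist (fst z) (snd z))\<^sup>2) \<partial>\<gamma>)"
      proof (rule nn_integral_mono)
        fix z assume "z \<in> space \<gamma>"
        then have "dist (fst z) (snd z) \<le> D" using D by (auto simp: radon_measuresD(2)[OF \<gamma>(1)])
        from le[OF k this]
        show "ennreal (k\<^sup>2) * HK_limit_cost k z \<le> ennreal (1 + e) * ennreal ((dist (fst z) (snd z))\<^sup>2)"
          using k0 e by (simp only: HK_limit_cost_def ennreal_mult' zero_le_power2) simp
      qed
      also have "\<dots> = ennreal (1 + e) * (\<integral>\<^sup>+z. ennreal ((dist (fst z) (snd z))\<^sup>2) \<partial>\<gamma>)"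
        by (rule nn_integral_cmult[OF dm])
      finally show "ennreal (k\<^sup>2) * HK_sq S k \<mu> \<nu> \<le> ennreal (1 + e) * (\<integral>\<^sup>+z. ennreal ((dist (fst z) (snd z))\<^sup>2) \<partial>\<gamma>)" .
    qed (use e in simp)
  qed
qed

text \<open>\<open>kl_entropy\<close> decreases below 1 with unbounded slope near 0, so removing an
  amount b from a density may raise the entropy. Above a threshold d the slope is at least ln d,
  which gives the term C * b; below d the additive e absorbs the loss.\<close>

lemma kl_entropy_le_add:
  assumes "0 < e"
  shows "\<exists>C\<ge>0. \<forall>a\<ge>0. \<forall>b\<ge>0. kl_entropy a \<le> kl_entropy (a + b) + e + C * b"
proof -
  \<comment> \<open>The threshold d must satisfy d - d * ln d \<le> e. For d = h * h, the bound -ln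
    h \<le> 1 / h - 1 yields at most 2 * h - h * h, hence the choice of h below e / 2.\<close>
  define h where "h = min (e / 2) (1 / 2)"
  have h: "0 < h" "h < 1" "2 * h \<le> e" using assms by (auto simp: h_def)
  define d where "d = h\<^sup>2"
  have lh: "ln h < 0" using h by simp
  have ld: "ln d = 2 * ln h" using h by (simp add: d_def ln_realpow)
  have d: "0 < d" "d < 1" using h by (auto simp: d_def power_less_one_iff)
  have "ln (1 / h) \<le> 1 / h - 1" using h by (intro ln_le_minus_one) auto
  then have "h\<^sup>2 * (- ln h) \<le> h\<^sup>2 * (1 / h - 1)" using h by (intro mult_left_mono) (auto simp: ln_div)
  also have "\<dots> = h - h\<^sup>2" using h by (simp add: field_simps power2_eq_square)
  finally have "h\<^sup>2 * (- ln h) \<le> h - h\<^sup>2" .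
  moreover have "d * ln d = 2 * (h\<^sup>2 * ln h)" unfolding ld by (simp add: d_def)
  ultimately have "d - d * ln d \<le> 2 * h - h\<^sup>2" using d_def by linarith
  also have "\<dots> \<le> e" using h(3) zero_le_power2[of h] by linarith
  finally have de: "d - d * ln d \<le> e" .
  show ?thesis
  proof (intro exI[of _ "- ln d"] conjI allI impI)
    show "0 \<le> - ln d" using lh ld by simp
    fix a b :: real assume ab: "0 \<le> a" "0 \<le> b"
    show "kl_entropy a \<le> kl_entropy (a + b) + e + - ln d * b"
    proof (cases "d \<le> a")
      case True
      then have a: "0 < a" using d by simp
      \<comment> \<open>Young's inequality with slope ln a is the tangent line at a.\<close>
      have "(a + b) * ln a - (exp (ln a) - 1) \<le> kl_entropy (a + b)"
        by (rule kl_entropy_young) (use ab in simp)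
      then have "kl_entropy a + b * ln a \<le> kl_entropy (a + b)"
        using a by (simp add: kl_entropy_def algebra_simps)
      moreover have "b * ln d \<le> b * ln a" using True d ab by (intro mult_left_mono) auto
      ultimately show ?thesis using assms by (simp add: algebra_simps)
    next
      case False
      \<comment> \<open>Near 0 the tangent at a would be too steep; the crude bound 1 is compared
        with the tangent line at d instead.\<close>
      have "kl_entropy a \<le> 1"
      proof (cases "a = 0")
        case f: False
        then have "ln a \<le> 0" "0 < a" using False ab d by auto
        then have "kl_entropy a = a * ln a - a + 1" "a * ln a \<le> 0" "0 < a"
          using mult_nonneg_nonpos[of a "ln a"] by (simp_all add: kl_entropy_def)
        then show ?thesis by linarith
      qed (simp add: kl_entropy_def)
      moreover have "(a + b) * ln d - (d - 1) \<le> kl_entropy (a + b)"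
        using kl_entropy_young[of "a + b" "ln d"] ab d by simp
      moreover have "d * ln d \<le> a * ln d" using False d lh ld by (intro mult_right_mono_neg) auto
      ultimately show ?thesis using de unfolding distrib_right minus_mult_left[symmetric] mult.commute[of "ln d"]
        by linarith
    qed
  qed
qed

text \<open>Intended for marginals: \<rho>1 and \<rho>2 come from the kept and the discarded part of
  one plan.\<close>

lemma KL_submeasure_le:
  assumes \<rho>: "\<rho> \<in> radon_measures S" and \<rho>1: "\<rho>1 \<in> radon_measures S" and \<rho>2: "\<rho>2 \<in> radon_measures S"
    and \<mu>: "\<mu> \<in> radon_measures S"
    and sum: "\<And>A. A \<in> sets \<rho> \<Longrightarrow> emeasure \<rho> A = emeasure \<rho>1 A + emeasure \<rho>2 A"
    and C: "0 \<le> C" "\<forall>a\<ge>0. \<forall>b\<ge>0. kl_entropy a \<le> kl_entropy (a + b) + e + C * b" and e: "0 \<le> e"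
  shows "KL \<rho>1 \<mu> \<le> KL \<rho> \<mu> + ennreal (e * measure \<mu> S + C * measure \<rho>2 S)"
proof (cases "absolutely_continuous \<mu> \<rho>")
  case True
  have sets: "sets \<rho> = sets \<mu>" "sets \<rho>1 = sets \<mu>" "sets \<rho>2 = sets \<mu>"
    using radon_measuresD(1) \<rho> \<rho>1 \<rho>2 \<mu> by blast+
  have ac: "absolutely_continuous \<mu> \<rho>1" "absolutely_continuous \<mu> \<rho>2"
    using True sum sets unfolding absolutely_continuous_def null_sets_def by auto
  obtain a where a: "a \<in> borel_measurable \<mu>" "\<And>x. 0 \<le> a x" "\<rho>1 = density \<mu> (\<lambda>x. ennreal (a x))"
    using radon_density_exists[OF \<rho>1 \<mu> ac(1)] by metis
  obtain b where b: "b \<in> borel_measurable \<mu>" "\<And>x. 0 \<le> b x" "\<rho>2 = density \<mu> (\<lambda>x. ennreal (b x))"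
    using radon_density_exists[OF \<rho>2 \<mu> ac(2)] by metis
  have [measurable]: "a \<in> borel_measurable \<mu>" "b \<in> borel_measurable \<mu>" by fact+
  have d: "\<rho> = density \<mu> (\<lambda>x. ennreal (a x + b x))"
  proof (rule measure_eqI)
    fix A assume A: "A \<in> sets \<rho>"
    then have [measurable]: "A \<in> sets \<mu>" using sets by simp
    have "emeasure (density \<mu> (\<lambda>x. ennreal (a x + b x))) A
        = (\<integral>\<^sup>+x. ennreal (a x) * indicator A x + ennreal (b x) * indicator A x \<partial>\<mu>)"
      by (subst emeasure_density) (auto intro!: nn_integral_cong simp: a(2) b(2) distrib_right)
    also have "\<dots> = emeasure \<rho>1 A + emeasure \<rho>2 A"
      unfolding a(3) b(3) by (subst nn_integral_add) (auto simp: emeasure_density)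
    finally show "emeasure \<rho> A = emeasure (density \<mu> (\<lambda>x. ennreal (a x + b x))) A" using sum[OF A] by simp
  qed (simp add: sets)
  have spS: "space \<mu> = S" using radon_measuresD(2)[OF \<mu>] .
  have S: "S \<in> sets \<mu>" using sets.top[of \<mu>] spS by simp
  have "(\<integral>\<^sup>+x. ennreal (b x) \<partial>\<mu>) = (\<integral>\<^sup>+x. ennreal (b x) * indicator S x \<partial>\<mu>)"
    by (rule nn_integral_cong) (simp add: spS)
  also have "\<dots> = emeasure \<rho>2 S" unfolding b(3) by (rule emeasure_density[symmetric]) (use S in auto)
  finally have bS: "(\<integral>\<^sup>+x. ennreal (b x) \<partial>\<mu>) = ennreal (measure \<rho>2 S)" by (simp add: emeasure_radon[OF \<rho>2])
  have "KL \<rho>1 \<mu> = (\<integral>\<^sup>+x. ennreal (kl_entropy (a x)) \<partial>\<mu>)"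
    unfolding a(3) by (rule KL_density[OF radon_measuresD(3)[OF \<mu>] a(1,2)])
  also have "\<dots> \<le> (\<integral>\<^sup>+x. ennreal (kl_entropy (a x + b x)) + (ennreal e + ennreal C * ennreal (b x)) \<partial>\<mu>)"
  proof (rule nn_integral_mono)
    fix x
    have "kl_entropy (a x) \<le> kl_entropy (a x + b x) + (e + C * b x)" using C(2) a(2)[of x] b(2)[of x] by force
    then have "ennreal (kl_entropy (a x)) \<le> ennreal (kl_entropy (a x + b x) + (e + C * b x))" by (rule ennreal_leI)
    also have "\<dots> = ennreal (kl_entropy (a x + b x)) + (ennreal e + ennreal C * ennreal (b x))"
      using a(2)[of x] b(2)[of x] C(1) e by (simp add: ennreal_plus kl_entropy_nonneg ennreal_mult')
    finally show "ennreal (kl_entropy (a x)) \<le> ennreal (kl_entropy (a x + b x)) + (ennreal e + ennreal C * ennreal (b x))" .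
  qed
  also have "\<dots> = (\<integral>\<^sup>+x. ennreal (kl_entropy (a x + b x)) \<partial>\<mu>) + (ennreal e * emeasure \<mu> (space \<mu>) + ennreal C * (\<integral>\<^sup>+x. ennreal (b x) \<partial>\<mu>))"
    by (simp add: nn_integral_add nn_integral_cmult)
  also have "(\<integral>\<^sup>+x. ennreal (kl_entropy (a x + b x)) \<partial>\<mu>) = KL \<rho> \<mu>"
    unfolding d using a b by (intro KL_density[symmetric] radon_measuresD(3)[OF \<mu>]) auto
  also have "ennreal e * emeasure \<mu> (space \<mu>) + ennreal C * (\<integral>\<^sup>+x. ennreal (b x) \<partial>\<mu>) = ennreal (e * measure \<mu> S + C * measure \<rho>2 S)"
    using C(1) e by (simp add: bS spS emeasure_radon[OF \<mu>] ennreal_mult' ennreal_plus)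
  finally show ?thesis .
qed (simp add: KL_def)

lemma radon_restrict:
  assumes \<gamma>: "\<gamma> \<in> radon_measures T" and A: "A \<in> sets \<gamma>"
  shows "density \<gamma> (indicator A) \<in> radon_measures T"
proof -
  have "emeasure (density \<gamma> (indicator A)) (space \<gamma>) = emeasure \<gamma> A"
    using A sets.sets_into_space[OF A] by (simp add: emeasure_restricted Int_absorb2)
  then have "finite_measure (density \<gamma> (indicator A))"
    by (intro finite_measureI) (simp add: emeasure_radon[OF \<gamma>])
  then show ?thesis using radon_measuresD(1)[OF \<gamma>] by (simp add: radon_measures_def)
qed

text \<open>Restricting a near-optimal plan to the pairs where the costs are already close gives a
  competitor; the discarded mass tends to zero and changes the entropies only slightly.\<close>

lemma HK_sq_limsup:
  fixes S :: "'a::euclidean_space set"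
  assumes k: "0 < k" "kn \<longlonglongrightarrow> k" "\<And>n. 0 < kn n"
    and \<mu>: "\<mu> \<in> radon_measures S" and \<nu>: "\<nu> \<in> radon_measures S"
  shows "limsup (\<lambda>n. HK_sq S (kn n) \<mu> \<nu>) \<le> HK_sq S k \<mu> \<nu>"
  unfolding HK_sq_eq_entropy_transport[OF k(1)] unfolding entropy_transport_def[of S "HK_limit_cost k"]
proof (rule INF_greatest)
  fix \<gamma> assume \<gamma>: "\<gamma> \<in> radon_measures (S \<times> S)"
  define F where "F = (\<integral>\<^sup>+z. HK_limit_cost k z \<partial>\<gamma>) + 1 * (KL (marginal1 S \<gamma>) \<mu> + KL (marginal2 S \<gamma>) \<nu>)"
  interpret g: finite_measure \<gamma> using radon_measuresD(3)[OF \<gamma>] .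
  have sp: "space \<gamma> = S \<times> S" using radon_measuresD(2)[OF \<gamma>] .
  note marg = marginal_measurable[OF \<gamma>]
  have cm [measurable]: "HK_limit_cost k \<in> borel_measurable \<gamma>" "HK_limit_cost (kn n) \<in> borel_measurable \<gamma>" for n
    using HK_limit_cost_measurable[OF \<gamma>] k(1) k(3)[of n] by (simp_all add: less_imp_le)
  show "limsup (\<lambda>n. HK_sq S (kn n) \<mu> \<nu>) \<le> F"
  proof (cases "F = \<infinity>")
    case False
    \<comment> \<open>Collects the errors proportional to e: one from the cost, carried by \<gamma>,
      and one from each entropy, carried by \<mu> and \<nu>.\<close>
    define T where "T = measure \<gamma> (S \<times> S) + measure \<mu> S + measure \<nu> S"
    have T: "0 \<le> T" by (simp add: T_def)
    have step: "limsup (\<lambda>n. HK_sq S (kn n) \<mu> \<nu>) \<le> F + ennreal (e * T)" if e: "0 < e" for e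
    proof -
      obtain C where C: "0 \<le> C" "\<forall>a\<ge>0. \<forall>b\<ge>0. kl_entropy a \<le> kl_entropy (a + b) + e + C * b"
        using kl_entropy_le_add[OF e] by blast
      \<comment> \<open>The kept pairs. Pairs close to the threshold \<open>k * pi / 2\<close> may
        drop out, since their cost at a smaller parameter can be much larger or infinite.\<close>
      define A where "A n = {z \<in> space \<gamma>. HK_limit_cost (kn n) z \<le> HK_limit_cost k z + ennreal e}" for n
      have A [measurable]: "A n \<in> sets \<gamma>" for n unfolding A_def by measurable
      define B where "B n = space \<gamma> - A n" for n
      have B [measurable]: "B n \<in> sets \<gamma>" for n unfolding B_def by measurable
      have "(\<integral>\<^sup>+z. HK_limit_cost k z \<partial>\<gamma>) \<noteq> \<infinity>" using False by (auto simp: F_def)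
      then have "AE z in \<gamma>. HK_limit_cost k z \<noteq> \<infinity>" by (rule nn_integral_PInf_AE[OF cm(1)])
      \<comment> \<open>Finite total cost confines \<gamma> to pairs of finite cost, where the costs
        converge; hence almost every pair is eventually kept.\<close>
      then have lim0: "AE z in \<gamma>. (\<lambda>n. indicator (B n) z :: real) \<longlonglongrightarrow> 0"
        using AE_space
      proof eventually_elim
        case (elim z)
        then have fin: "HK_cost k (fst z) (snd z) < \<infinity>" using k(1) by (simp add: HK_limit_cost_def less_top)
        then obtain c where "HK_cost k (fst z) (snd z) = ennreal c" "0 \<le> c"
          by (cases "HK_cost k (fst z) (snd z)") auto
        then have "HK_cost k (fst z) (snd z) < HK_limit_cost k z + ennreal e"
          using e k(1) by (simp add: HK_limit_cost_def ennreal_plus[symmetric] ennreal_less_iff del: ennreal_plus)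
        from order_tendstoD(2)[OF HK_cost_tendsto[OF k(1,2) fin] this]
        have "\<forall>\<^sub>F n in sequentially. indicator (B n) z = (0 :: real)"
          by eventually_elim (use elim k(3) in \<open>auto simp: B_def A_def HK_limit_cost_def less_imp_le less_imp_neq[symmetric]\<close>)
        then show ?case by (rule tendsto_eventually)
      qed
      have "(\<lambda>n. \<integral>z. indicator (B n) z \<partial>\<gamma>) \<longlonglongrightarrow> (\<integral>z. (0 :: real) \<partial>\<gamma>)"
        by (rule integral_dominated_convergence[where w = "\<lambda>_. 1"]) (use lim0 in \<open>auto simp: indicator_def\<close>)
      then have Blim: "(\<lambda>n. measure \<gamma> (B n)) \<longlonglongrightarrow> 0"
        using sets.sets_into_space[OF B] by (simp add: Int_absorb2)
      have bound: "HK_sq S (kn n) \<mu> \<nu> \<le> F + ennreal (e * T + 2 * C * measure \<gamma> (B n))" for n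
      proof -
        define \<gamma>1 where "\<gamma>1 = density \<gamma> (indicator (A n))"
        define \<gamma>2 where "\<gamma>2 = density \<gamma> (indicator (B n))"
        have \<gamma>1: "\<gamma>1 \<in> radon_measures (S \<times> S)" and \<gamma>2: "\<gamma>2 \<in> radon_measures (S \<times> S)"
          unfolding \<gamma>1_def \<gamma>2_def by (intro radon_restrict[OF \<gamma>] A B)+
        have split: "emeasure \<gamma> X = emeasure \<gamma>1 X + emeasure \<gamma>2 X" if X: "X \<in> sets \<gamma>" for X
        proof -
          have "emeasure \<gamma>1 X + emeasure \<gamma>2 X = emeasure \<gamma> (A n \<inter> X) + emeasure \<gamma> (B n \<inter> X)"
            unfolding \<gamma>1_def \<gamma>2_def using X A B by (simp add: emeasure_restricted)
          also have "\<dots> = emeasure \<gamma> (A n \<inter> X \<union> B n \<inter> X)"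
            using X A B by (intro plus_emeasure) (auto simp: B_def)
          also have "A n \<inter> X \<union> B n \<inter> X = X" using sets.sets_into_space[OF X] by (auto simp: B_def)
          finally show ?thesis by simp
        qed
        have sets12: "sets \<gamma>1 = sets \<gamma>" "sets \<gamma>2 = sets \<gamma>" by (simp_all add: \<gamma>1_def \<gamma>2_def)
        have sp12: "space \<gamma>1 = space \<gamma>" "space \<gamma>2 = space \<gamma>" by (simp_all add: \<gamma>1_def \<gamma>2_def)
        have m1: "emeasure (marginal1 S \<gamma>) X = emeasure (marginal1 S \<gamma>1) X + emeasure (marginal1 S \<gamma>2) X"
          if X: "X \<in> sets (marginal1 S \<gamma>)" for X
        proof -
          have X': "X \<in> sets (restrict_space borel S)" using X by (simp add: marginal1_def)
          show ?thesis
            unfolding marginal1_def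
              emeasure_distr[OF marg(1) X'] emeasure_distr[OF marginal_measurable(1)[OF \<gamma>1] X']
              emeasure_distr[OF marginal_measurable(1)[OF \<gamma>2] X'] sp12
            by (rule split[OF measurable_sets[OF marg(1) X']])
        qed
        have m2: "emeasure (marginal2 S \<gamma>) X = emeasure (marginal2 S \<gamma>1) X + emeasure (marginal2 S \<gamma>2) X"
          if X: "X \<in> sets (marginal2 S \<gamma>)" for X
        proof -
          have X': "X \<in> sets (restrict_space borel S)" using X by (simp add: marginal2_def)
          show ?thesis
            unfolding marginal2_def
              emeasure_distr[OF marg(2) X'] emeasure_distr[OF marginal_measurable(2)[OF \<gamma>1] X']
              emeasure_distr[OF marginal_measurable(2)[OF \<gamma>2] X'] sp12
            by (rule split[OF measurable_sets[OF marg(2) X']])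
        qed
        have mass2: "measure \<gamma>2 (S \<times> S) = measure \<gamma> (B n)"
          using sets.sets_into_space[OF B[of n]] sets.top[of \<gamma>] B[of n]
          by (simp add: \<gamma>2_def measure_def emeasure_restricted sp Int_absorb2)
        have K1: "KL (marginal1 S \<gamma>1) \<mu> \<le> KL (marginal1 S \<gamma>) \<mu> + ennreal (e * measure \<mu> S + C * measure \<gamma> (B n))"
          using KL_submeasure_le[OF marginal_radon(1)[OF \<gamma>] marginal_radon(1)[OF \<gamma>1] marginal_radon(1)[OF \<gamma>2] \<mu> m1 C less_imp_le[OF e]]
          by (simp add: measure_marginal(1)[OF \<gamma>2] mass2)
        have K2: "KL (marginal2 S \<gamma>1) \<nu> \<le> KL (marginal2 S \<gamma>) \<nu> + ennreal (e * measure \<nu> S + C * measure \<gamma> (B n))"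
          using KL_submeasure_le[OF marginal_radon(2)[OF \<gamma>] marginal_radon(2)[OF \<gamma>1] marginal_radon(2)[OF \<gamma>2] \<nu> m2 C less_imp_le[OF e]]
          by (simp add: measure_marginal(2)[OF \<gamma>2] mass2)
        have "(\<integral>\<^sup>+z. HK_limit_cost (kn n) z \<partial>\<gamma>1) = (\<integral>\<^sup>+z. indicator (A n) z * HK_limit_cost (kn n) z \<partial>\<gamma>)"
          unfolding \<gamma>1_def by (rule nn_integral_density) measurable
        also have "\<dots> \<le> (\<integral>\<^sup>+z. HK_limit_cost k z + ennreal e \<partial>\<gamma>)"
          by (rule nn_integral_mono) (auto simp: A_def indicator_def)
        also have "\<dots> = (\<integral>\<^sup>+z. HK_limit_cost k z \<partial>\<gamma>) + ennreal (e * measure \<gamma> (S \<times> S))"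
          using e by (subst nn_integral_add) (auto simp: sp emeasure_radon[OF \<gamma>] ennreal_mult')
        finally have K0: "(\<integral>\<^sup>+z. HK_limit_cost (kn n) z \<partial>\<gamma>1) \<le> (\<integral>\<^sup>+z. HK_limit_cost k z \<partial>\<gamma>) + ennreal (e * measure \<gamma> (S \<times> S))" .
        have "HK_sq S (kn n) \<mu> \<nu> \<le> (\<integral>\<^sup>+z. HK_limit_cost (kn n) z \<partial>\<gamma>1) + 1 * (KL (marginal1 S \<gamma>1) \<mu> + KL (marginal2 S \<gamma>1) \<nu>)"
          unfolding HK_sq_eq_entropy_transport[OF k(3)] entropy_transport_def by (rule INF_lower[OF \<gamma>1])
        also have "\<dots> \<le> ((\<integral>\<^sup>+z. HK_limit_cost k z \<partial>\<gamma>) + ennreal (e * measure \<gamma> (S \<times> S)))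
            + 1 * ((KL (marginal1 S \<gamma>) \<mu> + ennreal (e * measure \<mu> S + C * measure \<gamma> (B n)))
              + (KL (marginal2 S \<gamma>) \<nu> + ennreal (e * measure \<nu> S + C * measure \<gamma> (B n))))"
          by (intro add_mono mult_left_mono K0 K1 K2) simp
        also have "\<dots> = F + (ennreal (e * measure \<gamma> (S \<times> S)) + ennreal (e * measure \<mu> S + C * measure \<gamma> (B n))
            + ennreal (e * measure \<nu> S + C * measure \<gamma> (B n)))"
          by (simp add: F_def ac_simps)
        also have "\<dots> = F + ennreal (e * T + 2 * C * measure \<gamma> (B n))"
          using e C(1) by (simp add: ennreal_plus[symmetric] T_def algebra_simps del: ennreal_plus)
        finally show ?thesis .
      qed
      have "(\<lambda>n. F + ennreal (e * T + 2 * C * measure \<gamma> (B n))) \<longlonglongrightarrow> F + ennreal (e * T + 2 * C * 0)"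
        by (intro tendsto_add tendsto_const tendsto_ennrealI tendsto_mult Blim)
      then have "limsup (\<lambda>n. F + ennreal (e * T + 2 * C * measure \<gamma> (B n))) = F + ennreal (e * T)"
        by (simp add: lim_imp_Limsup)
      then show ?thesis using Limsup_mono[OF always_eventually, of "\<lambda>n. HK_sq S (kn n) \<mu> \<nu>"] bound by metis
    qed
    show ?thesis
    proof (rule ennreal_le_epsilon)
      fix e :: real assume "0 < e"
      have "limsup (\<lambda>n. HK_sq S (kn n) \<mu> \<nu>) \<le> F + ennreal (e / (T + 1) * T)"
        using \<open>0 < e\<close> T by (intro step) simp
      also have "\<dots> \<le> F + ennreal e"
        using \<open>0 < e\<close> T by (intro add_left_mono ennreal_leI) (simp add: field_simps)
      finally show "limsup (\<lambda>n. HK_sq S (kn n) \<mu> \<nu>) \<le> F + ennreal e" .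
    qed
  qed simp
qed


section \<open>Gamma-convergence of the barycenter functionals\<close>

text \<open>The alternative \<open>kn n = k\<close> admits the constant parameter, even 0. The same
  statement thus serves the convergence of functionals and the measurability of each
  distance.\<close>

lemma HK_limit_cost_liminf:
  fixes S :: "'a::euclidean_space set"
  assumes S: "compact S" and k: "0 \<le> k" "kn \<longlonglongrightarrow> k" "\<And>n. 0 < kn n \<or> kn n = k"
    and u: "\<And>n. u n \<in> bounded_radon_measures S M" "\<mu> \<in> bounded_radon_measures S M" "weak_star_conv S u \<mu>"
    and v: "\<And>n. v n \<in> bounded_radon_measures S M" "\<nu> \<in> bounded_radon_measures S M" "weak_star_conv S v \<nu>"
  shows "entropy_transport S (HK_limit_cost k) 1 \<mu> \<nu>
    \<le> liminf (\<lambda>n. entropy_transport S (HK_limit_cost (kn n)) 1 (u n) (v n))"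
proof (rule entropy_transport_lsc[OF S, where g = "\<lambda>j. HK_cost_trunc (k + 1 / real (Suc j)) (real j)"
      and \<alpha>' = "\<lambda>_. 1", OF _ _ _ _ _ _ _ u v])
  fix j :: nat
  have pos: "0 < k + 1 / real (Suc j)" using k(1) by (simp add: add_nonneg_pos)
  show "continuous_on (S \<times> S) (HK_cost_trunc (k + 1 / real (Suc j)) (real j))"
    by (rule continuous_on_HK_cost_trunc) (use pos in simp)
  show "0 \<le> HK_cost_trunc (k + 1 / real (Suc j)) (real j) z" for z by (rule HK_cost_trunc_nonneg) simp
  show "HK_cost_trunc (k + 1 / real (Suc j)) (real j) z \<le> HK_cost_trunc (k + 1 / real (Suc (Suc j))) (real (Suc j)) z" for z
    using k(1) by (intro HK_cost_trunc_mono) (auto simp: add_nonneg_pos frac_le)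
  have "\<forall>\<^sub>F n in sequentially. kn n < k + 1 / real (Suc j)"
    by (rule order_tendstoD(2)[OF k(2)]) simp
  then show "\<forall>\<^sub>F n in sequentially. \<forall>z\<in>S \<times> S.
      ennreal (HK_cost_trunc (k + 1 / real (Suc j)) (real j) z) \<le> HK_limit_cost (kn n) z"
  proof (eventually_elim, intro ballI)
    fix n z assume n: "kn n < k + 1 / real (Suc j)"
    show "ennreal (HK_cost_trunc (k + 1 / real (Suc j)) (real j) z) \<le> HK_limit_cost (kn n) z"
    \<comment> \<open>If \<open>kn n = k\<close>, the parameter may be 0, but the limit cost is
      itself the supremum of the truncations.\<close>
    proof (cases "kn n = k")
      case True
      show ?thesis unfolding True HK_limit_cost_eq_SUP[OF k(1)] by (rule SUP_upper) simp
    next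
      case False
      then have "0 < kn n" using k(3) by blast
      then show ?thesis
        using HK_cost_trunc_le[of "kn n" "k + 1 / real (Suc j)" "real j" z] n by (simp add: HK_limit_cost_def)
    qed
  qed
qed (use HK_limit_cost_eq_SUP[OF k(1)] in auto)

text \<open>The scaled cost is above the squared distance for every parameter, so the minorants g
  can be constant in j. The scaled weight tends to infinity and enforces the marginal constraints in
  the limit.\<close>

lemma W_sq_le_liminf_scaled_HK_sq:
  fixes S :: "'a::euclidean_space set"
  assumes S: "compact S" and k: "(\<lambda>n. ennreal (kn n)) \<longlonglongrightarrow> \<infinity>" "\<And>n. 0 < kn n"
    and u: "\<And>n. u n \<in> bounded_radon_measures S M" "\<mu> \<in> bounded_radon_measures S M" "weak_star_conv S u \<mu>"
    and v: "\<And>n. v n \<in> bounded_radon_measures S M" "\<nu> \<in> bounded_radon_measures S M" "weak_star_conv S v \<nu>"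
  shows "W_sq S \<mu> \<nu> \<le> liminf (\<lambda>n. ennreal ((kn n)\<^sup>2) * HK_sq S (kn n) (u n) (v n))"
proof -
  have top: "filterlim kn at_top sequentially" using k(1) by (simp add: ennreal_tendsto_top_eq_at_top)
  have "W_sq S \<mu> \<nu> = entropy_transport S (\<lambda>z. ennreal ((dist (fst z) (snd z))\<^sup>2)) \<infinity> \<mu> \<nu>"
    by (rule W_sq_eq_entropy_transport[OF bounded_radon_measuresD(1)[OF u(2)] bounded_radon_measuresD(1)[OF v(2)]])
  also have "\<dots> \<le> liminf (\<lambda>n. entropy_transport S (\<lambda>z. ennreal ((kn n)\<^sup>2) * HK_limit_cost (kn n) z)
      (ennreal ((kn n)\<^sup>2)) (u n) (v n))"
  proof (rule entropy_transport_lsc[OF S, where g = "\<lambda>_ z. (dist (fst z) (snd z))\<^sup>2", OF _ _ _ _ _ _ _ u v])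
    show "continuous_on (S \<times> S) (\<lambda>z. (dist (fst z) (snd z))\<^sup>2)" by (intro continuous_intros)
    show "\<forall>\<^sub>F n in sequentially. \<forall>z\<in>S \<times> S. ennreal ((dist (fst z) (snd z))\<^sup>2)
        \<le> ennreal ((kn n)\<^sup>2) * HK_limit_cost (kn n) z"
    proof (intro always_eventually allI ballI)
      fix n and z :: "'a \<times> 'a"
      show "ennreal ((dist (fst z) (snd z))\<^sup>2) \<le> ennreal ((kn n)\<^sup>2) * HK_limit_cost (kn n) z"
        using dist_sq_le_scaled_HK_cost[OF k(2)[of n], of "fst z" "snd z"] k(2)[of n]
        by (simp add: HK_limit_cost_def)
    qed
    have "filterlim (\<lambda>n. (kn n)\<^sup>2) at_top sequentially" by (rule filterlim_pow_at_top[OF _ top]) simp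
    then show "(\<lambda>n. ennreal ((kn n)\<^sup>2)) \<longlonglongrightarrow> \<infinity>" by (simp add: ennreal_tendsto_top_eq_at_top)
    have "\<forall>\<^sub>F n in sequentially. 1 \<le> kn n" using top by (simp add: filterlim_at_top)
    then show "\<forall>\<^sub>F n in sequentially. 1 \<le> ennreal ((kn n)\<^sup>2)"
      by eventually_elim (simp add: one_le_power)
  qed auto
  also have "\<dots> \<le> liminf (\<lambda>n. ennreal ((kn n)\<^sup>2) * HK_sq S (kn n) (u n) (v n))"
    by (intro Liminf_mono always_eventually allI scaled_HK_sq_ge_entropy_transport k(2))
  finally show ?thesis .
qed

text \<open>The constant weight \<infinity> in the semicontinuity theorem; the result provides
  measurability of the distance in its first argument.\<close>

lemma W_sq_liminf:
  fixes S :: "'a::euclidean_space set"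
  assumes S: "compact S"
    and u: "\<And>n. u n \<in> bounded_radon_measures S M" "\<mu> \<in> bounded_radon_measures S M" "weak_star_conv S u \<mu>"
    and v: "\<And>n. v n \<in> bounded_radon_measures S M" "\<nu> \<in> bounded_radon_measures S M" "weak_star_conv S v \<nu>"
  shows "W_sq S \<mu> \<nu> \<le> liminf (\<lambda>n. W_sq S (u n) (v n))"
  unfolding W_sq_eq_entropy_transport[OF bounded_radon_measuresD(1)[OF u(2)] bounded_radon_measuresD(1)[OF v(2)]]
    W_sq_eq_entropy_transport[OF bounded_radon_measuresD(1)[OF u(1)] bounded_radon_measuresD(1)[OF v(1)]]
  by (rule entropy_transport_lsc[OF S, where g = "\<lambda>_ z. (dist (fst z) (snd z))\<^sup>2" and \<alpha>' = "\<lambda>_. \<infinity>", OF _ _ _ _ _ _ _ u v])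
    (auto intro!: continuous_intros)

lemma bounded_radon_measures_mono: "M \<le> M' \<Longrightarrow> \<mu> \<in> bounded_radon_measures S M \<Longrightarrow> \<mu> \<in> bounded_radon_measures S M'"
  by (auto simp: bounded_radon_measures_def)

lemma bounded_radon_measures_self: "\<mu> \<in> radon_measures S \<Longrightarrow> \<mu> \<in> bounded_radon_measures S (max M (measure \<mu> S))"
  by (auto simp: bounded_radon_measures_def)

section \<open>Measurability, upper and lower limits of the functionals for a fixed law\<close>

context
  fixes S :: "'a::euclidean_space set" and M :: real and \<Lambda> :: "'a measure measure"
  assumes S: "compact S"
    and \<Lambda>: "\<Lambda> \<in> borel_prob_measures (subtopology (weak_star S) (bounded_radon_measures S M))"
begin

lemma space_borel_prob_measure: "space \<Lambda> = bounded_radon_measures S M"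
proof -
  define T where "T = subtopology (weak_star S) (bounded_radon_measures S M)"
  have "sets \<Lambda> = sets (borel_of T)" using \<Lambda> by (simp add: borel_prob_measures_def T_def)
  then have "space \<Lambda> = space (borel_of T)" by (rule sets_eq_imp_space_eq)
  also have "\<dots> = topspace T"
    unfolding borel_of_def by (rule space_measure_of) (use openin_subset in auto)
  also have "\<dots> = bounded_radon_measures S M"
    by (auto simp: T_def topspace_subtopology bounded_radon_measures_def)
  finally show ?thesis .
qed

lemma entropy_transport_measurable:
  assumes k: "0 \<le> k" and \<nu>: "\<nu> \<in> radon_measures S"
  shows "(\<lambda>\<mu>. entropy_transport S (HK_limit_cost k) 1 \<mu> \<nu>) \<in> borel_measurable \<Lambda>"
proof (rule borel_measurable_seq_lsc[OF S \<Lambda>])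
  fix u l a
  assume u: "\<And>n. u n \<in> bounded_radon_measures S M" and l: "l \<in> bounded_radon_measures S M"
    and conv: "weak_star_conv S u l" and a: "\<And>n. entropy_transport S (HK_limit_cost k) 1 (u n) \<nu> \<le> a"
  \<comment> \<open>A competitor \<nu> may have mass above M, while the semicontinuity bound uses
    one mass bound for both arguments.\<close>
  define M' where "M' = max M (measure \<nu> S)"
  note up = bounded_radon_measures_mono[of M M', OF max.cobounded1[of M "measure \<nu> S", folded M'_def]]
  note \<nu>' = bounded_radon_measures_self[OF \<nu>, of M, folded M'_def]
  have "entropy_transport S (HK_limit_cost k) 1 l \<nu>
      \<le> liminf (\<lambda>n :: nat. entropy_transport S (HK_limit_cost k) 1 (u n) \<nu>)"
    by (rule HK_limit_cost_liminf[OF S k tendsto_const _ up[OF u] up[OF l] conv \<nu>' \<nu>' weak_star_conv_const]) simp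
  also have "\<dots> \<le> liminf (\<lambda>n :: nat. a)" using a by (intro Liminf_mono always_eventually allI)
  also have "\<dots> = a" by (simp add: Liminf_const)
  finally show "entropy_transport S (HK_limit_cost k) 1 l \<nu> \<le> a" .
qed

lemma HK_sq_measurable:
  assumes "0 < k" "\<nu> \<in> radon_measures S"
  shows "(\<lambda>\<mu>. HK_sq S k \<mu> \<nu>) \<in> borel_measurable \<Lambda>"
  unfolding HK_sq_eq_entropy_transport[OF assms(1)] using assms by (intro entropy_transport_measurable) auto

lemma W_sq_measurable:
  assumes \<nu>: "\<nu> \<in> radon_measures S"
  shows "(\<lambda>\<mu>. W_sq S \<mu> \<nu>) \<in> borel_measurable \<Lambda>"
proof (rule borel_measurable_seq_lsc[OF S \<Lambda>])
  fix u l a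
  assume u: "\<And>n. u n \<in> bounded_radon_measures S M" and l: "l \<in> bounded_radon_measures S M"
    and conv: "weak_star_conv S u l" and a: "\<And>n. W_sq S (u n) \<nu> \<le> a"
  define M' where "M' = max M (measure \<nu> S)"
  note up = bounded_radon_measures_mono[of M M', OF max.cobounded1[of M "measure \<nu> S", folded M'_def]]
  note \<nu>' = bounded_radon_measures_self[OF \<nu>, of M, folded M'_def]
  have "W_sq S l \<nu> \<le> liminf (\<lambda>n :: nat. W_sq S (u n) \<nu>)"
    by (rule W_sq_liminf[OF S up[OF u] up[OF l] conv \<nu>' \<nu>' weak_star_conv_const])
  also have "\<dots> \<le> liminf (\<lambda>n :: nat. a)" using a by (intro Liminf_mono always_eventually allI)
  also have "\<dots> = a" by (simp add: Liminf_const)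
  finally show "W_sq S l \<nu> \<le> a" .
qed

lemma J_fun_ennreal: "0 < k \<Longrightarrow> J_fun S \<Lambda> (ennreal k) \<nu> = (\<integral>\<^sup>+\<mu>. HK_sq S k \<mu> \<nu> \<partial>\<Lambda>)"
  by (simp add: J_fun_def)

lemma J_fun_finite_eq:
  assumes "0 \<le> k" "\<nu> \<in> radon_measures S"
  shows "J_fun S \<Lambda> (ennreal k) \<nu> = (\<integral>\<^sup>+\<mu>. entropy_transport S (HK_limit_cost k) 1 \<mu> \<nu> \<partial>\<Lambda>)"
proof (cases "k = 0")
  case True
  have "(\<integral>\<^sup>+\<mu>. Hell_sq \<mu> \<nu> \<partial>\<Lambda>) = (\<integral>\<^sup>+\<mu>. entropy_transport S (HK_limit_cost 0) 1 \<mu> \<nu> \<partial>\<Lambda>)"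
    by (intro nn_integral_cong Hell_sq_eq_entropy_transport[OF _ assms(2)])
      (auto simp: space_borel_prob_measure dest: bounded_radon_measuresD(1))
  then show ?thesis using True by (simp add: J_fun_def)
next
  case False
  then show ?thesis using assms(1) J_fun_ennreal[of k] by (simp add: HK_sq_eq_entropy_transport)
qed

lemma J_fun_finite_limsup:
  assumes k: "0 \<le> k" "kn \<longlonglongrightarrow> k" "\<And>n. 0 < kn n" and \<nu>: "\<nu> \<in> radon_measures S"
  shows "limsup (\<lambda>n. J_fun S \<Lambda> (ennreal (kn n)) \<nu>) \<le> J_fun S \<Lambda> (ennreal k) \<nu>"
proof (cases "k = 0")
  case True
  have "J_fun S \<Lambda> (ennreal (kn n)) \<nu> \<le> J_fun S \<Lambda> 0 \<nu>" for n
    unfolding J_fun_ennreal[OF k(3)] unfolding J_fun_def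
    using \<nu> by (simp, intro nn_integral_mono HK_sq_le_Hell_sq k(3))
      (auto simp: space_borel_prob_measure dest: bounded_radon_measuresD(1))
  then have "limsup (\<lambda>n. J_fun S \<Lambda> (ennreal (kn n)) \<nu>) \<le> limsup (\<lambda>n :: nat. J_fun S \<Lambda> 0 \<nu>)"
    by (intro Limsup_mono always_eventually allI)
  then show ?thesis using True by (simp add: Limsup_const)
next
  case False
  then have k0: "0 < k" using k(1) by simp
  interpret prob_space \<Lambda> using \<Lambda> by (simp add: borel_prob_measures_def)
  have "limsup (\<lambda>n. \<integral>\<^sup>+\<mu>. HK_sq S (kn n) \<mu> \<nu> \<partial>\<Lambda>) \<le> (\<integral>\<^sup>+\<mu>. limsup (\<lambda>n. HK_sq S (kn n) \<mu> \<nu>) \<partial>\<Lambda>)"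
  proof (rule nn_integral_limsup[where w = "\<lambda>_. ennreal (M + measure \<nu> S)"])
    show "(\<lambda>\<mu>. HK_sq S (kn n) \<mu> \<nu>) \<in> borel_measurable \<Lambda>" for n by (rule HK_sq_measurable[OF k(3) \<nu>])
    show "AE \<mu> in \<Lambda>. HK_sq S (kn n) \<mu> \<nu> \<le> ennreal (M + measure \<nu> S)" for n
    proof (rule AE_I2)
      fix \<mu> assume "\<mu> \<in> space \<Lambda>"
      then have \<mu>: "\<mu> \<in> radon_measures S" "measure \<mu> S \<le> M"
        using bounded_radon_measuresD by (auto simp: space_borel_prob_measure)
      have "HK_sq S (kn n) \<mu> \<nu> \<le> ennreal (measure \<mu> S + measure \<nu> S)"
        by (rule HK_sq_le_mass[OF \<mu>(1) \<nu> k(3)])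
      also have "\<dots> \<le> ennreal (M + measure \<nu> S)" using \<mu>(2) by (intro ennreal_leI) simp
      finally show "HK_sq S (kn n) \<mu> \<nu> \<le> ennreal (M + measure \<nu> S)" .
    qed
  qed (simp_all add: emeasure_space_1)
  also have "\<dots> \<le> (\<integral>\<^sup>+\<mu>. HK_sq S k \<mu> \<nu> \<partial>\<Lambda>)"
    by (intro nn_integral_mono HK_sq_limsup[OF k0 k(2,3) _ \<nu>])
      (auto simp: space_borel_prob_measure dest: bounded_radon_measuresD(1))
  finally show ?thesis by (simp add: J_fun_ennreal k(3) k0)
qed

lemma J_fun_finite_liminf:
  assumes k: "0 \<le> k" "kn \<longlonglongrightarrow> k" "\<And>n. 0 < kn n"
    and \<nu>: "\<And>n. \<nu> n \<in> bounded_radon_measures S M" "l \<in> bounded_radon_measures S M" "weak_star_conv S \<nu> l"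
  shows "J_fun S \<Lambda> (ennreal k) l \<le> liminf (\<lambda>n. J_fun S \<Lambda> (ennreal (kn n)) (\<nu> n))"
proof -
  have "J_fun S \<Lambda> (ennreal k) l = (\<integral>\<^sup>+\<mu>. entropy_transport S (HK_limit_cost k) 1 \<mu> l \<partial>\<Lambda>)"
    by (rule J_fun_finite_eq[OF k(1) bounded_radon_measuresD(1)[OF \<nu>(2)]])
  also have "\<dots> \<le> (\<integral>\<^sup>+\<mu>. liminf (\<lambda>n. entropy_transport S (HK_limit_cost (kn n)) 1 \<mu> (\<nu> n)) \<partial>\<Lambda>)"
  proof (rule nn_integral_mono)
    fix \<mu> assume "\<mu> \<in> space \<Lambda>"
    then have \<mu>: "\<mu> \<in> bounded_radon_measures S M" by (simp add: space_borel_prob_measure)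
    show "entropy_transport S (HK_limit_cost k) 1 \<mu> l
        \<le> liminf (\<lambda>n. entropy_transport S (HK_limit_cost (kn n)) 1 \<mu> (\<nu> n))"
      by (rule HK_limit_cost_liminf[OF S k(1,2) disjI1[OF k(3)] \<mu> \<mu> weak_star_conv_const \<nu>])
  qed
  also have "\<dots> \<le> liminf (\<lambda>n. \<integral>\<^sup>+\<mu>. entropy_transport S (HK_limit_cost (kn n)) 1 \<mu> (\<nu> n) \<partial>\<Lambda>)"
    by (intro nn_integral_liminf entropy_transport_measurable less_imp_le[OF k(3)] bounded_radon_measuresD(1)[OF \<nu>(1)])
  finally show ?thesis by (simp add: J_fun_ennreal k(3) HK_sq_eq_entropy_transport)
qed

lemma scaled_J_fun:
  assumes "0 < k" "\<nu> \<in> radon_measures S"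
  shows "ennreal (k\<^sup>2) * J_fun S \<Lambda> (ennreal k) \<nu> = (\<integral>\<^sup>+\<mu>. ennreal (k\<^sup>2) * HK_sq S k \<mu> \<nu> \<partial>\<Lambda>)"
  unfolding J_fun_ennreal[OF assms(1)] by (rule nn_integral_cmult[symmetric, OF HK_sq_measurable[OF assms]])

lemma J_fun_infinite: "J_fun S \<Lambda> \<infinity> \<nu> = (\<integral>\<^sup>+\<mu>. W_sq S \<mu> \<nu> \<partial>\<Lambda>)"
  by (simp add: J_fun_def)

lemma J_fun_infinite_limsup:
  assumes k: "(\<lambda>n. ennreal (kn n)) \<longlonglongrightarrow> \<infinity>" "\<And>n. 0 < kn n" and \<nu>: "\<nu> \<in> radon_measures S"
  shows "limsup (\<lambda>n. ennreal ((kn n)\<^sup>2) * J_fun S \<Lambda> (ennreal (kn n)) \<nu>) \<le> J_fun S \<Lambda> \<infinity> \<nu>"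
    (is "limsup ?G \<le> _")
proof -
  have top: "filterlim kn at_top sequentially" using k(1) by (simp add: ennreal_tendsto_top_eq_at_top)
  have step: "limsup ?G \<le> ennreal (1 + e) * J_fun S \<Lambda> \<infinity> \<nu>" if e: "0 < e" for e
  proof -
    obtain K where K: "\<And>k \<mu>. K \<le> k \<Longrightarrow> \<mu> \<in> radon_measures S \<Longrightarrow>
        ennreal (k\<^sup>2) * HK_sq S k \<mu> \<nu> \<le> ennreal (1 + e) * W_sq S \<mu> \<nu>"
      using scaled_HK_sq_le_W_sq[OF compact_imp_bounded[OF S] e] \<nu> by blast
    have "\<forall>\<^sub>F n in sequentially. K \<le> kn n" using top by (simp add: filterlim_at_top)
    then have "\<forall>\<^sub>F n in sequentially. ?G n \<le> ennreal (1 + e) * J_fun S \<Lambda> \<infinity> \<nu>"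
    proof eventually_elim
      case (elim n)
      have "?G n = (\<integral>\<^sup>+\<mu>. ennreal ((kn n)\<^sup>2) * HK_sq S (kn n) \<mu> \<nu> \<partial>\<Lambda>)" by (rule scaled_J_fun[OF k(2) \<nu>])
      also have "\<dots> \<le> (\<integral>\<^sup>+\<mu>. ennreal (1 + e) * W_sq S \<mu> \<nu> \<partial>\<Lambda>)"
        by (intro nn_integral_mono K[OF elim]) (auto simp: space_borel_prob_measure dest: bounded_radon_measuresD(1))
      also have "\<dots> = ennreal (1 + e) * J_fun S \<Lambda> \<infinity> \<nu>"
        unfolding J_fun_infinite by (rule nn_integral_cmult[OF W_sq_measurable[OF \<nu>]])
      finally show ?case .
    qed
    then show ?thesis by (rule Limsup_bounded)
  qed
  show ?thesis
  proof (cases "J_fun S \<Lambda> \<infinity> \<nu>")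
    case (real g)
    show ?thesis
    proof (rule ennreal_le_epsilon)
      fix e :: real assume "0 < e"
      \<comment> \<open>With the finite value g of the limit functional, the relative error e / (g +
        1) is an absolute error of at most e.\<close>
      then have "limsup ?G \<le> ennreal (1 + e / (g + 1)) * J_fun S \<Lambda> \<infinity> \<nu>" using real by (intro step) simp
      also have "\<dots> = ennreal ((1 + e / (g + 1)) * g)" using real \<open>0 < e\<close> by (simp add: ennreal_mult'[symmetric] del: ennreal_plus)
      also have "\<dots> \<le> ennreal (g + e)" using real \<open>0 < e\<close> by (intro ennreal_leI) (simp add: field_simps)
      also have "\<dots> = J_fun S \<Lambda> \<infinity> \<nu> + ennreal e" using real \<open>0 < e\<close> by simp
      finally show "limsup ?G \<le> J_fun S \<Lambda> \<infinity> \<nu> + ennreal e" .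
    qed
  qed simp
qed

lemma J_fun_infinite_liminf:
  assumes k: "(\<lambda>n. ennreal (kn n)) \<longlonglongrightarrow> \<infinity>" "\<And>n. 0 < kn n"
    and \<nu>: "\<And>n. \<nu> n \<in> bounded_radon_measures S M" "l \<in> bounded_radon_measures S M" "weak_star_conv S \<nu> l"
  shows "J_fun S \<Lambda> \<infinity> l \<le> liminf (\<lambda>n. ennreal ((kn n)\<^sup>2) * J_fun S \<Lambda> (ennreal (kn n)) (\<nu> n))"
proof -
  have "J_fun S \<Lambda> \<infinity> l \<le> (\<integral>\<^sup>+\<mu>. liminf (\<lambda>n. ennreal ((kn n)\<^sup>2) * HK_sq S (kn n) \<mu> (\<nu> n)) \<partial>\<Lambda>)"
    unfolding J_fun_infinite
  proof (rule nn_integral_mono)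
    fix \<mu> assume "\<mu> \<in> space \<Lambda>"
    then have \<mu>: "\<mu> \<in> bounded_radon_measures S M" by (simp add: space_borel_prob_measure)
    show "W_sq S \<mu> l \<le> liminf (\<lambda>n. ennreal ((kn n)\<^sup>2) * HK_sq S (kn n) \<mu> (\<nu> n))"
      by (rule W_sq_le_liminf_scaled_HK_sq[OF S k \<mu> \<mu> weak_star_conv_const \<nu>])
  qed
  also have "\<dots> \<le> liminf (\<lambda>n. \<integral>\<^sup>+\<mu>. ennreal ((kn n)\<^sup>2) * HK_sq S (kn n) \<mu> (\<nu> n) \<partial>\<Lambda>)"
    by (intro nn_integral_liminf borel_measurable_times_ennreal borel_measurable_const HK_sq_measurable k(2)
        bounded_radon_measuresD(1)[OF \<nu>(1)])
  finally show ?thesis by (simp add: scaled_J_fun k(2) bounded_radon_measuresD(1)[OF \<nu>(1)])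
qed

end

text \<open>The recovery sequence of each \<rho> is constant, so the upper bound is a plain upper
  limit at fixed \<rho>. The lower bound is required along subsequences, because a cluster point is
  reached only along one.\<close>

lemma gamma_convergence_minimizers:
  fixes S :: "'a::euclidean_space set" and G :: "nat \<Rightarrow> 'a measure \<Rightarrow> ennreal"
  assumes S: "compact S" and \<nu>: "\<And>n. \<nu> n \<in> bounded_radon_measures S M"
    and liminf: "\<And>r l. strict_mono r \<Longrightarrow> l \<in> bounded_radon_measures S M \<Longrightarrow> weak_star_conv S (\<nu> \<circ> r) l \<Longrightarrow>
      G' l \<le> liminf (\<lambda>n. G (r n) (\<nu> (r n)))"
    and limsup: "\<And>\<rho>. \<rho> \<in> radon_measures S \<Longrightarrow> limsup (\<lambda>n. G n \<rho>) \<le> G' \<rho>"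
    and min: "\<And>n \<rho>. \<rho> \<in> radon_measures S \<Longrightarrow> G n (\<nu> n) \<le> G n \<rho>"
    and cl: "cluster_point (weak_star S) \<nu> l"
  shows "\<rho> \<in> radon_measures S \<Longrightarrow> G' l \<le> G' \<rho>" "(\<lambda>n. G n (\<nu> n)) \<longlonglongrightarrow> G' l"
proof -
  define a where "a n = G n (\<nu> n)" for n
  have l: "l \<in> bounded_radon_measures S M" by (rule cluster_point_bounded_radon[OF \<nu> cl])
  have upper: "limsup a \<le> G' \<rho>" if "\<rho> \<in> radon_measures S" for \<rho>
  proof -
    have "limsup a \<le> limsup (\<lambda>n. G n \<rho>)"
      unfolding a_def by (intro Limsup_mono always_eventually allI min that)
    also have "\<dots> \<le> G' \<rho>" by (rule limsup[OF that])
    finally show ?thesis .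
  qed
  obtain r where r: "strict_mono r" "weak_star_conv S (\<nu> \<circ> r) l" by (rule cluster_point_subseq[OF S \<nu> cl])
  have "G' l \<le> liminf (a \<circ> r)" using liminf[OF r(1) l r(2)] by (simp add: a_def o_def)
  also have "\<dots> \<le> limsup (a \<circ> r)" by (rule Liminf_le_Limsup) simp
  also have "\<dots> \<le> limsup a" by (rule limsup_subseq_mono[OF r(1)])
  finally have "G' l \<le> limsup a" .
  then show min': "G' l \<le> G' \<rho>" if "\<rho> \<in> radon_measures S" for \<rho> using upper[OF that] by (rule order_trans)
  \<comment> \<open>Convergence of the whole sequence of minima: values below some C < G' l along a
    subsequence would, by compactness, produce a measure l' with G' l' \<le> C, against the
    minimality of l.\<close>
  have "G' l \<le> liminf a"
  proof (rule ccontr)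
    assume "\<not> ?thesis"
    then have "liminf a < G' l" by simp
    then obtain C where C: "liminf a < C" "C < G' l" using dense by blast
    have "\<not> (\<forall>\<^sub>F n in sequentially. C \<le> a n)" using Liminf_bounded[of C a sequentially] C(1) by auto
    then have "\<exists>\<^sub>F n in sequentially. a n < C" by (simp add: not_eventually not_le)
    from frequently_subseq[OF this]
    obtain p :: "nat \<Rightarrow> nat" where p: "strict_mono p" "\<And>n. a (p n) < C" by blast
    have "\<And>n. (\<nu> \<circ> p) n \<in> bounded_radon_measures S M" using \<nu> by simp
    from radon_seq_compact[OF S this]
    obtain q l' where q: "strict_mono q" "l' \<in> bounded_radon_measures S M" "weak_star_conv S ((\<nu> \<circ> p) \<circ> q) l'" .
    have "G' l' \<le> liminf (\<lambda>n. G ((p \<circ> q) n) (\<nu> ((p \<circ> q) n)))"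
      using liminf[OF strict_mono_o[OF p(1) q(1)] q(2)] q(3) by (simp add: o_assoc)
    also have "\<dots> \<le> liminf (\<lambda>n :: nat. C)"
      using p(2) by (intro Liminf_mono always_eventually allI) (simp add: a_def less_imp_le)
    also have "\<dots> = C" by (simp add: Liminf_const)
    finally have "G' l' \<le> C" .
    moreover have "G' l \<le> G' l'" by (rule min'[OF bounded_radon_measuresD(1)[OF q(2)]])
    ultimately show False using C(2) by simp
  qed
  moreover have "limsup a \<le> G' l" by (rule upper[OF bounded_radon_measuresD(1)[OF l]])
  moreover have "liminf a \<le> limsup a" by (rule Liminf_le_Limsup) simp
  ultimately have "liminf a = G' l" "limsup a = G' l" by auto
  then show "(\<lambda>n. G n (\<nu> n)) \<longlonglongrightarrow> G' l"
    unfolding a_def[symmetric] by (rule Liminf_eq_Limsup[OF sequentially_bot])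
qed

theorem proposition3p4:
  fixes \<Omega> :: "'a::euclidean_space set"
    and M :: real
    and \<Lambda> :: "'a measure measure"
    and \<kappa> :: "nat \<Rightarrow> real"
    and \<kappa>\<^sub>l :: ennreal
    and \<nu> :: "nat \<Rightarrow> 'a measure"
  assumes "compact \<Omega>" "convex \<Omega>" "interior \<Omega> \<noteq> {}"
    and "0 < M"
    and "\<Lambda> \<in> borel_prob_measures (subtopology (weak_star \<Omega>) (bounded_radon_measures \<Omega> M))"
    and "\<And>n. 0 < \<kappa> n"
    and "(\<lambda>n. ennreal (\<kappa> n)) \<longlonglongrightarrow> \<kappa>\<^sub>l"
    and "\<And>n. \<nu> n \<in> bounded_radon_measures \<Omega> M"
    and "\<And>n. is_arg_min (J_fun \<Omega> \<Lambda> (ennreal (\<kappa> n))) (\<lambda>\<nu>'. \<nu>' \<in> radon_measures \<Omega>) (\<nu> n)"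
  shows "precompact_in (weak_star \<Omega>) (range \<nu>) \<and>
    (\<forall>\<nu>\<^sub>l. cluster_point (weak_star \<Omega>) \<nu> \<nu>\<^sub>l \<longrightarrow>
       \<nu>\<^sub>l \<in> bounded_radon_measures \<Omega> M \<and>
       is_arg_min (J_fun \<Omega> \<Lambda> \<kappa>\<^sub>l) (\<lambda>\<nu>'. \<nu>' \<in> radon_measures \<Omega>) \<nu>\<^sub>l \<and>
       (\<kappa>\<^sub>l < \<infinity> \<longrightarrow>
          (\<lambda>n. J_fun \<Omega> \<Lambda> (ennreal (\<kappa> n)) (\<nu> n)) \<longlonglongrightarrow> J_fun \<Omega> \<Lambda> \<kappa>\<^sub>l \<nu>\<^sub>l) \<and>
       (\<kappa>\<^sub>l = \<infinity> \<longrightarrow>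
          (\<lambda>n. ennreal ((\<kappa> n)\<^sup>2) * J_fun \<Omega> \<Lambda> (ennreal (\<kappa> n)) (\<nu> n)) \<longlonglongrightarrow> J_fun \<Omega> \<Lambda> \<infinity> \<nu>\<^sub>l))"
proof (intro conjI allI impI)
  note S = assms(1) and \<Lambda> = assms(5) and kpos = assms(6) and \<nu> = assms(8)
  show "precompact_in (weak_star \<Omega>) (range \<nu>)"
    by (rule precompact_bounded_radon[OF S]) (use \<nu> in blast)
  fix \<nu>\<^sub>l assume cl: "cluster_point (weak_star \<Omega>) \<nu> \<nu>\<^sub>l"
  show l: "\<nu>\<^sub>l \<in> bounded_radon_measures \<Omega> M" by (rule cluster_point_bounded_radon[OF \<nu> cl])
  have min: "J_fun \<Omega> \<Lambda> (ennreal (\<kappa> n)) (\<nu> n) \<le> J_fun \<Omega> \<Lambda> (ennreal (\<kappa> n)) \<rho>" if "\<rho> \<in> radon_measures \<Omega>" for n \<rho>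
    using assms(9)[of n] that unfolding is_arg_min_def by (meson not_le)
  have fin: "(\<rho> \<in> radon_measures \<Omega> \<longrightarrow> J_fun \<Omega> \<Lambda> \<kappa>\<^sub>l \<nu>\<^sub>l \<le> J_fun \<Omega> \<Lambda> \<kappa>\<^sub>l \<rho>) \<and>
      (\<lambda>n. J_fun \<Omega> \<Lambda> (ennreal (\<kappa> n)) (\<nu> n)) \<longlonglongrightarrow> J_fun \<Omega> \<Lambda> \<kappa>\<^sub>l \<nu>\<^sub>l"
    if kfin: "\<kappa>\<^sub>l < \<infinity>" for \<rho>
  proof -
    obtain k where k: "\<kappa>\<^sub>l = ennreal k" "0 \<le> k" using kfin by (cases \<kappa>\<^sub>l) auto
    have lim: "\<kappa> \<longlonglongrightarrow> k"
      using assms(7) kpos k by (simp add: less_imp_le)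
    note R = gamma_convergence_minimizers[OF S \<nu>, where G = "\<lambda>n. J_fun \<Omega> \<Lambda> (ennreal (\<kappa> n))"
        and G' = "J_fun \<Omega> \<Lambda> (ennreal k)", OF _ _ _ cl]
    have A: "J_fun \<Omega> \<Lambda> (ennreal k) l' \<le> liminf (\<lambda>n. J_fun \<Omega> \<Lambda> (ennreal (\<kappa> (r n))) (\<nu> (r n)))"
      if r: "strict_mono r" and l': "l' \<in> bounded_radon_measures \<Omega> M" "weak_star_conv \<Omega> (\<nu> \<circ> r) l'" for r l'
      using J_fun_finite_liminf[OF S \<Lambda> k(2) LIMSEQ_subseq_LIMSEQ[OF lim r], of "\<nu> \<circ> r"] kpos \<nu> l' by simp
    have B: "limsup (\<lambda>n. J_fun \<Omega> \<Lambda> (ennreal (\<kappa> n)) \<rho>) \<le> J_fun \<Omega> \<Lambda> (ennreal k) \<rho>"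
      if "\<rho> \<in> radon_measures \<Omega>" for \<rho>
      by (rule J_fun_finite_limsup[OF S \<Lambda> k(2) lim kpos that])
    show ?thesis unfolding k(1) using R(1)[OF A B min] R(2)[OF A B min] by blast
  qed
  have inf: "(\<rho> \<in> radon_measures \<Omega> \<longrightarrow> J_fun \<Omega> \<Lambda> \<infinity> \<nu>\<^sub>l \<le> J_fun \<Omega> \<Lambda> \<infinity> \<rho>) \<and>
      (\<lambda>n. ennreal ((\<kappa> n)\<^sup>2) * J_fun \<Omega> \<Lambda> (ennreal (\<kappa> n)) (\<nu> n)) \<longlonglongrightarrow> J_fun \<Omega> \<Lambda> \<infinity> \<nu>\<^sub>l"
    if "\<kappa>\<^sub>l = \<infinity>" for \<rho>
  proof -
    have lim: "(\<lambda>n. ennreal (\<kappa> n)) \<longlonglongrightarrow> \<infinity>" using assms(7) that by simp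
    note R = gamma_convergence_minimizers[OF S \<nu>, where G = "\<lambda>n \<rho>. ennreal ((\<kappa> n)\<^sup>2) * J_fun \<Omega> \<Lambda> (ennreal (\<kappa> n)) \<rho>"
        and G' = "J_fun \<Omega> \<Lambda> \<infinity>", OF _ _ _ cl]
    have A: "J_fun \<Omega> \<Lambda> \<infinity> l' \<le> liminf (\<lambda>n. ennreal ((\<kappa> (r n))\<^sup>2) * J_fun \<Omega> \<Lambda> (ennreal (\<kappa> (r n))) (\<nu> (r n)))"
      if r: "strict_mono r" and l': "l' \<in> bounded_radon_measures \<Omega> M" "weak_star_conv \<Omega> (\<nu> \<circ> r) l'" for r l'
      using J_fun_infinite_liminf[OF S \<Lambda>, of "\<kappa> \<circ> r" "\<nu> \<circ> r"] LIMSEQ_subseq_LIMSEQ[OF lim r] kpos \<nu> l'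
      by (simp add: o_def)
    have B: "limsup (\<lambda>n. ennreal ((\<kappa> n)\<^sup>2) * J_fun \<Omega> \<Lambda> (ennreal (\<kappa> n)) \<rho>) \<le> J_fun \<Omega> \<Lambda> \<infinity> \<rho>"
      if "\<rho> \<in> radon_measures \<Omega>" for \<rho>
      by (rule J_fun_infinite_limsup[OF S \<Lambda> lim kpos that])
    \<comment> \<open>Multiplication by a factor that does not depend on \<rho> preserves
      minimality, so the abstract result applies to the scaled functionals.\<close>
    have min': "ennreal ((\<kappa> n)\<^sup>2) * J_fun \<Omega> \<Lambda> (ennreal (\<kappa> n)) (\<nu> n) \<le> ennreal ((\<kappa> n)\<^sup>2) * J_fun \<Omega> \<Lambda> (ennreal (\<kappa> n)) \<rho>"
      if "\<rho> \<in> radon_measures \<Omega>" for n \<rho>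
      by (rule mult_left_mono[OF min[OF that]]) simp
    show ?thesis using R(1)[OF A B min'] R(2)[OF A B min'] by blast
  qed
  show "is_arg_min (J_fun \<Omega> \<Lambda> \<kappa>\<^sub>l) (\<lambda>\<nu>'. \<nu>' \<in> radon_measures \<Omega>) \<nu>\<^sub>l"
  proof -
    have "J_fun \<Omega> \<Lambda> \<kappa>\<^sub>l \<nu>\<^sub>l \<le> J_fun \<Omega> \<Lambda> \<kappa>\<^sub>l \<rho>" if "\<rho> \<in> radon_measures \<Omega>" for \<rho>
      using fin[of \<rho>] inf[of \<rho>] that by (cases "\<kappa>\<^sub>l = \<infinity>") (auto simp: less_top)
    \<comment> \<open>\<open>is_arg_min\<close> only excludes strictly smaller values, so an
      identically infinite functional has every measure as a minimizer.\<close>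
    then show ?thesis unfolding is_arg_min_def using bounded_radon_measuresD(1)[OF l] by (simp add: not_less)
  qed
  show "(\<lambda>n. J_fun \<Omega> \<Lambda> (ennreal (\<kappa> n)) (\<nu> n)) \<longlonglongrightarrow> J_fun \<Omega> \<Lambda> \<kappa>\<^sub>l \<nu>\<^sub>l" if "\<kappa>\<^sub>l < \<infinity>"
    using fin[OF that] by blast
  show "(\<lambda>n. ennreal ((\<kappa> n)\<^sup>2) * J_fun \<Omega> \<Lambda> (ennreal (\<kappa> n)) (\<nu> n)) \<longlonglongrightarrow> J_fun \<Omega> \<Lambda> \<infinity> \<nu>\<^sub>l" if "\<kappa>\<^sub>l = \<infinity>"
    using inf[OF that] by blast
qed

end
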